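(* Let $(\Omega,\Sigma,\mu)$ be a $\sigma$-finite measure space, let $M\colon\Omega\times[0,\infty)\to[0,\infty]$ be a Musielak-Orlicz function, and let $\mathbb{X}$ be a quasi-Banach space endowed with a continuous quasi-norm $\|\cdot\|$. Let $$L_M(\mathbb{X})=\Big\{f\in L(\mu,\mathbb{X})\colon\int_\Omega M(\omega,u\|f(\omega)\|)\,d\mu(\omega)<\infty\text{ for some }u>0\Big\},$$ $$B_M(\varepsilon)=\Big\{f\in L(\mu,\mathbb{X})\colon\int_\Omega M(\omega,\|f(\omega)\|)\,d\mu(\omega)<\varepsilon\Big\},\quad\varepsilon>0.$$ Then $\{uB_M(\varepsilon)\colon u,\varepsilon>0\}$ is a neighbourhood basis at the origin for a complete metrizable vector topology on $L_M(\mathbb{X})$. Moreover, with respect to this topology: (a) If there is $D\in(1,\infty)$ such that $M(\omega,2s)\le D\,M(\omega,s)$ for all $(\omega,s)\in\Omega\times[0,\infty)$, then $\{B_M(\varepsilon)\colon\varepsilon>0\}$ is a neighbourhood basis at the origin for $L_M(\mathbb{X})$, and $L_M(\mathbb{X})=\{f\in L(\mu,\mathbb{X})\colon\int_\Omega M(\omega,\|f(\omega)\|)\,d\mu(\omega)<\infty\}$. (b) If there are $c,d\in(0,1)$ such that $M(\omega,cs)\le d\,M(\omega,s)$ for all $(\omega,s)\in\Omega\times[0,\infty)$, then $L_M(\mathbb{X})$ is a quasi-Banach space, and the map $$f\mapsto\inf\Big\{t>0\colon\int_\Omega M\Big(\omega,\frac{\|f(\omega)\|}{t}\Big)\,d\mu(\omega)<1\Big\}$$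 is a quasi-norm for $L_M(\mathbb{X})$ (inducing its topology).
   Context: Scalars are real or complex, and vector topologies are assumed to be Hausdorff. A topological vector space is complete if every Cauchy net converges. A quasi-norm on a vector space is a map $\|\cdot\|$ into $[0,\infty)$ with $\|x\|>0$ for $x\neq0$, $\|\lambda x\|=|\lambda|\|x\|$, and $\|x+y\|\le\kappa(\|x\|+\|y\|)$ for some constant $\kappa$; a quasi-Banach space is a complete quasi-normed space. $\mathbb{X}$ carries its Borel $\sigma$-algebra, and the quasi-norm is assumed continuous for the topology it induces. $L(\mu,\mathbb{X})$ is the vector space of strongly measurable functions $f\colon\Omega\to\mathbb{X}$ (measurable, with values $\mu$-a.e. in a separable subspace of $\mathbb{X}$), modulo equality $\mu$-a.e. An Orlicz function is a non-decreasing left-continuous function $F\colon[0,\infty)\to[0,\infty]$ such that $\lim_{t\to0^+}F(t)=0$ and $\lim_{t\to\infty}F(t)>0$. A function $M\colon\Omega\times[0,\infty)\to[0,\infty]$, with $M(\cdot,t)$ measurable for each $t\in[0,\infty)$, is a Musielak-Orlicz function if $M(\omega,\cdot)$ is an Orlicz function for every $\omega\in\Omega$, and for every $E\in\Sigma$ with $\mu(E)<\infty$ there is $u_E\in(0,\infty)$ such that $\int_EM(\omega,u_E)\,d\mu(\omega)<\infty$ and $M(\omega,u_E)>0$ for all $\omega\in E$. *)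

theory Defs
  imports "HOL-Analysis.Analysis"
begin

text \<open>
  The scalar field is a type \<open>'k\<close> of class \<open>real_normed_field\<close>. Its norm is multiplicative and
  extends the absolute value of \<open>\<real>\<close>, so by the Gelfand--Mazur theorem (applied to the completion)
  such a field is isometrically \<open>\<real>\<close> or \<open>\<complex>\<close>: this is exactly ``scalars are real or complex''.

  The space \<open>L\<^sub>M(X)\<close> is a set of equivalence classes depending on the measure, hence linear and
  topological notions are relative to a carrier \<open>V\<close>; the space \<open>X\<close> has carrier \<open>UNIV\<close>.
\<close>

locale vector_space_on =
  fixes V :: "'v set"
    and add :: "'v \<Rightarrow> 'v \<Rightarrow> 'v"
    and zero :: 'v
    and smul :: "'k::real_normed_field \<Rightarrow> 'v \<Rightarrow> 'v"
  assumes zero_closed: "zero \<in> V"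
    and add_closed: "\<lbrakk>x \<in> V; y \<in> V\<rbrakk> \<Longrightarrow> add x y \<in> V"
    and smul_closed: "x \<in> V \<Longrightarrow> smul a x \<in> V"
    and add_assoc: "\<lbrakk>x \<in> V; y \<in> V; z \<in> V\<rbrakk> \<Longrightarrow> add (add x y) z = add x (add y z)"
    and add_commute: "\<lbrakk>x \<in> V; y \<in> V\<rbrakk> \<Longrightarrow> add x y = add y x"
    and add_zero: "x \<in> V \<Longrightarrow> add x zero = x"
    and add_inverse: "x \<in> V \<Longrightarrow> \<exists>y\<in>V. add x y = zero"
    and smul_add_right: "\<lbrakk>x \<in> V; y \<in> V\<rbrakk> \<Longrightarrow> smul a (add x y) = add (smul a x) (smul a y)"
    and smul_add_left: "x \<in> V \<Longrightarrow> smul (a + b) x = add (smul a x) (smul b x)"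
    and smul_smul: "x \<in> V \<Longrightarrow> smul a (smul b x) = smul (a * b) x"
    and smul_one: "x \<in> V \<Longrightarrow> smul 1 x = x"

definition vector_topology_on ::
    "'v set \<Rightarrow> ('v \<Rightarrow> 'v \<Rightarrow> 'v) \<Rightarrow> 'v \<Rightarrow> ('k::real_normed_field \<Rightarrow> 'v \<Rightarrow> 'v) \<Rightarrow> 'v topology \<Rightarrow> bool"
  where "vector_topology_on V add zero smul T \<longleftrightarrow>
    vector_space_on V add zero smul \<and> topspace T = V \<and> Hausdorff_space T \<and>
    continuous_map (prod_topology T T) T (\<lambda>(x, y). add x y) \<and>
    continuous_map (prod_topology (euclidean :: 'k topology) T) T (\<lambda>(a, x). smul a x)"

definition nhds_basis_at :: "'v topology \<Rightarrow> 'v \<Rightarrow> 'v set set \<Rightarrow> bool"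
  where "nhds_basis_at T x \<B> \<longleftrightarrow>
    (\<forall>B\<in>\<B>. B \<subseteq> topspace T \<and> (\<exists>U. openin T U \<and> x \<in> U \<and> U \<subseteq> B)) \<and>
    (\<forall>U. openin T U \<and> x \<in> U \<longrightarrow> (\<exists>B\<in>\<B>. B \<subseteq> U))"

definition directed_set :: "'i set \<Rightarrow> ('i \<Rightarrow> 'i \<Rightarrow> bool) \<Rightarrow> bool"
  where "directed_set I le \<longleftrightarrow> I \<noteq> {} \<and> reflp_on I le \<and> transp_on I le \<and>
    (\<forall>i\<in>I. \<forall>j\<in>I. \<exists>k\<in>I. le i k \<and> le j k)"

definition Cauchy_net ::
    "('v \<Rightarrow> 'v \<Rightarrow> 'v) \<Rightarrow> 'v \<Rightarrow> ('k::real_normed_field \<Rightarrow> 'v \<Rightarrow> 'v) \<Rightarrow> 'v topology \<Rightarrow>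
     'i set \<Rightarrow> ('i \<Rightarrow> 'i \<Rightarrow> bool) \<Rightarrow> ('i \<Rightarrow> 'v) \<Rightarrow> bool"
  where "Cauchy_net add zero smul T I le x \<longleftrightarrow>
    directed_set I le \<and> x ` I \<subseteq> topspace T \<and>
    (\<forall>U. openin T U \<and> zero \<in> U \<longrightarrow>
      (\<exists>k\<in>I. \<forall>i\<in>I. \<forall>j\<in>I. le k i \<and> le k j \<longrightarrow> add (x i) (smul (- 1) (x j)) \<in> U))"

definition net_converges ::
    "'v topology \<Rightarrow> 'i set \<Rightarrow> ('i \<Rightarrow> 'i \<Rightarrow> bool) \<Rightarrow> ('i \<Rightarrow> 'v) \<Rightarrow> bool"
  where "net_converges T I le x \<longleftrightarrow>
    (\<exists>l\<in>topspace T. \<forall>U. openin T U \<and> l \<in> U \<longrightarrow> (\<exists>k\<in>I. \<forall>i\<in>I. le k i \<longrightarrow> x i \<in> U))"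

text \<open>
  A definition cannot quantify over all index types. Index sets of type \<open>('v set \<times> 'v) set\<close> suffice:
  lemma \<open>complete_vector_topologyD\<close> below gives convergence of Cauchy nets of every index type.
\<close>

definition complete_vector_topology ::
    "('v \<Rightarrow> 'v \<Rightarrow> 'v) \<Rightarrow> 'v \<Rightarrow> ('k::real_normed_field \<Rightarrow> 'v \<Rightarrow> 'v) \<Rightarrow> 'v topology \<Rightarrow> bool"
  where "complete_vector_topology add zero smul T \<longleftrightarrow>
    (\<forall>(I :: ('v set \<times> 'v) set) le x.
      Cauchy_net add zero smul T I le x \<longrightarrow> net_converges T I le x)"

lemma complete_vector_topologyD:
  fixes I :: "'i set" and x :: "'i \<Rightarrow> 'v"
  assumes complete: "complete_vector_topology add zero smul T"
    and Cauchy: "Cauchy_net add zero smul T I le x"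
  shows "net_converges T I le x"
proof -
  define tail where "tail i = x ` {j \<in> I. le i j}" for i
  define J where "J = {(A, a). A \<in> tail ` I \<and> a \<in> A}"
  define le' where "le' p q \<longleftrightarrow> fst q \<subseteq> fst p" for p q :: "'v set \<times> 'v"
  from Cauchy have dir: "directed_set I le" and sub: "x ` I \<subseteq> topspace T"
    by (auto simp: Cauchy_net_def)
  have refl: "le i i" if "i \<in> I" for i
    using dir that by (auto simp: directed_set_def reflp_on_def)
  have trans: "le i k" if "i \<in> I" "j \<in> I" "k \<in> I" "le i j" "le j k" for i j k
    using dir that unfolding directed_set_def transp_on_def by blast
  have ub: "\<exists>k\<in>I. le i k \<and> le j k" if "i \<in> I" "j \<in> I" for i j
    using dir that by (auto simp: directed_set_def)
  have tail_mono: "tail j \<subseteq> tail i" if "i \<in> I" "j \<in> I" "le i j" for i j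
    using that trans unfolding tail_def by blast
  have in_J: "(tail i, x j) \<in> J" if "i \<in> I" "j \<in> I" "le i j" for i j
    using that by (auto simp: J_def tail_def)
  have J_E: "\<exists>i\<in>I. \<exists>j\<in>I. le i j \<and> p = (tail i, x j)" if "p \<in> J" for p
    using that by (auto simp: J_def tail_def)
  have dir_J: "directed_set J le'"
    unfolding directed_set_def
  proof (intro conjI ballI)
    show "J \<noteq> {}"
      using dir in_J refl unfolding directed_set_def by blast
    show "reflp_on J le'" by (auto simp: reflp_on_def le'_def)
    show "transp_on J le'" by (auto simp: transp_on_def le'_def)
    fix p q assume "p \<in> J" "q \<in> J"
    then obtain i j where ij: "i \<in> I" "j \<in> I" "fst p = tail i" "fst q = tail j"
      using J_E by (metis fst_conv)
    then obtain k where "k \<in> I" "le i k" "le j k" using ub by blast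
    then show "\<exists>r\<in>J. le' p r \<and> le' q r"
      using ij tail_mono in_J[of k k] refl by (intro bexI[of _ "(tail k, x k)"]) (auto simp: le'_def)
  qed
  have "Cauchy_net add zero smul T J le' snd"
    unfolding Cauchy_net_def
  proof (intro conjI allI impI dir_J)
    show "snd ` J \<subseteq> topspace T" using J_E sub by fastforce
    fix U assume "openin T U \<and> zero \<in> U"
    then obtain k where k: "k \<in> I"
      "\<And>i j. \<lbrakk>i \<in> I; j \<in> I; le k i; le k j\<rbrakk> \<Longrightarrow> add (x i) (smul (- 1) (x j)) \<in> U"
      using Cauchy unfolding Cauchy_net_def by meson
    have *: "\<exists>i\<in>I. le k i \<and> snd p = x i" if "p \<in> J" "le' (tail k, x k) p" for p
    proof -
      have "snd p \<in> fst p" using that(1) by (auto simp: J_def)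
      then show ?thesis using that(2) by (auto simp: le'_def tail_def)
    qed
    show "\<exists>r\<in>J. \<forall>p\<in>J. \<forall>q\<in>J. le' r p \<and> le' r q \<longrightarrow> add (snd p) (smul (- 1) (snd q)) \<in> U"
    proof (intro bexI ballI impI)
      show "(tail k, x k) \<in> J" using in_J k(1) refl by blast
      fix p q
      assume "p \<in> J" "q \<in> J" "le' (tail k, x k) p \<and> le' (tail k, x k) q"
      then show "add (snd p) (smul (- 1) (snd q)) \<in> U"
        using *[of p] *[of q] k(2) by metis
    qed
  qed
  with complete have "net_converges T J le' snd"
    by (simp add: complete_vector_topology_def)
  then obtain l where l: "l \<in> topspace T"
    "\<forall>U. openin T U \<and> l \<in> U \<longrightarrow> (\<exists>r\<in>J. \<forall>p\<in>J. le' r p \<longrightarrow> snd p \<in> U)"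
    unfolding net_converges_def by (elim bexE)
  show ?thesis
    unfolding net_converges_def
  proof (intro bexI[OF _ l(1)] allI impI)
    fix U assume "openin T U \<and> l \<in> U"
    then have "\<exists>r\<in>J. \<forall>p\<in>J. le' r p \<longrightarrow> snd p \<in> U"
      using l(2) by simp
    then obtain r where r: "r \<in> J" "\<And>p. \<lbrakk>p \<in> J; le' r p\<rbrakk> \<Longrightarrow> snd p \<in> U"
      by blast
    obtain k where k: "k \<in> I" "fst r = tail k" using J_E[OF r(1)] by auto
    show "\<exists>k\<in>I. \<forall>i\<in>I. le k i \<longrightarrow> x i \<in> U"
    proof (intro bexI ballI impI)
      show "k \<in> I" by fact
      fix i assume "i \<in> I" "le k i"
      then show "x i \<in> U"
        using r(2)[OF in_J[of i i]] tail_mono[of k i] refl k by (auto simp: le'_def)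
    qed
  qed
qed

definition quasi_norm_on ::
    "'v set \<Rightarrow> ('v \<Rightarrow> 'v \<Rightarrow> 'v) \<Rightarrow> 'v \<Rightarrow> ('k::real_normed_field \<Rightarrow> 'v \<Rightarrow> 'v) \<Rightarrow> ('v \<Rightarrow> real) \<Rightarrow> bool"
  where "quasi_norm_on V add zero smul N \<longleftrightarrow>
    vector_space_on V add zero smul \<and>
    (\<forall>x\<in>V. 0 \<le> N x) \<and>
    (\<forall>x\<in>V. x \<noteq> zero \<longrightarrow> 0 < N x) \<and>
    (\<forall>a. \<forall>x\<in>V. N (smul a x) = norm a * N x) \<and>
    (\<exists>\<kappa>. \<forall>x\<in>V. \<forall>y\<in>V. N (add x y) \<le> \<kappa> * (N x + N y))"

text \<open>
  The open sets are those containing, with each point \<open>x\<close>, some translate \<open>x + {y. N y < r}\<close>. (The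
  sets \<open>{y. N y < r}\<close> themselves need not be open when \<open>N\<close> is not continuous.)
\<close>

definition quasi_norm_topology ::
    "'v set \<Rightarrow> ('v \<Rightarrow> 'v \<Rightarrow> 'v) \<Rightarrow> ('v \<Rightarrow> real) \<Rightarrow> 'v topology"
  where "quasi_norm_topology V add N =
    topology (\<lambda>U. U \<subseteq> V \<and> (\<forall>x\<in>U. \<exists>r>0. \<forall>y\<in>V. N y < r \<longrightarrow> add x y \<in> U))"

lemma openin_quasi_norm_topology:
  "openin (quasi_norm_topology V add N) U \<longleftrightarrow>
    U \<subseteq> V \<and> (\<forall>x\<in>U. \<exists>r>0. \<forall>y\<in>V. N y < r \<longrightarrow> add x y \<in> U)"
proof -
  define P where "P U \<longleftrightarrow> U \<subseteq> V \<and> (\<forall>x\<in>U. \<exists>r>0. \<forall>y\<in>V. N y < r \<longrightarrow> add x y \<in> U)" for U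
  have "P (S \<inter> T)" if "P S" "P T" for S T
    unfolding P_def
  proof (intro conjI ballI)
    show "S \<inter> T \<subseteq> V" using that by (auto simp: P_def)
    fix x assume "x \<in> S \<inter> T"
    then obtain r s where rs: "r > 0" "\<forall>y\<in>V. N y < r \<longrightarrow> add x y \<in> S"
      "s > 0" "\<forall>y\<in>V. N y < s \<longrightarrow> add x y \<in> T"
      using \<open>P S\<close> \<open>P T\<close> unfolding P_def by blast
    then show "\<exists>r>0. \<forall>y\<in>V. N y < r \<longrightarrow> add x y \<in> S \<inter> T"
      by (intro exI[of _ "min r s"]) auto
  qed
  moreover have "P (\<Union>\<K>)" if \<K>: "\<forall>K\<in>\<K>. P K" for \<K>
    unfolding P_def
  proof (intro conjI ballI)
    show "\<Union>\<K> \<subseteq> V" using \<K> by (auto simp: P_def)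
    fix x assume "x \<in> \<Union>\<K>"
    then obtain K where K: "K \<in> \<K>" "x \<in> K" by blast
    then obtain r where "r > 0" "\<forall>y\<in>V. N y < r \<longrightarrow> add x y \<in> K"
      using \<K> unfolding P_def by blast
    then show "\<exists>r>0. \<forall>y\<in>V. N y < r \<longrightarrow> add x y \<in> \<Union>\<K>"
      using K(1) by blast
  qed
  ultimately have "istopology P" unfolding istopology_def by blast
  then have "openin (topology P) U \<longleftrightarrow> P U" by (simp add: topology_inverse')
  moreover have "quasi_norm_topology V add N = topology P"
    by (simp only: quasi_norm_topology_def P_def[abs_def])
  ultimately show ?thesis by (simp only: P_def)
qed

definition quasi_Banach_space_on ::
    "'v set \<Rightarrow> ('v \<Rightarrow> 'v \<Rightarrow> 'v) \<Rightarrow> 'v \<Rightarrow> ('k::real_normed_field \<Rightarrow> 'v \<Rightarrow> 'v) \<Rightarrow> ('v \<Rightarrow> real) \<Rightarrow> bool"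
  where "quasi_Banach_space_on V add zero smul N \<longleftrightarrow>
    quasi_norm_on V add zero smul N \<and>
    complete_vector_topology add zero smul (quasi_norm_topology V add N)"

text \<open>Functions on \<open>[0,\<infinity>)\<close> are functions on \<open>real\<close> whose values at negative arguments are irrelevant.\<close>

definition Orlicz_function :: "(real \<Rightarrow> ennreal) \<Rightarrow> bool"
  where "Orlicz_function F \<longleftrightarrow>
    mono_on {0..} F \<and>
    (\<forall>t>0. continuous (at_left t) F) \<and>
    (F \<longlongrightarrow> 0) (at_right 0) \<and>
    (\<exists>l>0. (F \<longlongrightarrow> l) at_top)"

definition Musielak_Orlicz_function :: "'w measure \<Rightarrow> ('w \<Rightarrow> real \<Rightarrow> ennreal) \<Rightarrow> bool"
  where "Musielak_Orlicz_function \<mu> M \<longleftrightarrow>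
    (\<forall>t\<ge>0. (\<lambda>\<omega>. M \<omega> t) \<in> borel_measurable \<mu>) \<and>
    (\<forall>\<omega>\<in>space \<mu>. Orlicz_function (M \<omega>)) \<and>
    (\<forall>E\<in>sets \<mu>. emeasure \<mu> E < \<infinity> \<longrightarrow>
      (\<exists>u>0. (\<integral>\<^sup>+\<omega>\<in>E. M \<omega> u \<partial>\<mu>) < \<infinity> \<and> (\<forall>\<omega>\<in>E. 0 < M \<omega> u)))"

abbreviation quasi_norm_top :: "('x::ab_group_add \<Rightarrow> real) \<Rightarrow> 'x topology"
  where "quasi_norm_top N \<equiv> quasi_norm_topology UNIV (+) N"

definition strongly_measurable ::
    "'w measure \<Rightarrow> ('k::real_normed_field \<Rightarrow> 'x::ab_group_add \<Rightarrow> 'x) \<Rightarrow> ('x \<Rightarrow> real) \<Rightarrow> ('w \<Rightarrow> 'x) set"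
  where "strongly_measurable \<mu> scl N =
    {f. f \<in> measurable \<mu> (sigma UNIV {U. openin (quasi_norm_top N) U}) \<and>
        (\<exists>S. module.subspace scl S \<and> separable_space (subtopology (quasi_norm_top N) S) \<and>
             (AE \<omega> in \<mu>. f \<omega> \<in> S))}"

definition L0 ::
    "'w measure \<Rightarrow> ('k::real_normed_field \<Rightarrow> 'x::ab_group_add \<Rightarrow> 'x) \<Rightarrow> ('x \<Rightarrow> real) \<Rightarrow> ('w \<Rightarrow> 'x) set set"
  where "L0 \<mu> scl N = strongly_measurable \<mu> scl N //
    {(f, g). f \<in> strongly_measurable \<mu> scl N \<and> g \<in> strongly_measurable \<mu> scl N \<and>
             (AE \<omega> in \<mu>. f \<omega> = g \<omega>)}"

text \<open>
  If \<open>X\<close> is not separable, the pointwise sum of two strongly measurable functions may fail to be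
  measurable on the null set where their values leave the separable subspace. The sum of two classes
  is therefore the class of the strongly measurable functions that are almost everywhere equal to it.
\<close>

definition L0_add ::
    "'w measure \<Rightarrow> ('k::real_normed_field \<Rightarrow> 'x::ab_group_add \<Rightarrow> 'x) \<Rightarrow> ('x \<Rightarrow> real) \<Rightarrow>
     ('w \<Rightarrow> 'x) set \<Rightarrow> ('w \<Rightarrow> 'x) set \<Rightarrow> ('w \<Rightarrow> 'x) set"
  where "L0_add \<mu> scl N F G =
    {h \<in> strongly_measurable \<mu> scl N. \<exists>f\<in>F. \<exists>g\<in>G. AE \<omega> in \<mu>. h \<omega> = f \<omega> + g \<omega>}"

definition L0_zero ::
    "'w measure \<Rightarrow> ('k::real_normed_field \<Rightarrow> 'x::ab_group_add \<Rightarrow> 'x) \<Rightarrow> ('x \<Rightarrow> real) \<Rightarrow> ('w \<Rightarrow> 'x) set"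
  where "L0_zero \<mu> scl N = {h \<in> strongly_measurable \<mu> scl N. AE \<omega> in \<mu>. h \<omega> = 0}"

definition L0_smult ::
    "'w measure \<Rightarrow> ('k::real_normed_field \<Rightarrow> 'x::ab_group_add \<Rightarrow> 'x) \<Rightarrow> ('x \<Rightarrow> real) \<Rightarrow>
     'k \<Rightarrow> ('w \<Rightarrow> 'x) set \<Rightarrow> ('w \<Rightarrow> 'x) set"
  where "L0_smult \<mu> scl N a F =
    {h \<in> strongly_measurable \<mu> scl N. \<exists>f\<in>F. AE \<omega> in \<mu>. h \<omega> = scl a (f \<omega>)}"

text \<open>
  In the following, \<open>\<exists>f\<in>F\<close> selects a representative of the class \<open>F\<close>; the integrals do not depend
  on it.
\<close>

definition LM ::
    "'w measure \<Rightarrow> ('w \<Rightarrow> real \<Rightarrow> ennreal) \<Rightarrow> ('k::real_normed_field \<Rightarrow> 'x::ab_group_add \<Rightarrow> 'x) \<Rightarrow>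
     ('x \<Rightarrow> real) \<Rightarrow> ('w \<Rightarrow> 'x) set set"
  where "LM \<mu> M scl N =
    {F \<in> L0 \<mu> scl N. \<exists>f\<in>F. \<exists>u>0. (\<integral>\<^sup>+\<omega>. M \<omega> (u * N (f \<omega>)) \<partial>\<mu>) < \<infinity>}"

definition BM ::
    "'w measure \<Rightarrow> ('w \<Rightarrow> real \<Rightarrow> ennreal) \<Rightarrow> ('k::real_normed_field \<Rightarrow> 'x::ab_group_add \<Rightarrow> 'x) \<Rightarrow>
     ('x \<Rightarrow> real) \<Rightarrow> real \<Rightarrow> ('w \<Rightarrow> 'x) set set"
  where "BM \<mu> M scl N \<epsilon> =
    {F \<in> L0 \<mu> scl N. \<exists>f\<in>F. (\<integral>\<^sup>+\<omega>. M \<omega> (N (f \<omega>)) \<partial>\<mu>) < ennreal \<epsilon>}"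

definition Luxemburg ::
    "'w measure \<Rightarrow> ('w \<Rightarrow> real \<Rightarrow> ennreal) \<Rightarrow> ('x \<Rightarrow> real) \<Rightarrow> ('w \<Rightarrow> 'x) set \<Rightarrow> real"
  where "Luxemburg \<mu> M N F =
    Inf {t. t > 0 \<and> (\<exists>f\<in>F. (\<integral>\<^sup>+\<omega>. M \<omega> (N (f \<omega>) / t) \<partial>\<mu>) < 1)}"

end

theory Submission
  imports Defs
begin

text \<open>
  Idea. For \<open>I f = \<integral> M \<omega> \<parallel>f \<omega>\<parallel>\<close>, the functional \<open>\<rho> f = inf {t > 0. I (f / t) < t}\<close> satisfies
  \<open>\<rho> (f + g) \<le> K max (\<rho> f) (\<rho> g)\<close>, because \<open>\<parallel>x + y\<parallel> \<le> K max \<parallel>x\<parallel> \<parallel>y\<parallel>\<close> gives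
  \<open>I ((f + g) / (K t)) \<le> I (f / t) + I (g / t)\<close>. Multiplication by scalars is continuous at \<open>0\<close> by
  dominated convergence. Such a functional defines a vector topology, which Frink's chain argument
  shows to be metrizable. If the differences of consecutive terms of a sequence satisfy
  \<open>\<rho> < K ^ - i\<close>, then \<open>\<Sum> M \<omega> (K ^ i \<parallel>f (i + 1) \<omega> - f i \<omega>\<parallel>)\<close> is finite almost everywhere, so the
  sequence converges pointwise almost everywhere, and Fatou's lemma gives convergence in \<open>\<rho>\<close>.
\<close>

text \<open>\<open>M \<omega>\<close> need not be convex, so no norm is available and every triangle
  inequality loses a factor. The loss is placed in the scale of the modular, not in its value. The
  condition \<open>I (f / t) < t\<close> ties the two parameters of \<open>u B(\<epsilon>)\<close>
  together, so that a single real functional describes the whole neighbourhood basis. With 1 on the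
  right-hand side it becomes the Luxemburg functional; there the sum of two values below 1 has to be
  brought below 1 again, and this is what the condition in (b) does. The same abstract locale is
  used for \<open>N\<close> on the target space and for \<rho> on the classes. Balls of \<rho> need
  not be open, so open sets are obtained as interiors of balls. Outside a separable set the
  pointwise sum of measurable functions may fail to be measurable. Sums and limits are therefore
  formed with representatives whose values lie everywhere in the closure of one countable set.
  Left-continuity of \<open>M \<omega>\<close> makes \<open>M \<omega> (g \<omega>)\<close>
  measurable in \<omega>. In the Fatou step monotonicity is combined with the quasi-triangle
  inequality, which costs one more factor \<open>K\<close> in the scale.\<close>

context vector_space_on
begin

text \<open>Multiplication by \<open>- 1\<close> takes the place of a subtraction, which the locale
  does not provide. This is the expression that occurs in \<open>Cauchy_net\<close>.\<close>

definition diff :: "'v \<Rightarrow> 'v \<Rightarrow> 'v"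
  where "diff x y = add x (smul (- 1) y)"

lemma zero_add: "x \<in> V \<Longrightarrow> add zero x = x"
  using add_commute add_zero zero_closed by metis

lemma add_cancel:
  assumes "x \<in> V" "y \<in> V" "add x y = x"
  shows "y = zero"
proof -
  obtain z where z: "z \<in> V" "add x z = zero" using add_inverse assms(1) by blast
  have "add (add z x) y = add z x" using add_assoc[of z x y] assms z by simp
  then show ?thesis using add_commute[of z x] z assms zero_add by simp
qed

lemma smul_zero_left: "x \<in> V \<Longrightarrow> smul 0 x = zero"
  using smul_add_left[of x 1 0] smul_one[of x] smul_closed[of x 0] add_cancel[of x "smul 0 x"] by simp

lemma smul_zero_right: "smul a zero = zero"
  using smul_smul[OF zero_closed, of a 0] smul_zero_left[OF zero_closed] by simp

lemma diff_closed: "x \<in> V \<Longrightarrow> y \<in> V \<Longrightarrow> diff x y \<in> V"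
  by (simp add: diff_def add_closed smul_closed)

lemma diff_self: "x \<in> V \<Longrightarrow> diff x x = zero"
  using smul_add_left[of x 1 "- 1"] by (simp add: diff_def smul_one smul_zero_left)

lemma diff_zero: "x \<in> V \<Longrightarrow> diff x zero = x"
  by (simp add: diff_def smul_zero_right add_zero)

lemma add_diff_cancel:
  assumes "x \<in> V" "y \<in> V"
  shows "add x (diff y x) = y"
proof -
  have "add x (diff y x) = add (diff y x) x"
    using assms diff_closed add_commute by blast
  also have "\<dots> = add y (add (smul (- 1) x) x)"
    using assms add_assoc smul_closed unfolding diff_def by simp
  also have "add (smul (- 1) x) x = zero"
    using diff_self[OF assms(1)] add_commute smul_closed assms by (simp add: diff_def)
  finally show ?thesis using assms add_zero by simp
qed

lemma diff_add_cancel: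
  assumes "x \<in> V" "y \<in> V"
  shows "diff (add x y) x = y"
proof -
  have "diff (add x y) x = add (add y x) (smul (- 1) x)"
    using assms add_commute by (simp add: diff_def)
  also have "\<dots> = add y (diff x x)"
    using assms add_assoc smul_closed by (simp add: diff_def)
  finally show ?thesis using assms diff_self add_zero by simp
qed

lemma diff_eq_zero: "x \<in> V \<Longrightarrow> y \<in> V \<Longrightarrow> diff x y = zero \<Longrightarrow> x = y"
  using add_diff_cancel add_zero by metis

lemma diff_commute:
  assumes "x \<in> V" "y \<in> V"
  shows "diff y x = smul (- 1) (diff x y)"
proof -
  have "smul (- 1) (diff x y) = add (smul (- 1) x) (smul (- 1) (smul (- 1) y))"
    using assms smul_add_right smul_closed by (simp add: diff_def)
  also have "smul (- 1) (smul (- 1) y) = y"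
    using assms smul_smul smul_one by simp
  finally show ?thesis using assms add_commute smul_closed by (simp add: diff_def)
qed

lemma diff_triangle:
  assumes "x \<in> V" "y \<in> V" "z \<in> V"
  shows "diff x z = add (diff x y) (diff y z)"
proof -
  have "add (diff x y) (diff y z) = add (add (diff x y) y) (smul (- 1) z)"
    using assms add_assoc[of "diff x y" y "smul (- 1) z"] diff_closed smul_closed
    by (simp add: diff_def[of y z])
  also have "add (diff x y) y = x"
    using assms add_diff_cancel[of y x] add_commute diff_closed by simp
  finally show ?thesis by (simp add: diff_def)
qed

lemma diff_add_add:
  assumes "x \<in> V" "y \<in> V" "x' \<in> V" "y' \<in> V"
  shows "diff (add x y) (add x' y') = add (diff x x') (diff y y')"
proof -
  have s: "smul (- 1) x' \<in> V" "smul (- 1) y' \<in> V" using assms smul_closed by auto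
  have "diff (add x y) (add x' y') = add (add x y) (add (smul (- 1) x') (smul (- 1) y'))"
    using assms smul_add_right by (simp add: diff_def)
  also have "\<dots> = add x (add y (add (smul (- 1) x') (smul (- 1) y')))"
    using assms s add_assoc add_closed by simp
  also have "add y (add (smul (- 1) x') (smul (- 1) y')) =
      add (smul (- 1) x') (add y (smul (- 1) y'))"
    using assms s add_assoc[of y "smul (- 1) x'" "smul (- 1) y'"]
      add_assoc[of "smul (- 1) x'" y "smul (- 1) y'"] add_commute[of y "smul (- 1) x'"] by simp
  also have "add x \<dots> = add (diff x x') (diff y y')"
    using assms s add_assoc add_closed by (simp add: diff_def)
  finally show ?thesis .
qed

text \<open>Separates the change of the vector from the change of the scalar, as joint continuity of
  scalar multiplication requires.\<close>

lemma diff_smul_smul: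
  assumes "x \<in> V" "y \<in> V"
  shows "diff (smul a x) (smul b y) = add (smul a (diff x y)) (smul (a - b) y)"
proof -
  have "add (smul a (diff x y)) (smul (a - b) y) =
      add (add (smul a x) (smul (- a) y)) (smul (a - b) y)"
    using assms smul_add_right smul_smul smul_closed by (simp add: diff_def)
  also have "\<dots> = add (smul a x) (smul (- a + (a - b)) y)"
    using assms smul_add_left[of y "- a" "a - b"] add_assoc smul_closed by simp
  also have "\<dots> = diff (smul a x) (smul b y)"
    using assms smul_smul by (simp add: diff_def)
  finally show ?thesis by simp
qed

end

section \<open>Metrization of quasi-metrics\<close>

text \<open>The starting point is kept apart from the list, so the empty chain is allowed and a
  chain always ends in \<open>last (x # ys)\<close>.\<close>

fun chain_length :: "('v \<Rightarrow> 'v \<Rightarrow> real) \<Rightarrow> 'v \<Rightarrow> 'v list \<Rightarrow> real"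
  where
    "chain_length D x [] = 0"
  | "chain_length D x (y # ys) = D x y + chain_length D y ys"

lemma chain_length_append:
  "chain_length D x (ys @ zs) = chain_length D x ys + chain_length D (last (x # ys)) zs"
  by (induction ys arbitrary: x) auto

text \<open>The induction removes the last point: as soon as the chain without it has length at most
  \<open>s\<close>, that point is the required \<open>v\<close>.\<close>

lemma chain_split:
  assumes "chain_length D x ys > s" "s \<ge> 0"
  shows "\<exists>us v ws. ys = us @ v # ws \<and> chain_length D x us \<le> s \<and> chain_length D x (us @ [v]) > s"
  using assms
proof (induction ys rule: rev_induct)
  case (snoc y ys)
  show ?case
  proof (cases "chain_length D x ys > s")
    case True
    then obtain us v ws where "ys = us @ v # ws" "chain_length D x us \<le> s"
      "chain_length D x (us @ [v]) > s"
      using snoc by blast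
    then show ?thesis by (intro exI[of _ us] exI[of _ v] exI[of _ "ws @ [y]"]) simp
  next
    case False
    then show ?thesis using snoc.prems by (intro exI[of _ ys] exI[of _ y] exI[of _ "[]"]) simp
  qed
qed simp

text \<open>Assumption \<open>three\<close> is Frink's condition. It has three edges because cutting
  a chain near its middle leaves two pieces and the edge between them, and the constant 2 is the one
  that reproduces itself in \<open>le_chain_length\<close>.\<close>

locale quasi_metric =
  fixes V :: "'v set" and D :: "'v \<Rightarrow> 'v \<Rightarrow> real"
  assumes nonneg: "D x y \<ge> 0"
    and zero_iff: "x \<in> V \<Longrightarrow> y \<in> V \<Longrightarrow> D x y = 0 \<longleftrightarrow> x = y"
    and sym: "x \<in> V \<Longrightarrow> y \<in> V \<Longrightarrow> D x y = D y x"
    and three: "x \<in> V \<Longrightarrow> y \<in> V \<Longrightarrow> z \<in> V \<Longrightarrow> w \<in> V \<Longrightarrow>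
      D x w \<le> 2 * max (D x y) (max (D y z) (D z w))"
begin

lemma chain_length_nonneg: "chain_length D x ys \<ge> 0"
  by (induction ys arbitrary: x) (auto simp: nonneg)

text \<open>Frink's induction: cut the chain of length \<open>s\<close> at the edge where the
  partial length exceeds \<open>s / 2\<close>. Both remaining pieces have length at most
  \<open>s / 2\<close>, so by induction their endpoints are at distance at most \<open>s\<close>;
  the edge itself is at most \<open>s\<close>; condition \<open>three\<close> then gives
  \<open>2 * s\<close>.\<close>

lemma le_chain_length:
  assumes "x \<in> V" "set ys \<subseteq> V"
  shows "D x (last (x # ys)) \<le> 2 * chain_length D x ys"
  using assms
proof (induction "length ys" arbitrary: x ys rule: less_induct)
  case less
  define s where "s = chain_length D x ys"
  have s0: "s \<ge> 0" unfolding s_def by (rule chain_length_nonneg)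
  show ?case
  proof (cases "s = 0")
    case True
    show ?thesis
    proof (cases ys)
      case Nil
      then show ?thesis using zero_iff[of x x] less by simp
    next
      case (Cons y zs)
      then have "D x y = 0" "chain_length D y zs = 0"
        using True nonneg[of x y] chain_length_nonneg[of y zs] by (auto simp: s_def)
      then have "x = y" using zero_iff less.prems Cons by simp
      moreover have "D y (last (y # zs)) \<le> 2 * chain_length D y zs"
        using less.prems Cons by (intro less.hyps) auto
      ultimately show ?thesis using Cons nonneg[of x y] by simp
    qed
  next
    case False
    then obtain us v ws where split: "ys = us @ v # ws" "chain_length D x us \<le> s / 2"
        "chain_length D x (us @ [v]) > s / 2"
      using chain_split[of "s / 2" D x ys] s0 by (auto simp: s_def)
    define u where "u = last (x # us)"
    have uV: "u \<in> V" "v \<in> V" "last (v # ws) \<in> V"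
      using less.prems split(1) by (auto simp: u_def)
    have total: "s = chain_length D x us + D u v + chain_length D v ws"
      by (simp add: s_def split(1) chain_length_append u_def)
    have "D x u \<le> s"
      using less.hyps[of us x] split less.prems by (force simp: u_def)
    moreover have "D u v \<le> s"
      using total chain_length_nonneg[of x us] chain_length_nonneg[of v ws] by linarith
    moreover have "chain_length D v ws \<le> s / 2"
      using split(3) total by (simp add: chain_length_append u_def)
    then have "D v (last (v # ws)) \<le> s"
      using less.hyps[of ws v] split(1) less.prems by force
    ultimately have "D x (last (v # ws)) \<le> 2 * s"
      using three[of x u v "last (v # ws)"] less.prems uV by auto
    then show ?thesis by (simp add: split(1) s_def)
  qed
qed

definition chain_dist :: "'v \<Rightarrow> 'v \<Rightarrow> real"
  where "chain_dist x y = Inf {chain_length D x ys | ys. set ys \<subseteq> V \<and> last (x # ys) = y}"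

lemma chain_dist_le:
  assumes "set ys \<subseteq> V" "last (x # ys) = y"
  shows "chain_dist x y \<le> chain_length D x ys"
  unfolding chain_dist_def
  using assms chain_length_nonneg by (intro cInf_lower bdd_belowI[where m = 0]) auto

lemma chain_dist_greatest:
  assumes "y \<in> V"
    and "\<And>ys. set ys \<subseteq> V \<Longrightarrow> last (x # ys) = y \<Longrightarrow> c \<le> chain_length D x ys"
  shows "c \<le> chain_dist x y"
  unfolding chain_dist_def
proof (rule cInf_greatest)
  have "chain_length D x [y] \<in> {chain_length D x ys | ys. set ys \<subseteq> V \<and> last (x # ys) = y}"
    using assms(1) by (intro CollectI exI[of _ "[y]"]) auto
  then show "{chain_length D x ys | ys. set ys \<subseteq> V \<and> last (x # ys) = y} \<noteq> {}" by blast
qed (use assms in auto)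

lemma chain_dist_le_D: "y \<in> V \<Longrightarrow> chain_dist x y \<le> D x y"
  using chain_dist_le[of "[y]" x y] by simp

lemma D_le_chain_dist: "x \<in> V \<Longrightarrow> y \<in> V \<Longrightarrow> D x y / 2 \<le> chain_dist x y"
  using le_chain_length by (intro chain_dist_greatest) fastforce+

lemma chain_dist_triangle:
  assumes "x \<in> V" "y \<in> V" "z \<in> V"
  shows "chain_dist x z \<le> chain_dist x y + chain_dist y z"
proof -
  have *: "chain_dist x z - chain_length D x ys \<le> chain_dist y z"
    if "set ys \<subseteq> V" "last (x # ys) = y" for ys
  proof (rule chain_dist_greatest[OF assms(3)])
    fix zs assume "set zs \<subseteq> V" "last (y # zs) = z"
    then have "chain_dist x z \<le> chain_length D x (ys @ zs)"
      using that by (intro chain_dist_le) auto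
    then show "chain_dist x z - chain_length D x ys \<le> chain_length D y zs"
      using that by (simp add: chain_length_append)
  qed
  have "chain_dist x z - chain_dist y z \<le> chain_dist x y"
    using * by (intro chain_dist_greatest[OF assms(2)]) fastforce
  then show ?thesis by simp
qed

text \<open>The maximum over both directions gives symmetry without reversing chains. The value 0
  off the carrier is there because \<open>Metric_space\<close> demands nonnegativity and symmetry
  for all arguments.\<close>

definition metric :: "'v \<Rightarrow> 'v \<Rightarrow> real"
  where "metric x y = (if x \<in> V \<and> y \<in> V then max (chain_dist x y) (chain_dist y x) else 0)"

lemma metric_le: "x \<in> V \<Longrightarrow> y \<in> V \<Longrightarrow> metric x y \<le> D x y"
  using chain_dist_le_D[of y x] chain_dist_le_D[of x y] sym[of x y] by (simp add: metric_def)

lemma le_metric: "x \<in> V \<Longrightarrow> y \<in> V \<Longrightarrow> D x y \<le> 2 * metric x y"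
  using D_le_chain_dist[of x y] by (simp add: metric_def max_def)

lemma Metric_space_metric: "Metric_space V metric"
proof
  fix x y
  show "0 \<le> metric x y"
  proof (cases "x \<in> V \<and> y \<in> V")
    case True
    then show ?thesis using le_metric[of x y] nonneg[of x y] by linarith
  qed (auto simp: metric_def)
  show "metric x y = metric y x" by (auto simp: metric_def)
next
  fix x y assume V: "x \<in> V" "y \<in> V"
  show "metric x y = 0 \<longleftrightarrow> x = y"
    using metric_le[OF V] le_metric[OF V] nonneg[of x y] zero_iff[OF V] by auto
next
  fix x y z assume V: "x \<in> V" "y \<in> V" "z \<in> V"
  then show "metric x z \<le> metric x y + metric y z"
    using chain_dist_triangle[of x y z] chain_dist_triangle[of z y x]
    by (auto simp: metric_def max_def)
qed

end

section \<open>Topologies of quasi-F-norms\<close>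

text \<open>Homogeneity of a quasi-norm is weakened to \<open>rho_smul\<close> and
  \<open>rho_smul_small\<close>, which are what continuity of scalar multiplication uses. Both
  \<open>N\<close> and the functional on classes are instances.\<close>

locale quasi_F_norm = vector_space_on V add zero smul
  for V :: "'v set" and add zero and smul :: "'k::real_normed_field \<Rightarrow> 'v \<Rightarrow> 'v" +
  fixes \<rho> :: "'v \<Rightarrow> real" and C :: real
  assumes C_ge_1: "C \<ge> 1"
    and rho_nonneg: "x \<in> V \<Longrightarrow> \<rho> x \<ge> 0"
    and rho_zeroD: "x \<in> V \<Longrightarrow> \<rho> x = 0 \<Longrightarrow> x = zero"
    and rho_add: "x \<in> V \<Longrightarrow> y \<in> V \<Longrightarrow> \<rho> (add x y) \<le> C * max (\<rho> x) (\<rho> y)"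
    and rho_smul: "x \<in> V \<Longrightarrow> \<rho> (smul a x) \<le> max 1 (norm a) * \<rho> x"
    and rho_smul_small: "x \<in> V \<Longrightarrow> r > 0 \<Longrightarrow> \<exists>\<delta>>0. \<forall>a. norm a < \<delta> \<longrightarrow> \<rho> (smul a x) < r"
begin

abbreviation "T \<equiv> quasi_norm_topology V add \<rho>"

lemma rho_zero: "\<rho> zero = 0"
proof (rule ccontr)
  assume "\<rho> zero \<noteq> 0"
  then have "\<rho> zero > 0" using rho_nonneg[OF zero_closed] by simp
  then obtain \<delta> where "\<delta> > 0" "\<forall>a::'k. norm a < \<delta> \<longrightarrow> \<rho> (smul a zero) < \<rho> zero"
    using rho_smul_small[OF zero_closed] by blast
  then show False using smul_zero_right[of 0] by (metis norm_zero less_irrefl)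
qed

lemma rho_diff_commute:
  assumes "x \<in> V" "y \<in> V"
  shows "\<rho> (diff x y) = \<rho> (diff y x)"
proof (rule antisym)
  show "\<rho> (diff x y) \<le> \<rho> (diff y x)"
    using rho_smul[of "diff y x" "- 1"] diff_commute[of y x] assms diff_closed by simp
  show "\<rho> (diff y x) \<le> \<rho> (diff x y)"
    using rho_smul[of "diff x y" "- 1"] diff_commute[of x y] assms diff_closed by simp
qed

lemma rho_diff_triangle:
  assumes "x \<in> V" "y \<in> V" "z \<in> V"
  shows "\<rho> (diff x z) \<le> C * max (\<rho> (diff x y)) (\<rho> (diff y z))"
  using rho_add[of "diff x y" "diff y z"] assms diff_triangle[of x y z] diff_closed by simp

lemma rho_add_less:
  assumes "x \<in> V" "y \<in> V" "\<rho> x < r / C" "\<rho> y < r / C"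
  shows "\<rho> (add x y) < r"
proof -
  have "C * max (\<rho> x) (\<rho> y) < r" using C_ge_1 assms by (simp add: max_def field_simps)
  then show ?thesis using rho_add[of x y] assms by simp
qed

lemma rho_diff_less:
  assumes "x \<in> V" "y \<in> V" "z \<in> V" "\<rho> (diff x y) < r / C" "\<rho> (diff y z) < r / C"
  shows "\<rho> (diff x z) < r"
  using rho_add_less[of "diff x y" "diff y z" r] assms diff_triangle[of x y z] diff_closed by simp

lemma openin_T:
  "openin T U \<longleftrightarrow> U \<subseteq> V \<and> (\<forall>x\<in>U. \<exists>r>0. \<forall>y\<in>V. \<rho> (diff y x) < r \<longrightarrow> y \<in> U)"
proof -
  have "(\<forall>y\<in>V. \<rho> y < r \<longrightarrow> add x y \<in> U) \<longleftrightarrow> (\<forall>y\<in>V. \<rho> (diff y x) < r \<longrightarrow> y \<in> U)"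
    if x: "x \<in> V" for x r
  proof (intro iffI ballI impI)
    fix y assume *: "\<forall>y\<in>V. \<rho> y < r \<longrightarrow> add x y \<in> U" and y: "y \<in> V" "\<rho> (diff y x) < r"
    then have "add x (diff y x) \<in> U" using diff_closed[OF y(1) x] by blast
    then show "y \<in> U" using add_diff_cancel[OF x y(1)] by simp
  next
    fix y assume *: "\<forall>y\<in>V. \<rho> (diff y x) < r \<longrightarrow> y \<in> U" and y: "y \<in> V" "\<rho> y < r"
    then have "\<rho> (diff (add x y) x) < r" using diff_add_cancel[OF x y(1)] by simp
    then show "add x y \<in> U" using * add_closed[OF x y(1)] by blast
  qed
  then show ?thesis
    unfolding openin_quasi_norm_topology by blast
qed

lemma topspace_T: "topspace T = V"
proof
  have "openin T V" unfolding openin_T using zero_less_one by blast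
  then show "V \<subseteq> topspace T" by (rule openin_subset)
  show "topspace T \<subseteq> V" using openin_topspace[of T] unfolding openin_T by blast
qed

text \<open>The ball itself need not be open; \<open>U\<close> is its interior. If the
  \<open>s\<close>-ball around \<open>y\<close> lies in the ball and \<open>z\<close> is within
  \<open>s / C\<close> of \<open>y\<close>, then so does the \<open>s / C\<close>-ball around
  \<open>z\<close>, and therefore \<open>U\<close> is open.\<close>

lemma open_nhd:
  assumes "x \<in> V" "r > 0"
  shows "\<exists>U. openin T U \<and> x \<in> U \<and> (\<forall>y\<in>U. \<rho> (diff y x) < r)"
proof -
  define U where "U = {y \<in> V. \<exists>s>0. \<forall>z\<in>V. \<rho> (diff z y) < s \<longrightarrow> \<rho> (diff z x) < r}"
  have "openin T U"
    unfolding openin_T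
  proof (intro conjI ballI)
    fix y assume "y \<in> U"
    then obtain s where y: "y \<in> V" and s: "s > 0" "\<forall>z\<in>V. \<rho> (diff z y) < s \<longrightarrow> \<rho> (diff z x) < r"
      by (auto simp: U_def)
    have "z \<in> U" if z: "z \<in> V" "\<rho> (diff z y) < s / C" for z
    proof -
      have "\<rho> (diff w x) < r" if "w \<in> V" "\<rho> (diff w z) < s / C" for w
        using rho_diff_less[of w z y s] s y z that by blast
      moreover have "s / C > 0" using s C_ge_1 by simp
      ultimately show ?thesis using z unfolding U_def by blast
    qed
    moreover have "s / C > 0" using s C_ge_1 by simp
    ultimately show "\<exists>r>0. \<forall>z\<in>V. \<rho> (diff z y) < r \<longrightarrow> z \<in> U" by blast
  qed (auto simp: U_def)
  moreover have "x \<in> U" using assms by (auto simp: U_def)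
  moreover have "\<rho> (diff y x) < r" if "y \<in> U" for y
    using that diff_self rho_zero unfolding U_def by force
  ultimately show ?thesis by blast
qed

text \<open>The members of the basis need not be open: each one contains a ball, and
  \<open>open_nhd\<close> puts an open set inside that ball.\<close>

lemma nhds_basis_at_zero:
  assumes "\<And>B. B \<in> \<B> \<Longrightarrow> B \<subseteq> V \<and> (\<exists>r>0. \<forall>x\<in>V. \<rho> x < r \<longrightarrow> x \<in> B)"
    and "\<And>r. r > 0 \<Longrightarrow> \<exists>B\<in>\<B>. \<forall>x\<in>B. \<rho> x < r"
  shows "nhds_basis_at T zero \<B>"
  unfolding nhds_basis_at_def topspace_T
proof (intro conjI ballI allI impI)
  fix B assume "B \<in> \<B>"
  note B = assms(1)[OF this]
  then show "B \<subseteq> V" by blast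
  obtain r where r: "r > 0" "\<forall>x\<in>V. \<rho> x < r \<longrightarrow> x \<in> B" using B by blast
  obtain U where U: "openin T U" "zero \<in> U" "\<forall>y\<in>U. \<rho> (diff y zero) < r"
    using open_nhd[OF zero_closed r(1)] by blast
  have "U \<subseteq> V" using U(1) openin_T by blast
  then have "U \<subseteq> B" using U(3) r(2) diff_zero by force
  then show "\<exists>U. openin T U \<and> zero \<in> U \<and> U \<subseteq> B" using U by blast
next
  fix U assume U: "openin T U \<and> zero \<in> U"
  then obtain r where r: "r > 0" "\<forall>y\<in>V. \<rho> (diff y zero) < r \<longrightarrow> y \<in> U"
    unfolding openin_T by blast
  then obtain B where "B \<in> \<B>" "\<forall>x\<in>B. \<rho> x < r" using assms(2) by blast
  then show "\<exists>B\<in>\<B>. B \<subseteq> U" using r(2) assms(1) diff_zero by (metis subset_iff)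
qed

text \<open>Openness speaks only of small translates, so it is enough that each functional is small
  where the other one is. This applies to the Luxemburg functional ahead of any proof that it is a
  quasi-norm.\<close>

lemma topology_eqI:
  assumes "\<And>r. r > 0 \<Longrightarrow> \<exists>s>0. \<forall>x\<in>V. \<rho> x < s \<longrightarrow> \<rho>' x < r"
    and "\<And>r. r > 0 \<Longrightarrow> \<exists>s>0. \<forall>x\<in>V. \<rho>' x < s \<longrightarrow> \<rho> x < r"
  shows "quasi_norm_topology V add \<rho>' = T"
proof -
  have sub: "openin (quasi_norm_topology V add \<sigma>') U"
    if U: "openin (quasi_norm_topology V add \<sigma>) U"
      and *: "\<And>r. r > 0 \<Longrightarrow> \<exists>s>0. \<forall>x\<in>V. \<sigma>' x < s \<longrightarrow> \<sigma> x < r" for \<sigma> \<sigma>' U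
    unfolding openin_quasi_norm_topology
  proof (intro conjI ballI)
    show "U \<subseteq> V" using U by (simp add: openin_quasi_norm_topology)
    fix x assume "x \<in> U"
    then obtain r where r: "r > 0" "\<forall>y\<in>V. \<sigma> y < r \<longrightarrow> add x y \<in> U"
      using U by (auto simp: openin_quasi_norm_topology)
    then obtain s where "s > 0" "\<forall>x\<in>V. \<sigma>' x < s \<longrightarrow> \<sigma> x < r" using * by blast
    then show "\<exists>s>0. \<forall>y\<in>V. \<sigma>' y < s \<longrightarrow> add x y \<in> U" using r by blast
  qed
  have "openin (quasi_norm_topology V add \<rho>') U \<longleftrightarrow> openin T U" for U
    using sub[of \<rho>' U \<rho>] sub[of \<rho> U \<rho>'] assms by blast
  then show ?thesis by (simp add: topology_eq)
qed

text \<open>If \<open>C ^ (2 p) \<le> 2\<close>, then the power \<open>p\<close> of the distance satisfies Frink's condition.\<close>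

lemma metrizable_space_T: "metrizable_space T"
proof -
  \<comment> \<open>The exponent is chosen so that \<open>(C * C) powr p = 2\<close>; for
    \<open>C = 1\<close> there is no logarithm to this base and every positive exponent works. The
    square of \<open>C\<close> comes from two uses of the triangle inequality along three
    edges.\<close>
  define p where "p = (if C = 1 then 1 else log (C * C) 2)"
  have p: "p > 0" "(C * C) powr p \<le> 2"
  proof -
    have "C * C > 1" if "C \<noteq> 1"
      using C_ge_1 that by (simp add: less_1_mult)
    then show "p > 0" "(C * C) powr p \<le> 2" using C_ge_1 by (auto simp: p_def)
  qed
  define D where "D x y = (if x \<in> V \<and> y \<in> V then \<rho> (diff x y) powr p else 0)" for x y
  interpret quasi_metric V D
  proof
    fix x y show "D x y \<ge> 0" by (simp add: D_def)
  next
    fix x y assume V: "x \<in> V" "y \<in> V"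
    then show "D x y = 0 \<longleftrightarrow> x = y"
      using rho_zeroD[of "diff x y"] diff_self[of x] rho_zero diff_eq_zero[of x y] diff_closed
      by (auto simp: D_def)
    show "D x y = D y x" using V rho_diff_commute by (simp add: D_def)
  next
    fix x y z w assume V: "x \<in> V" "y \<in> V" "z \<in> V" "w \<in> V"
    define m where "m = max (\<rho> (diff x y)) (max (\<rho> (diff y z)) (\<rho> (diff z w)))"
    have m0: "m \<ge> 0" using V rho_nonneg diff_closed by (simp add: m_def max_def)
    have "C * max (\<rho> (diff y z)) (\<rho> (diff z w)) \<le> C * m"
      using C_ge_1 by (intro mult_left_mono) (auto simp: m_def)
    then have "\<rho> (diff y w) \<le> C * m" using rho_diff_triangle[of y z w] V by linarith
    moreover have "\<rho> (diff x y) \<le> C * m"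
      using mult_right_mono[OF C_ge_1 m0] by (simp add: m_def)
    ultimately have "C * max (\<rho> (diff x y)) (\<rho> (diff y w)) \<le> C * (C * m)"
      using C_ge_1 by (intro mult_left_mono) auto
    then have "\<rho> (diff x w) \<le> (C * C) * m" using rho_diff_triangle[of x y w] V by simp
    then have "\<rho> (diff x w) powr p \<le> ((C * C) * m) powr p"
      using V p rho_nonneg diff_closed by (intro powr_mono2) auto
    also have "\<dots> = (C * C) powr p * m powr p" using C_ge_1 m0 by (simp add: powr_mult)
    also have "\<dots> \<le> 2 * m powr p" using p by (intro mult_right_mono) auto
    also have "m powr p \<le> max (D x y) (max (D y z) (D z w))"
      using V by (simp add: m_def D_def max_def)
    finally show "D x w \<le> 2 * max (D x y) (max (D y z) (D z w))"
      using V by (simp add: D_def)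
  qed
  interpret M: Metric_space V metric by (rule Metric_space_metric)
  have small: "D y x < s powr p" if "x \<in> V" "y \<in> V" "\<rho> (diff y x) < s" for x y s
    using that p rho_nonneg[of "diff y x"] diff_closed by (simp add: D_def powr_less_mono2)
  have small': "\<rho> (diff y x) < s" if "x \<in> V" "y \<in> V" "D y x < s powr p" "s > 0" for x y s
    using that p powr_mono2[of p s "\<rho> (diff y x)"] by (force simp: D_def)
  have "openin T U \<longleftrightarrow> openin M.mtopology U" for U
    unfolding openin_T M.openin_mtopology
  proof (intro conj_cong refl iffI allI ballI impI)
    fix x assume U: "U \<subseteq> V" "\<forall>x\<in>U. \<exists>r>0. \<forall>y\<in>V. \<rho> (diff y x) < r \<longrightarrow> y \<in> U" and x: "x \<in> U"
    then obtain r where r: "r > 0" "\<forall>y\<in>V. \<rho> (diff y x) < r \<longrightarrow> y \<in> U" by blast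
    \<comment> \<open>The radius is halved because \<open>D\<close> is only bounded by twice the
      metric.\<close>
    have "y \<in> U" if "y \<in> M.mball x (r powr p / 2)" for y
    proof -
      have y: "x \<in> V" "y \<in> V" "metric x y < r powr p / 2" using that by auto
      then have "D y x < r powr p" using le_metric[of y x] M.commute[of x y] by simp
      then show ?thesis using small' y r by blast
    qed
    moreover have "r powr p / 2 > 0" using r by simp
    ultimately show "\<exists>r>0. M.mball x r \<subseteq> U" by blast
  next
    fix x assume U: "U \<subseteq> V" "\<forall>x. x \<in> U \<longrightarrow> (\<exists>r>0. M.mball x r \<subseteq> U)" and x: "x \<in> U"
    then obtain r where r: "r > 0" "M.mball x r \<subseteq> U" by blast
    have "y \<in> U" if "y \<in> V" "\<rho> (diff y x) < r powr (1 / p)" for y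
    proof -
      have V: "x \<in> V" using x U by blast
      have "D y x < r" using small[OF V that] r p by (simp add: powr_powr)
      then have "metric x y < r" using metric_le[of y x] M.commute[of x y] V that by simp
      then show ?thesis using r V that by auto
    qed
    moreover have "r powr (1 / p) > 0" using r by simp
    ultimately show "\<exists>r>0. \<forall>y\<in>V. \<rho> (diff y x) < r \<longrightarrow> y \<in> U" by blast
  qed
  then have "T = M.mtopology" by (simp add: topology_eq)
  then show ?thesis using M.metrizable_space_mtopology by simp
qed

section \<open>Continuity of the vector operations\<close>

lemma continuous_map_add: "continuous_map (prod_topology T T) T (\<lambda>(x, y). add x y)"
  unfolding continuous_map topspace_prod_topology topspace_T
proof (intro conjI allI impI)
  show "(\<lambda>(x, y). add x y) ` (V \<times> V) \<subseteq> V" using add_closed by auto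
  fix U assume U: "openin T U"
  show "openin (prod_topology T T) {x \<in> V \<times> V. (case x of (x, y) \<Rightarrow> add x y) \<in> U}"
    unfolding openin_prod_topology_alt
  proof (intro allI impI)
    fix x y assume "(x, y) \<in> {x \<in> V \<times> V. (case x of (x, y) \<Rightarrow> add x y) \<in> U}"
    then have V: "x \<in> V" "y \<in> V" "add x y \<in> U" by auto
    then obtain r where r: "r > 0" "\<forall>z\<in>V. \<rho> (diff z (add x y)) < r \<longrightarrow> z \<in> U"
      using U unfolding openin_T by blast
    then have r': "r / C > 0" using C_ge_1 by simp
    obtain A where A: "openin T A" "x \<in> A" "\<forall>y\<in>A. \<rho> (diff y x) < r / C"
      using open_nhd[OF V(1) r'] by blast
    obtain B where B: "openin T B" "y \<in> B" "\<forall>x\<in>B. \<rho> (diff x y) < r / C"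
      using open_nhd[OF V(2) r'] by blast
    have sub: "A \<subseteq> V" "B \<subseteq> V" using A(1) B(1) openin_T by auto
    have "add a b \<in> U" if ab: "a \<in> A" "b \<in> B" for a b
    proof -
      have abV: "a \<in> V" "b \<in> V" using ab sub by auto
      have "\<rho> (diff (add a b) (add x y)) < r"
        using rho_add_less[of "diff a x" "diff b y" r] diff_add_add[of a b x y]
          diff_closed abV V A(3) B(3) ab by simp
      then show ?thesis using r(2) add_closed[OF abV] by blast
    qed
    then have "A \<times> B \<subseteq> {x \<in> V \<times> V. (case x of (x, y) \<Rightarrow> add x y) \<in> U}" using sub by auto
    then show "\<exists>A B. openin T A \<and> openin T B \<and> x \<in> A \<and> y \<in> B \<and>
        A \<times> B \<subseteq> {x \<in> V \<times> V. (case x of (x, y) \<Rightarrow> add x y) \<in> U}"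
      using A B by blast
  qed
qed

text \<open>Writes \<open>b y - a x = b (y - x) + (b - a) x\<close>. For \<open>b\<close> within 1
  of \<open>a\<close> the first term is controlled by \<open>rho_smul\<close> with the fixed factor
  \<open>norm a + 1\<close>, and the second by \<open>rho_smul_small\<close> at the fixed vector
  \<open>x\<close>.\<close>

lemma continuous_map_smul:
  "continuous_map (prod_topology euclidean T) T (\<lambda>(a, x). smul a x)"
  unfolding continuous_map topspace_prod_topology topspace_T topspace_euclidean
proof (intro conjI allI impI)
  show "(\<lambda>(a, x). smul a x) ` (UNIV \<times> V) \<subseteq> V" using smul_closed by auto
  fix U assume U: "openin T U"
  show "openin (prod_topology euclidean T)
      {x \<in> UNIV \<times> V. (case x of (a, x) \<Rightarrow> smul a x) \<in> U}"
    unfolding openin_prod_topology_alt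
  proof (intro allI impI)
    fix a :: 'k and x assume "(a, x) \<in> {x \<in> UNIV \<times> V. (case x of (a, x) \<Rightarrow> smul a x) \<in> U}"
    then have V: "x \<in> V" "smul a x \<in> U" by auto
    then obtain r where r: "r > 0" "\<forall>z\<in>V. \<rho> (diff z (smul a x)) < r \<longrightarrow> z \<in> U"
      using U unfolding openin_T by blast
    then have r': "r / C > 0" using C_ge_1 by simp
    obtain \<delta> where \<delta>: "\<delta> > 0" "\<forall>b. norm b < \<delta> \<longrightarrow> \<rho> (smul b x) < r / C"
      using rho_smul_small[OF V(1) r'] by blast
    define K where "K = norm a + 1"
    have K: "K \<ge> 1" by (simp add: K_def)
    have "r / C / K > 0" using divide_pos_pos[OF r', of K] K by linarith
    then obtain B where B: "openin T B" "x \<in> B" "\<forall>y\<in>B. \<rho> (diff y x) < r / C / K"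
      using open_nhd[OF V(1)] by blast
    have sub: "B \<subseteq> V" using B(1) openin_T by auto
    have "smul b y \<in> U" if yb: "b \<in> ball a (min 1 \<delta>)" "y \<in> B" for b y
    proof -
      have yV: "y \<in> V" "diff y x \<in> V" using yb sub V diff_closed by auto
      have b: "norm (b - a) < \<delta>" "norm (b - a) < 1"
        using yb by (auto simp: dist_norm norm_minus_commute)
      have "norm b \<le> norm a + norm (b - a)" by (metis norm_triangle_sub)
      then have "max 1 (norm b) \<le> K" using b by (simp add: K_def)
      then have "\<rho> (smul b (diff y x)) \<le> K * \<rho> (diff y x)"
        using rho_smul[of "diff y x" b] mult_right_mono[of "max 1 (norm b)" K "\<rho> (diff y x)"]
          rho_nonneg[of "diff y x"] yV by linarith
      also have "\<rho> (diff y x) < r / C / K" using B(3) yb(2) by blast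
      then have "K * \<rho> (diff y x) < r / C"
        using pos_less_divide_eq[of K "\<rho> (diff y x)" "r / C"] K by (simp add: mult.commute)
      finally have "\<rho> (smul b (diff y x)) < r / C" .
      then have "\<rho> (diff (smul b y) (smul a x)) < r"
        using rho_add_less[of "smul b (diff y x)" "smul (b - a) x" r] diff_smul_smul[of y x b a]
          yV V smul_closed \<delta>(2) b by simp
      then show ?thesis using r(2) smul_closed yV by blast
    qed
    then have "ball a (min 1 \<delta>) \<times> B \<subseteq> {x \<in> UNIV \<times> V. (case x of (a, x) \<Rightarrow> smul a x) \<in> U}"
      using sub by auto
    moreover have "a \<in> ball a (min 1 \<delta>)" using \<delta> by simp
    ultimately show "\<exists>A B. openin euclidean A \<and> openin T B \<and> a \<in> A \<and> x \<in> B \<and>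
        A \<times> B \<subseteq> {x \<in> UNIV \<times> V. (case x of (a, x) \<Rightarrow> smul a x) \<in> U}"
      using B by (intro exI[of _ "ball a (min 1 \<delta>)"] exI[of _ B]) auto
  qed
qed

lemma vector_topology_on_T: "vector_topology_on V add zero smul T"
  unfolding vector_topology_on_def
  using continuous_map_add continuous_map_smul topspace_T metrizable_space_T vector_space_on_axioms
  by (auto intro: metrizable_imp_Hausdorff_space)

section \<open>Reduction of completeness to sequences\<close>

definition Cauchy_seq :: "(nat \<Rightarrow> 'v) \<Rightarrow> bool"
  where "Cauchy_seq y \<longleftrightarrow> range y \<subseteq> V \<and>
    (\<forall>r>0. \<exists>k. \<forall>m\<ge>k. \<forall>n\<ge>k. \<rho> (diff (y m) (y n)) < r)"

definition converges_to :: "(nat \<Rightarrow> 'v) \<Rightarrow> 'v \<Rightarrow> bool"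
  where "converges_to y l \<longleftrightarrow> l \<in> V \<and> (\<forall>r>0. \<exists>k. \<forall>n\<ge>k. \<rho> (diff (y n) l) < r)"

text \<open>Countably many radii determine the neighbourhoods of zero. For each radius
  \<open>1 / Suc n\<close> an index \<open>k n\<close> is chosen beyond which the net varies by
  less; the sequence of these terms is Cauchy and its limit is the limit of the net. The indices
  \<open>k n\<close> need not increase, so two of them are compared through a common upper
  bound.\<close>

lemma complete_vector_topology_T:
  assumes "\<And>y. Cauchy_seq y \<Longrightarrow> \<exists>l. converges_to y l"
  shows "complete_vector_topology add zero smul T"
  unfolding complete_vector_topology_def
proof (intro allI impI)
  fix I :: "('v set \<times> 'v) set" and le x
  assume "Cauchy_net add zero smul T I le x"
  then have dir: "directed_set I le" and V: "x ` I \<subseteq> V"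
    and small: "\<And>U. openin T U \<and> zero \<in> U \<Longrightarrow>
      \<exists>k\<in>I. \<forall>i\<in>I. \<forall>j\<in>I. le k i \<and> le k j \<longrightarrow> diff (x i) (x j) \<in> U"
    by (auto simp: Cauchy_net_def topspace_T diff_def)
  have xV: "x i \<in> V" if "i \<in> I" for i using V that by blast
  have *: "\<exists>k\<in>I. \<forall>i\<in>I. \<forall>j\<in>I. le k i \<and> le k j \<longrightarrow> \<rho> (diff (x i) (x j)) < r" if r: "r > 0" for r
  proof -
    obtain U where U: "openin T U" "zero \<in> U" "\<forall>y\<in>U. \<rho> (diff y zero) < r"
      using open_nhd[OF zero_closed r] by blast
    then obtain k where "k \<in> I" "\<forall>i\<in>I. \<forall>j\<in>I. le k i \<and> le k j \<longrightarrow> diff (x i) (x j) \<in> U"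
      using small by blast
    then show ?thesis
      using U(3) diff_zero diff_closed xV by (intro bexI[of _ k]) (metis, simp)
  qed
  obtain k where k: "\<And>n. k n \<in> I"
    "\<And>n i j. \<lbrakk>i \<in> I; j \<in> I; le (k n) i; le (k n) j\<rbrakk> \<Longrightarrow> \<rho> (diff (x i) (x j)) < 1 / Suc n"
    using *[of "1 / Suc n" for n] by simp metis
  have refl: "le i i" if "i \<in> I" for i
    using dir that by (auto simp: directed_set_def reflp_on_def)
  have ub: "\<exists>k\<in>I. le i k \<and> le j k" if "i \<in> I" "j \<in> I" for i j
    using dir that by (auto simp: directed_set_def)
  have near: "\<exists>n. \<forall>m\<ge>n. \<forall>i\<in>I. le (k m) i \<longrightarrow> \<rho> (diff (x i) (x (k m))) < r / C" if "r > 0" for r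
  proof -
    have "r / C > 0" using that C_ge_1 by simp
    then obtain n where n: "inverse (Suc n) < r / C" using reals_Archimedean by blast
    have "\<rho> (diff (x i) (x (k m))) < r / C" if "m \<ge> n" "i \<in> I" "le (k m) i" for m i
    proof -
      have "\<rho> (diff (x i) (x (k m))) < 1 / Suc m" using k that refl by blast
      also have "\<dots> \<le> inverse (Suc n)" using that by (simp add: field_simps)
      finally show ?thesis using n by simp
    qed
    then show ?thesis by blast
  qed
  have "Cauchy_seq (\<lambda>n. x (k n))"
    unfolding Cauchy_seq_def
  proof (intro conjI allI impI)
    show "range (\<lambda>n. x (k n)) \<subseteq> V" using xV[OF k(1)] by blast
    fix r :: real assume "r > 0"
    then obtain n where n: "\<forall>m\<ge>n. \<forall>i\<in>I. le (k m) i \<longrightarrow> \<rho> (diff (x i) (x (k m))) < r / C"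
      using near by blast
    have "\<rho> (diff (x (k a)) (x (k b))) < r" if ab: "a \<ge> n" "b \<ge> n" for a b
    proof -
      obtain i where i: "i \<in> I" "le (k a) i" "le (k b) i" using ub k by blast
      then have "\<rho> (diff (x i) (x (k a))) < r / C" "\<rho> (diff (x i) (x (k b))) < r / C"
        using n ab by auto
      then show ?thesis
        using rho_diff_less[of "x (k a)" "x i" "x (k b)" r] xV k i rho_diff_commute by simp
    qed
    then show "\<exists>k'. \<forall>m\<ge>k'. \<forall>n\<ge>k'. \<rho> (diff (x (k m)) (x (k n))) < r" by blast
  qed
  then obtain l where l: "l \<in> V" "\<And>r. r > 0 \<Longrightarrow> \<exists>k'. \<forall>n\<ge>k'. \<rho> (diff (x (k n)) l) < r"
    using assms unfolding converges_to_def by blast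
  show "net_converges T I le x"
    unfolding net_converges_def topspace_T
  proof (intro bexI[OF _ l(1)] allI impI)
    fix U assume "openin T U \<and> l \<in> U"
    then obtain r where r: "r > 0" "\<forall>y\<in>V. \<rho> (diff y l) < r \<longrightarrow> y \<in> U"
      unfolding openin_T by blast
    obtain n where n: "\<forall>m\<ge>n. \<forall>i\<in>I. le (k m) i \<longrightarrow> \<rho> (diff (x i) (x (k m))) < r / C"
      using near r by blast
    have "r / C > 0" using r C_ge_1 by simp
    then obtain n' where n': "\<forall>m\<ge>n'. \<rho> (diff (x (k m)) l) < r / C" using l(2) by blast
    define m where "m = max n n'"
    have "x i \<in> U" if "i \<in> I" "le (k m) i" for i
      using rho_diff_less[of "x i" "x (k m)" l r] n n' that xV k l r by (auto simp: m_def)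
    then show "\<exists>k\<in>I. \<forall>i\<in>I. le k i \<longrightarrow> x i \<in> U" using k by blast
  qed
qed

text \<open>The index type \<open>nat\<close> is not the one in the definition of completeness, so
  the passage goes through \<open>complete_vector_topologyD\<close>. Applied to the target space,
  this supplies the pointwise limits.\<close>

lemma Cauchy_seq_converges:
  assumes "complete_vector_topology add zero smul T" "Cauchy_seq y"
  shows "\<exists>l. converges_to y l"
proof -
  have yV: "y n \<in> V" for n using assms(2) by (auto simp: Cauchy_seq_def)
  have "Cauchy_net add zero smul T UNIV (\<le>) y"
    unfolding Cauchy_net_def
  proof (intro conjI allI impI)
    show "directed_set (UNIV :: nat set) (\<le>)"
      by (auto simp: directed_set_def intro!: reflp_onI transp_onI intro: max.cobounded1 max.cobounded2)
    show "range y \<subseteq> topspace T" using yV topspace_T by auto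
    fix U assume "openin T U \<and> zero \<in> U"
    then obtain r where "r > 0" and r: "\<forall>y\<in>V. \<rho> (diff y zero) < r \<longrightarrow> y \<in> U"
      unfolding openin_T by blast
    then obtain k where "\<forall>m\<ge>k. \<forall>n\<ge>k. \<rho> (diff (y m) (y n)) < r"
      using assms(2) unfolding Cauchy_seq_def by blast
    then have "\<forall>m\<ge>k. \<forall>n\<ge>k. diff (y m) (y n) \<in> U"
      using r diff_zero diff_closed yV by simp
    then show "\<exists>k\<in>UNIV. \<forall>i\<in>UNIV. \<forall>j\<in>UNIV. k \<le> i \<and> k \<le> j \<longrightarrow> add (y i) (smul (- 1) (y j)) \<in> U"
      unfolding diff_def by blast
  qed
  then have "net_converges T UNIV (\<le>) y"
    by (rule complete_vector_topologyD[OF assms(1)])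
  then obtain l where l: "l \<in> V" "\<And>U. openin T U \<and> l \<in> U \<Longrightarrow> \<exists>k. \<forall>n\<ge>k. y n \<in> U"
    unfolding net_converges_def topspace_T by auto
  have "\<exists>k. \<forall>n\<ge>k. \<rho> (diff (y n) l) < r" if "r > 0" for r
    using open_nhd[OF l(1) that] l(2) by meson
  then show ?thesis using l(1) by (auto simp: converges_to_def)
qed

end

section \<open>Strongly measurable functions\<close>

locale continuous_quasi_norm =
  fixes scl :: "'k::real_normed_field \<Rightarrow> 'x::ab_group_add \<Rightarrow> 'x" and N :: "'x \<Rightarrow> real"
  assumes quasi_norm: "quasi_norm_on UNIV (+) 0 scl N"
    and continuous: "continuous_map (quasi_norm_top N) euclideanreal N"
begin

text \<open>The maximum, in contrast to a sum, passes through the monotone functions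
  \<open>M \<omega>\<close>. Asking for \<open>K \<ge> 2\<close> allows
  \<open>t + t \<le> K * t\<close> and makes the powers of \<open>1 / K\<close> summable.\<close>

definition K :: real
  where "K = (SOME K. K \<ge> 2 \<and> (\<forall>x y. N (x + y) \<le> K * max (N x) (N y)))"

lemma N_nonneg: "N x \<ge> 0"
  using quasi_norm by (simp add: quasi_norm_on_def)

lemma N_smul: "N (scl a x) = norm a * N x"
  using quasi_norm by (simp add: quasi_norm_on_def)

lemma K: "K \<ge> 2" "N (x + y) \<le> K * max (N x) (N y)"
proof -
  have "\<exists>\<kappa>. \<forall>x y. N (x + y) \<le> \<kappa> * (N x + N y)"
    using quasi_norm by (simp add: quasi_norm_on_def)
  then obtain \<kappa> where \<kappa>: "\<And>x y. N (x + y) \<le> \<kappa> * (N x + N y)" by blast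
  \<comment> \<open>The factor 2 comes from \<open>N x + N y \<le> 2 * max (N x) (N y)\<close>, and
    \<open>max 1 \<kappa>\<close> keeps the result at least 2.\<close>
  have "N (x + y) \<le> (2 * max 1 \<kappa>) * max (N x) (N y)" for x y
  proof -
    have "\<kappa> * (N x + N y) \<le> max 1 \<kappa> * (2 * max (N x) (N y))"
      using N_nonneg[of x] N_nonneg[of y] by (intro mult_mono) (auto simp: max_def)
    then show ?thesis using \<kappa>[of x y] by simp
  qed
  then have "\<exists>K\<ge>2. \<forall>x y. N (x + y) \<le> K * max (N x) (N y)"
    by (intro exI[of _ "2 * max 1 \<kappa>"]) auto
  then have "K \<ge> 2 \<and> (\<forall>x y. N (x + y) \<le> K * max (N x) (N y))"
    unfolding K_def by (rule someI_ex)
  then show "K \<ge> 2" "N (x + y) \<le> K * max (N x) (N y)" by auto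
qed

sublocale X: vector_space_on UNIV "(+)" 0 scl
  using quasi_norm by (simp add: quasi_norm_on_def)

sublocale X: quasi_F_norm UNIV "(+)" 0 scl N K
proof
  show "K \<ge> 1" using K(1) by simp
  fix x y :: 'x and a :: 'k and r :: real
  show "N x \<ge> 0" by (rule N_nonneg)
  have "x \<noteq> 0 \<Longrightarrow> 0 < N x" using quasi_norm by (simp add: quasi_norm_on_def)
  then show "N x = 0 \<Longrightarrow> x = 0" by auto
  show "N (x + y) \<le> K * max (N x) (N y)" by (rule K)
  show "N (scl a x) \<le> max 1 (norm a) * N x"
    using N_nonneg[of x] by (simp add: N_smul mult_right_mono)
  assume r: "r > 0"
  have "norm a * N x < r" if "norm a < r / (N x + 1)" for a :: 'k
  proof -
    have "norm a * N x \<le> norm a * (N x + 1)" by (intro mult_left_mono) auto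
    also have "\<dots> < r" using that N_nonneg[of x] by (simp add: field_simps)
    finally show ?thesis .
  qed
  then show "\<exists>\<delta>>0. \<forall>a. norm a < \<delta> \<longrightarrow> N (scl a x) < r"
    using r N_nonneg[of x] by (intro exI[of _ "r / (N x + 1)"]) (auto simp: N_smul)
qed

lemma scl_minus_one: "scl (- 1) x = - x"
  using X.diff_self[of x] unfolding X.diff_def by (intro minus_unique[symmetric]) simp

lemma diff_eq: "X.diff x y = x - y"
  by (simp add: X.diff_def scl_minus_one)

lemma module: "module scl"
  using X.smul_add_right X.smul_add_left X.smul_smul X.smul_one by unfold_locales auto

lemma N_zero: "N 0 = 0" by (rule X.rho_zero)

lemma N_eq_0: "N x = 0 \<longleftrightarrow> x = 0"
  using X.rho_zeroD[of x] N_zero by auto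

lemma N_diff_commute: "N (x - y) = N (y - x)"
  using X.rho_diff_commute[of x y] by (simp add: diff_eq)

lemma N_diff_less: "N (x - y) < r / K \<Longrightarrow> N (y - z) < r / K \<Longrightarrow> N (x - z) < r"
  using X.rho_diff_less[of x y z r] by (simp add: diff_eq)

lemma openin_top: "openin X.T U \<longleftrightarrow> (\<forall>x\<in>U. \<exists>r>0. \<forall>y. N (y - x) < r \<longrightarrow> y \<in> U)"
  using X.openin_T by (simp add: diff_eq)

lemma open_nhd: "r > 0 \<Longrightarrow> \<exists>U. openin X.T U \<and> x \<in> U \<and> (\<forall>y\<in>U. N (y - x) < r)"
  using X.open_nhd[of x r] by (simp add: diff_eq)

text \<open>Continuity of the quasi-norm enters here, moved to an arbitrary centre \<open>d\<close>
  by translation. It makes the functions \<open>N (f \<omega> - d)\<close> measurable.\<close>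

lemma openin_continuous_N:
  assumes "open S"
  shows "openin X.T {x. N (x - d) \<in> S}"
proof -
  have S: "openin X.T {x. N x \<in> S}"
    using openin_continuous_map_preimage[OF continuous, of S] assms X.topspace_T by simp
  show ?thesis
    unfolding openin_top
  proof
    fix x assume "x \<in> {x. N (x - d) \<in> S}"
    then have "x - d \<in> {x. N x \<in> S}" by simp
    then obtain r where r: "r > 0" "\<forall>y. N (y - (x - d)) < r \<longrightarrow> y \<in> {x. N x \<in> S}"
      using S unfolding openin_top by meson
    have "N (y - d) \<in> S" if "N (y - x) < r" for y
      using r(2)[rule_format, of "y - d"] that by simp
    then show "\<exists>r>0. \<forall>y. N (y - x) < r \<longrightarrow> y \<in> {x. N (x - d) \<in> S}" using r by auto
  qed
qed

lemma continuous_N_sequence: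
  assumes "\<And>r. r > 0 \<Longrightarrow> \<exists>k. \<forall>n\<ge>k. N (f n - l) < r"
  shows "(\<lambda>n. N (f n - d)) \<longlonglongrightarrow> N (l - d)"
proof (rule topological_tendstoI)
  fix S assume S: "open S" "N (l - d) \<in> S"
  then have "l \<in> {x. N (x - d) \<in> S}" by simp
  then obtain r where "r > 0" "\<forall>y. N (y - l) < r \<longrightarrow> y \<in> {x. N (x - d) \<in> S}"
    using openin_continuous_N[OF S(1), of d] unfolding openin_top by meson
  then show "\<forall>\<^sub>F n in sequentially. N (f n - d) \<in> S"
    using assms[of r] unfolding eventually_sequentially by auto
qed

abbreviation borel_X :: "'x measure"
  where "borel_X \<equiv> sigma UNIV {U. openin X.T U}"

lemma measurable_openin:
  assumes "f \<in> measurable \<mu> borel_X" "openin X.T U"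
  shows "{\<omega> \<in> space \<mu>. f \<omega> \<in> U} \<in> sets \<mu>"
proof -
  have "U \<in> sets borel_X" using assms(2) by (simp add: sets_measure_of_conv)
  then have "f -` U \<inter> space \<mu> \<in> sets \<mu>" by (rule measurable_sets[OF assms(1)])
  also have "f -` U \<inter> space \<mu> = {\<omega> \<in> space \<mu>. f \<omega> \<in> U}" by auto
  finally show ?thesis .
qed

lemma measurable_borel_XI:
  assumes "\<And>U. openin X.T U \<Longrightarrow> {\<omega> \<in> space \<mu>. f \<omega> \<in> U} \<in> sets \<mu>"
  shows "f \<in> measurable \<mu> borel_X"
proof (rule measurable_measure_of)
  fix U assume "U \<in> {U. openin X.T U}"
  then have "{\<omega> \<in> space \<mu>. f \<omega> \<in> U} \<in> sets \<mu>" using assms by simp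
  also have "{\<omega> \<in> space \<mu>. f \<omega> \<in> U} = f -` U \<inter> space \<mu>" by auto
  finally show "f -` U \<inter> space \<mu> \<in> sets \<mu>" .
qed auto

lemma borel_measurable_N_diff:
  assumes "f \<in> measurable \<mu> borel_X"
  shows "(\<lambda>\<omega>. N (f \<omega> - d)) \<in> borel_measurable \<mu>"
  unfolding borel_measurable_iff_less
proof
  fix a
  show "{\<omega> \<in> space \<mu>. N (f \<omega> - d) < a} \<in> sets \<mu>"
    using measurable_openin[OF assms openin_continuous_N[of "{..<a}" d]] by simp
qed

lemma borel_measurable_N:
  "f \<in> measurable \<mu> borel_X \<Longrightarrow> (\<lambda>\<omega>. N (f \<omega>)) \<in> borel_measurable \<mu>"
  using borel_measurable_N_diff[of f \<mu> 0] by simp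

section \<open>Closures of countable sets and separable subspaces\<close>

definition cl :: "'x set \<Rightarrow> 'x set"
  where "cl A = {x. \<forall>r>0. \<exists>a\<in>A. N (x - a) < r}"

lemma cl_less: "x \<in> cl A \<Longrightarrow> r > 0 \<Longrightarrow> \<exists>a\<in>A. N (x - a) < r"
  by (auto simp: cl_def)

lemma subset_cl: "A \<subseteq> cl A"
  using N_zero by (force simp: cl_def)

lemma cl_closed:
  assumes "\<And>r. r > 0 \<Longrightarrow> \<exists>y\<in>cl A. N (x - y) < r"
  shows "x \<in> cl A"
  unfolding cl_def
proof (intro CollectI allI impI)
  fix r :: real assume "r > 0"
  then have r: "r / K > 0" using K by simp
  then obtain y where y: "y \<in> cl A" "N (x - y) < r / K" using assms by blast
  then obtain a where "a \<in> A" "N (y - a) < r / K" using cl_less r by blast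
  then show "\<exists>a\<in>A. N (x - a) < r" using y N_diff_less by blast
qed

lemma cl_add:
  assumes "\<And>a b. a \<in> A \<Longrightarrow> b \<in> A \<Longrightarrow> a + b \<in> A" "x \<in> cl A" "y \<in> cl A"
  shows "x + y \<in> cl A"
  unfolding cl_def
proof (intro CollectI allI impI)
  fix r :: real assume "r > 0"
  then have r: "r / K > 0" using K by simp
  obtain a where a: "a \<in> A" "N (x - a) < r / K" using assms cl_less r by blast
  obtain b where b: "b \<in> A" "N (y - b) < r / K" using assms cl_less r by blast
  have "N ((x - a) + (y - b)) < r" using X.rho_add_less a b by simp
  then show "\<exists>a\<in>A. N (x + y - a) < r"
    using assms(1)[OF a(1) b(1)] by (intro bexI[of _ "a + b"]) (auto simp: algebra_simps)
qed

text \<open>The predicate is about a countable dense set \<open>A\<close>; the subspace is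
  \<open>cl A\<close>. The measurability proofs take countable unions over \<open>A\<close>.\<close>

definition separable_subspace :: "'x set \<Rightarrow> bool"
  where "separable_subspace A \<longleftrightarrow> countable A \<and> module.subspace scl (cl A)"

lemma separable_subspaceD:
  assumes "separable_subspace A"
  shows "countable A" "0 \<in> cl A" "x \<in> cl A \<Longrightarrow> y \<in> cl A \<Longrightarrow> x + y \<in> cl A"
    "x \<in> cl A \<Longrightarrow> scl c x \<in> cl A"
  using assms module.subspace_def[OF module] by (auto simp: separable_subspace_def)

lemma separable_space_cl:
  assumes "countable A"
  shows "separable_space (subtopology X.T (cl A))"
  unfolding separable_space_def
proof (intro exI[of _ A] conjI)
  have top: "topspace (subtopology X.T (cl A)) = cl A" using X.topspace_T by simp
  show "A \<subseteq> topspace (subtopology X.T (cl A))" using top subset_cl by simp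
  show "subtopology X.T (cl A) closure_of A = topspace (subtopology X.T (cl A))"
  proof
    show "topspace (subtopology X.T (cl A)) \<subseteq> subtopology X.T (cl A) closure_of A"
      unfolding top
    proof
      fix x assume x: "x \<in> cl A"
      have "\<exists>y. y \<in> A \<and> y \<in> W" if W: "x \<in> W" "openin (subtopology X.T (cl A)) W" for W
      proof -
        obtain U where U: "openin X.T U" "W = U \<inter> cl A"
          using W(2) by (auto simp: openin_subtopology)
        then obtain r where r: "r > 0" "\<forall>y. N (y - x) < r \<longrightarrow> y \<in> U"
          using W(1) unfolding openin_top by blast
        then obtain a where "a \<in> A" "N (x - a) < r" using x cl_less by blast
        then show ?thesis using r U subset_cl N_diff_commute[of x a] by auto
      qed
      then show "x \<in> subtopology X.T (cl A) closure_of A"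
        using x by (simp add: in_closure_of X.topspace_T)
    qed
  qed (rule closure_of_subset_topspace)
qed (rule assms)

text \<open>Density refers to the subtopology on \<open>S\<close>, whereas \<open>cl\<close> is
  formed in the whole space, so the result is an inclusion.\<close>

lemma separable_space_imp_cl:
  assumes "separable_space (subtopology X.T S)"
  shows "\<exists>A. countable A \<and> A \<subseteq> S \<and> S \<subseteq> cl A"
proof -
  obtain A where A: "countable A" "A \<subseteq> S" "subtopology X.T S closure_of A = S"
    using assms X.topspace_T by (auto simp: separable_space_def)
  have "x \<in> cl A" if x: "x \<in> S" for x
    unfolding cl_def
  proof (intro CollectI allI impI)
    fix r :: real assume "r > 0"
    then obtain U where U: "openin X.T U" "x \<in> U" "\<forall>y\<in>U. N (y - x) < r"
      using open_nhd by blast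
    have "openin (subtopology X.T S) (U \<inter> S)" using U(1) by (auto simp: openin_subtopology)
    moreover have "x \<in> subtopology X.T S closure_of A" using x A(3) by simp
    ultimately obtain a where "a \<in> A" "a \<in> U \<inter> S"
      using x U(2) unfolding in_closure_of by blast
    then show "\<exists>a\<in>A. N (x - a) < r" using U(3) N_diff_commute[of x a] by (intro bexI[of _ a]) auto
  qed
  then show ?thesis using A by blast
qed

text \<open>
  Finite sums of elements of dense countable subsets are dense in the sum of the subspaces. Rational
  combinations would do as well, but would require \<open>'k\<close> to be separable.
\<close>

lemma separable_subspace_Union:
  fixes S :: "nat \<Rightarrow> 'x set"
  assumes S: "\<And>n. module.subspace scl (S n)" "\<And>n. separable_space (subtopology X.T (S n))"
  shows "\<exists>A. separable_subspace A \<and> (\<forall>n. S n \<subseteq> cl A)"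
proof -
  have "\<forall>n. \<exists>A. countable A \<and> A \<subseteq> S n \<and> S n \<subseteq> cl A"
    using separable_space_imp_cl S(2) by blast
  then obtain D where D: "\<And>n. countable (D n)" "\<And>n. D n \<subseteq> S n" "\<And>n. S n \<subseteq> cl (D n)"
    by metis
  define L where "L = lists (\<Union>n. D n)"
  define A where "A = sum_list ` L"
  have countable: "countable A" using D(1) by (simp add: A_def L_def)
  have add_A: "a + b \<in> A" if ab: "a \<in> A" "b \<in> A" for a b
  proof -
    obtain xs ys where *: "xs \<in> L" "a = sum_list xs" "ys \<in> L" "b = sum_list ys"
      using ab unfolding A_def by blast
    then have "xs @ ys \<in> L" "sum_list (xs @ ys) = a + b" by (simp_all add: L_def)
    then show ?thesis unfolding A_def by (metis imageI)
  qed
  have "D n \<subseteq> A" for n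
  proof
    fix x assume "x \<in> D n"
    then have "[x] \<in> L" "sum_list [x] = x" by (auto simp: L_def)
    then show "x \<in> A" unfolding A_def by (metis imageI)
  qed
  then have S_cl: "S n \<subseteq> cl A" for n
    using D(3)[of n] by (force simp: cl_def)
  have zero: "0 \<in> cl A"
    using S(1)[of 0] S_cl[of 0] by (auto simp: module.subspace_def[OF module])
  have add: "x + y \<in> cl A" if "x \<in> cl A" "y \<in> cl A" for x y
    using cl_add[OF add_A that] by blast
  \<comment> \<open>\<open>A\<close> is not closed under scalars. A multiple of a finite sum is
    still approximated, because each multiplied summand stays in its subspace \<open>S n\<close> and
    hence in \<open>cl A\<close>.\<close>
  have smul_A: "scl c (sum_list xs) \<in> cl A" if "xs \<in> L" for c xs
    using that unfolding L_def
  proof (induction xs)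
    case Nil
    then show ?case using zero X.smul_zero_right by simp
  next
    case (Cons x xs)
    then obtain n where "x \<in> S n" using D(2) by blast
    then have "scl c x \<in> S n" using S(1)[of n] by (simp add: module.subspace_def[OF module])
    then have "scl c x \<in> cl A" using S_cl by blast
    moreover have "scl c (sum_list xs) \<in> cl A" using Cons by simp
    ultimately show ?case using add X.smul_add_right by simp
  qed
  have "scl c x \<in> cl A" if x: "x \<in> cl A" for c x
  proof (rule cl_closed)
    fix r :: real assume r: "r > 0"
    define s where "s = r / (norm c + 1)"
    have s: "s > 0" "norm c * s < r"
      using r by (auto simp: s_def field_simps add_pos_nonneg)
    obtain a where a: "a \<in> A" "N (x - a) < s" using x cl_less s(1) by blast
    have "scl c x - scl c a = scl c (x - a)"
      using X.smul_add_right[of "x - a" a c] by simp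
    then have "N (scl c x - scl c a) = norm c * N (x - a)" by (simp add: N_smul)
    also have "\<dots> \<le> norm c * s" using a by (intro mult_left_mono) auto
    finally have "N (scl c x - scl c a) < r" using s by simp
    moreover have "scl c a \<in> cl A" using smul_A a(1) unfolding A_def by (elim imageE) simp
    ultimately show "\<exists>y\<in>cl A. N (scl c x - y) < r" by blast
  qed
  then have "module.subspace scl (cl A)" using zero add by (simp add: module.subspace_def[OF module])
  then show ?thesis using countable S_cl by (auto simp: separable_subspace_def)
qed

section \<open>Measurability of sums, multiples and limits\<close>

lemma strongly_measurableI:
  assumes "f \<in> measurable \<mu> borel_X" "separable_subspace A" "AE \<omega> in \<mu>. f \<omega> \<in> cl A"
  shows "f \<in> strongly_measurable \<mu> scl N"
  unfolding strongly_measurable_def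
  using assms separable_space_cl by (auto simp: separable_subspace_def intro!: exI[of _ "cl A"])

lemma strongly_measurable_imp_measurable:
  "f \<in> strongly_measurable \<mu> scl N \<Longrightarrow> f \<in> measurable \<mu> borel_X"
  by (simp add: strongly_measurable_def)

lemma measurable_zero: "(\<lambda>\<omega>. 0) \<in> measurable \<mu> borel_X"
  by (rule measurable_const) (simp add: space_measure_of_conv)

text \<open>Provides one separable subspace for a whole sequence. On the countable union of the
  exceptional null sets the functions are redefined as 0, which lies in every subspace; afterwards
  all values lie in \<open>cl A\<close> without exception.\<close>

lemma strongly_measurable_representatives:
  fixes f :: "nat \<Rightarrow> 'w \<Rightarrow> 'x"
  assumes f: "\<And>n. f n \<in> strongly_measurable \<mu> scl N"
  obtains A g where "separable_subspace A" "\<And>n. g n \<in> measurable \<mu> borel_X"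
    "\<And>n \<omega>. \<omega> \<in> space \<mu> \<Longrightarrow> g n \<omega> \<in> cl A" "\<And>n. AE \<omega> in \<mu>. f n \<omega> = g n \<omega>"
proof -
  have "\<forall>n. \<exists>S. module.subspace scl S \<and> separable_space (subtopology X.T S) \<and> (AE \<omega> in \<mu>. f n \<omega> \<in> S)"
    using f unfolding strongly_measurable_def by blast
  then obtain S where S: "\<And>n. module.subspace scl (S n)"
    "\<And>n. separable_space (subtopology X.T (S n))" "\<And>n. AE \<omega> in \<mu>. f n \<omega> \<in> S n"
    by metis
  then obtain A where A: "separable_subspace A" "\<And>n. S n \<subseteq> cl A"
    using separable_subspace_Union[of S] by blast
  have "AE \<omega> in \<mu>. \<forall>n. f n \<omega> \<in> S n" using S(3) by (simp add: AE_all_countable)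
  then obtain Z where Z: "\<And>\<omega>. \<omega> \<in> space \<mu> - Z \<Longrightarrow> \<forall>n. f n \<omega> \<in> S n" "Z \<in> null_sets \<mu>"
    by (rule AE_E3) blast
  define g where "g n \<omega> = (if \<omega> \<in> Z then 0 else f n \<omega>)" for n \<omega>
  have "g n \<in> measurable \<mu> borel_X" for n
    unfolding g_def using Z(2) measurable_zero strongly_measurable_imp_measurable[OF f]
    by (intro measurable_If_set) auto
  moreover have "g n \<omega> \<in> cl A" if "\<omega> \<in> space \<mu>" for n \<omega>
    using Z(1)[of \<omega>] A that separable_subspaceD(2) by (auto simp: g_def)
  moreover have "AE \<omega> in \<mu>. f n \<omega> = g n \<omega>" for n
    using AE_not_in[OF Z(2)] by eventually_elim (simp add: g_def)
  ultimately show thesis using that[of A g] A(1) by simp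
qed

text \<open>Separability replaces a second countable product: the preimage of \<open>U\<close> is a
  countable union of intersections of preimages of two balls, with centres in \<open>A\<close> and a
  rational radius \<open>q\<close> such that the sum of the two balls lies in
  \<open>U\<close>.\<close>

lemma measurable_add:
  assumes A: "countable A"
    and f: "f \<in> measurable \<mu> borel_X" "\<And>\<omega>. \<omega> \<in> space \<mu> \<Longrightarrow> f \<omega> \<in> cl A"
    and g: "g \<in> measurable \<mu> borel_X" "\<And>\<omega>. \<omega> \<in> space \<mu> \<Longrightarrow> g \<omega> \<in> cl A"
  shows "(\<lambda>\<omega>. f \<omega> + g \<omega>) \<in> measurable \<mu> borel_X"
proof (rule measurable_borel_XI)
  fix U assume U: "openin X.T U"
  define Q where "Q = {(a, b, q). a \<in> A \<and> b \<in> A \<and> q \<in> \<rat> \<and>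
    (\<forall>x y. N (x - a) < q \<and> N (y - b) < q \<longrightarrow> x + y \<in> U)}"
  have "Q \<subseteq> A \<times> A \<times> \<rat>" by (auto simp: Q_def)
  then have "countable Q" by (rule countable_subset) (use A countable_rat in auto)
  have sub: "\<exists>a b q. (a, b, q) \<in> Q \<and> N (f \<omega> - a) < q \<and> N (g \<omega> - b) < q"
    if \<omega>: "\<omega> \<in> space \<mu>" "f \<omega> + g \<omega> \<in> U" for \<omega>
  proof -
    obtain r where r: "r > 0" "\<forall>y. N (y - (f \<omega> + g \<omega>)) < r \<longrightarrow> y \<in> U"
      using U \<omega>(2) unfolding openin_top by blast
    \<comment> \<open>One factor \<open>K\<close> is spent on passing from the centres
      \<open>a\<close>, \<open>b\<close> to \<open>f \<omega>\<close>, \<open>g \<omega>\<close>,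
      the other on adding the two differences.\<close>
    have "r / K / K > 0" using r K(1) by simp
    then obtain q where q: "q \<in> \<rat>" "0 < q" "q < r / K / K" using Rats_dense_in_real by blast
    obtain a where a: "a \<in> A" "N (f \<omega> - a) < q" using f(2) \<omega>(1) q(2) cl_less by blast
    obtain b where b: "b \<in> A" "N (g \<omega> - b) < q" using g(2) \<omega>(1) q(2) cl_less by blast
    have "x + y \<in> U" if xy: "N (x - a) < q" "N (y - b) < q" for x y
    proof -
      have "N (x - f \<omega>) < r / K"
        using xy(1) a(2) q(3) N_diff_commute[of a "f \<omega>"] by (auto intro!: N_diff_less[of x a "r / K" "f \<omega>"])
      moreover have "N (y - g \<omega>) < r / K"
        using xy(2) b(2) q(3) N_diff_commute[of b "g \<omega>"] by (auto intro!: N_diff_less[of y b "r / K" "g \<omega>"])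
      ultimately have "N ((x - f \<omega>) + (y - g \<omega>)) < r" using X.rho_add_less by simp
      then show ?thesis using r(2) by (simp add: algebra_simps)
    qed
    then have "(a, b, q) \<in> Q" using a b q by (auto simp: Q_def)
    then show ?thesis using a b by blast
  qed
  have sup: "f \<omega> + g \<omega> \<in> U" if "(a, b, q) \<in> Q" "N (f \<omega> - a) < q" "N (g \<omega> - b) < q" for a b q \<omega>
    using that by (simp add: Q_def)
  have "{\<omega> \<in> space \<mu>. f \<omega> + g \<omega> \<in> U} =
      (\<Union>(a, b, q)\<in>Q. {\<omega> \<in> space \<mu>. N (f \<omega> - a) < q} \<inter> {\<omega> \<in> space \<mu>. N (g \<omega> - b) < q})"
    (is "_ = ?R")
  proof (rule set_eqI, rule iffI)
    fix \<omega> assume \<omega>: "\<omega> \<in> {\<omega> \<in> space \<mu>. f \<omega> + g \<omega> \<in> U}"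
    then obtain a b q where "(a, b, q) \<in> Q" "N (f \<omega> - a) < q" "N (g \<omega> - b) < q" using sub[of \<omega>] by auto
    then show "\<omega> \<in> ?R" using \<omega> by (intro UN_I[of "(a, b, q)"]) auto
  next
    fix \<omega> assume "\<omega> \<in> ?R"
    then show "\<omega> \<in> {\<omega> \<in> space \<mu>. f \<omega> + g \<omega> \<in> U}" using sup by auto
  qed
  also have "\<dots> \<in> sets \<mu>"
    using borel_measurable_N_diff[OF f(1)] borel_measurable_N_diff[OF g(1)]
    by (intro sets.countable_UN'' \<open>countable Q\<close>) (auto simp: borel_measurable_iff_less)
  finally show "{\<omega> \<in> space \<mu>. f \<omega> + g \<omega> \<in> U} \<in> sets \<mu>" .
qed

lemma measurable_scl:
  assumes f: "f \<in> measurable \<mu> borel_X"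
  shows "(\<lambda>\<omega>. scl c (f \<omega>)) \<in> measurable \<mu> borel_X"
proof (rule measurable_borel_XI)
  fix U assume U: "openin X.T U"
  have "openin X.T {x. scl c x \<in> U}"
    unfolding openin_top
  proof
    fix x assume "x \<in> {x. scl c x \<in> U}"
    then obtain r where r: "r > 0" "\<forall>y. N (y - scl c x) < r \<longrightarrow> y \<in> U"
      using U unfolding openin_top by blast
    have "scl c y \<in> U" if y: "N (y - x) < r / (norm c + 1)" for y
    proof -
      have "norm c * N (y - x) \<le> (norm c + 1) * N (y - x)"
        using N_nonneg by (intro mult_right_mono) auto
      also have "\<dots> < r" using y by (simp add: pos_less_divide_eq add_nonneg_pos mult.commute)
      finally have "N (scl c (y - x)) < r" by (simp add: N_smul)
      also have "scl c (y - x) = scl c y - scl c x"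
        using X.smul_add_right[of "y - x" x c] by simp
      finally show ?thesis using r(2) by blast
    qed
    then show "\<exists>r>0. \<forall>y. N (y - x) < r \<longrightarrow> y \<in> {x. scl c x \<in> U}"
      using r(1) by (intro exI[of _ "r / (norm c + 1)"]) (auto simp: add_nonneg_pos)
  qed
  then have "{\<omega> \<in> space \<mu>. f \<omega> \<in> {x. scl c x \<in> U}} \<in> sets \<mu>" by (rule measurable_openin[OF f])
  then show "{\<omega> \<in> space \<mu>. scl c (f \<omega>) \<in> U} \<in> sets \<mu>" by simp
qed

text \<open>The distances to a fixed \<open>a\<close> converge because \<open>N\<close> is
  continuous, so \<open>N (l \<omega> - a)\<close> is measurable. Since the limit stays in
  \<open>cl A\<close>, preimages of open sets are countable unions of preimages of balls centred in
  \<open>A\<close>.\<close>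

lemma measurable_limit:
  fixes f :: "nat \<Rightarrow> 'w \<Rightarrow> 'x"
  assumes A: "countable A"
    and f: "\<And>n. f n \<in> measurable \<mu> borel_X" "\<And>n \<omega>. \<omega> \<in> space \<mu> \<Longrightarrow> f n \<omega> \<in> cl A"
    and lim: "\<And>\<omega> r. \<omega> \<in> space \<mu> \<Longrightarrow> r > 0 \<Longrightarrow> \<exists>k. \<forall>n\<ge>k. N (f n \<omega> - l \<omega>) < r"
  shows "l \<in> measurable \<mu> borel_X" "\<And>\<omega>. \<omega> \<in> space \<mu> \<Longrightarrow> l \<omega> \<in> cl A"
proof -
  have meas: "(\<lambda>\<omega>. N (l \<omega> - a)) \<in> borel_measurable \<mu>" for a
  proof (rule borel_measurable_LIMSEQ_real)
    fix \<omega> assume "\<omega> \<in> space \<mu>"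
    then show "(\<lambda>n. N (f n \<omega> - a)) \<longlonglongrightarrow> N (l \<omega> - a)"
      using lim by (intro continuous_N_sequence) blast
  qed (rule borel_measurable_N_diff[OF f(1)])
  show cl: "l \<omega> \<in> cl A" if \<omega>: "\<omega> \<in> space \<mu>" for \<omega>
  proof (rule cl_closed)
    fix r :: real assume "r > 0"
    then obtain k where "N (f k \<omega> - l \<omega>) < r" using lim[OF \<omega>] by blast
    then show "\<exists>y\<in>cl A. N (l \<omega> - y) < r"
      using f(2)[OF \<omega>, of k] N_diff_commute[of "l \<omega>" "f k \<omega>"] by (intro bexI[of _ "f k \<omega>"]) auto
  qed
  show "l \<in> measurable \<mu> borel_X"
  proof (rule measurable_borel_XI)
    fix U assume U: "openin X.T U"
    define Q where "Q = {(a, q). a \<in> A \<and> q \<in> \<rat> \<and> (\<forall>x. N (x - a) < q \<longrightarrow> x \<in> U)}"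
    have "Q \<subseteq> A \<times> \<rat>" by (auto simp: Q_def)
    then have "countable Q" by (rule countable_subset) (use A countable_rat in auto)
    have sub: "\<exists>a q. (a, q) \<in> Q \<and> N (l \<omega> - a) < q" if \<omega>: "\<omega> \<in> space \<mu>" "l \<omega> \<in> U" for \<omega>
    proof -
      obtain r where r: "r > 0" "\<forall>y. N (y - l \<omega>) < r \<longrightarrow> y \<in> U"
        using U \<omega>(2) unfolding openin_top by blast
      have "r / K > 0" using r K(1) by simp
      then obtain q where q: "q \<in> \<rat>" "0 < q" "q < r / K" using Rats_dense_in_real by blast
      obtain a where a: "a \<in> A" "N (l \<omega> - a) < q" using cl \<omega>(1) q(2) cl_less by blast
      have "x \<in> U" if x: "N (x - a) < q" for x
        using x a(2) q(3) N_diff_commute[of a "l \<omega>"] r(2) N_diff_less[of x a r "l \<omega>"] by auto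
      then have "(a, q) \<in> Q" using a q by (auto simp: Q_def)
      then show ?thesis using a by blast
    qed
    have sup: "l \<omega> \<in> U" if "(a, q) \<in> Q" "N (l \<omega> - a) < q" for a q \<omega>
      using that by (simp add: Q_def)
    have "{\<omega> \<in> space \<mu>. l \<omega> \<in> U} = (\<Union>(a, q)\<in>Q. {\<omega> \<in> space \<mu>. N (l \<omega> - a) < q})"
      (is "_ = ?R")
    proof (rule set_eqI, rule iffI)
      fix \<omega> assume \<omega>: "\<omega> \<in> {\<omega> \<in> space \<mu>. l \<omega> \<in> U}"
      then obtain a q where "(a, q) \<in> Q" "N (l \<omega> - a) < q" using sub[of \<omega>] by auto
      then show "\<omega> \<in> ?R" using \<omega> by (intro UN_I[of "(a, q)"]) auto
    next
      fix \<omega> assume "\<omega> \<in> ?R"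
      then show "\<omega> \<in> {\<omega> \<in> space \<mu>. l \<omega> \<in> U}" using sup by auto
    qed
    also have "\<dots> \<in> sets \<mu>"
      using meas by (intro sets.countable_UN'' \<open>countable Q\<close>) (auto simp: borel_measurable_iff_less)
    finally show "{\<omega> \<in> space \<mu>. l \<omega> \<in> U} \<in> sets \<mu>" .
  qed
qed

end

section \<open>Classes of strongly measurable functions\<close>

lemma (in vector_space_on) vector_space_on_subset:
  assumes "W \<subseteq> V" "zero \<in> W" "\<And>x y. x \<in> W \<Longrightarrow> y \<in> W \<Longrightarrow> add x y \<in> W"
    and smul: "\<And>a x. x \<in> W \<Longrightarrow> smul a x \<in> W"
  shows "vector_space_on W add zero smul"
proof
  fix x y z and a b :: 'k assume W: "x \<in> W" "y \<in> W" "z \<in> W"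
  then have V: "x \<in> V" "y \<in> V" "z \<in> V" using assms(1) by auto
  show "add (add x y) z = add x (add y z)" using V by (rule add_assoc)
  show "add x y = add y x" using V(1,2) by (rule add_commute)
  show "add x zero = x" using V(1) by (rule add_zero)
  show "smul a (add x y) = add (smul a x) (smul a y)" using V(1,2) by (rule smul_add_right)
  show "smul (a + b) x = add (smul a x) (smul b x)" using V(1) by (rule smul_add_left)
  show "smul a (smul b x) = smul (a * b) x" using V(1) by (rule smul_smul)
  show "smul 1 x = x" using V(1) by (rule smul_one)
  show "\<exists>y\<in>W. add x y = zero"
    using smul[OF W(1), of "- 1"] diff_self[OF V(1)] unfolding diff_def by blast
qed (use assms in auto)

locale measurable_classes = continuous_quasi_norm scl N
  for scl :: "'k::real_normed_field \<Rightarrow> 'x::ab_group_add \<Rightarrow> 'x" and N :: "'x \<Rightarrow> real" +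
  fixes \<mu> :: "'w measure"
begin

abbreviation SM :: "('w \<Rightarrow> 'x) set"
  where "SM \<equiv> strongly_measurable \<mu> scl N"

abbreviation "L \<equiv> L0 \<mu> scl N"
abbreviation "add \<equiv> L0_add \<mu> scl N"
abbreviation "zero \<equiv> L0_zero \<mu> scl N"
abbreviation "smul \<equiv> L0_smult \<mu> scl N"

definition cls :: "('w \<Rightarrow> 'x) \<Rightarrow> ('w \<Rightarrow> 'x) set"
  where "cls f = {g \<in> SM. AE \<omega> in \<mu>. f \<omega> = g \<omega>}"

lemma L0_eq: "L = cls ` SM"
  by (auto simp: L0_def quotient_def cls_def)

lemma cls_mem: "f \<in> SM \<Longrightarrow> f \<in> cls f"
  by (simp add: cls_def)

lemma mem_clsD: "g \<in> cls f \<Longrightarrow> g \<in> SM" "g \<in> cls f \<Longrightarrow> AE \<omega> in \<mu>. f \<omega> = g \<omega>"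
  by (auto simp: cls_def)

lemma cls_eqI:
  assumes "AE \<omega> in \<mu>. f \<omega> = g \<omega>"
  shows "cls f = cls g"
proof -
  have "(AE \<omega> in \<mu>. f \<omega> = h \<omega>) \<longleftrightarrow> (AE \<omega> in \<mu>. g \<omega> = h \<omega>)" for h
  proof
    assume "AE \<omega> in \<mu>. f \<omega> = h \<omega>"
    with assms show "AE \<omega> in \<mu>. g \<omega> = h \<omega>" by eventually_elim simp
  next
    assume "AE \<omega> in \<mu>. g \<omega> = h \<omega>"
    with assms show "AE \<omega> in \<mu>. f \<omega> = h \<omega>" by eventually_elim simp
  qed
  then show ?thesis by (simp add: cls_def)
qed

lemma SM_measurable: "f \<in> SM \<Longrightarrow> f \<in> measurable \<mu> borel_X"
  by (rule strongly_measurable_imp_measurable)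

lemma SM_add:
  assumes f: "f \<in> SM" and g: "g \<in> SM"
  shows "\<exists>h\<in>SM. AE \<omega> in \<mu>. h \<omega> = f \<omega> + g \<omega>"
proof -
  \<comment> \<open>A sequence with only two different terms, so that \<open>f\<close> and
    \<open>g\<close> receive a common separable subspace.\<close>
  define F where "F n = (if n = (0::nat) then f else g)" for n
  have "F n \<in> SM" for n using f g by (simp add: F_def)
  then obtain A G where A: "separable_subspace A" and G: "\<And>n. G n \<in> measurable \<mu> borel_X"
    "\<And>n \<omega>. \<omega> \<in> space \<mu> \<Longrightarrow> G n \<omega> \<in> cl A" and eq: "\<And>n. AE \<omega> in \<mu>. F n \<omega> = G n \<omega>"
    using strongly_measurable_representatives[of F \<mu>] by blast
  define h where "h \<omega> = G 0 \<omega> + G 1 \<omega>" for \<omega>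
  have "h \<in> measurable \<mu> borel_X"
    unfolding h_def using measurable_add[OF separable_subspaceD(1)[OF A] G(1) G(2) G(1) G(2)] .
  moreover have "AE \<omega> in \<mu>. h \<omega> \<in> cl A"
    using separable_subspaceD(3)[OF A] G(2) by (intro AE_I2) (auto simp: h_def)
  ultimately have "h \<in> SM" using A strongly_measurableI by blast
  moreover have "AE \<omega> in \<mu>. h \<omega> = f \<omega> + g \<omega>"
    using eq[of 0] eq[of 1] by eventually_elim (simp add: F_def h_def)
  ultimately show ?thesis by blast
qed

lemma SM_scl:
  assumes "f \<in> SM"
  shows "(\<lambda>\<omega>. scl a (f \<omega>)) \<in> SM"
proof -
  obtain A g where A: "separable_subspace A" and "\<And>n::nat. g n \<in> measurable \<mu> borel_X"
    and g: "\<And>n \<omega>. \<omega> \<in> space \<mu> \<Longrightarrow> g n \<omega> \<in> cl A" and eq: "\<And>n. AE \<omega> in \<mu>. f \<omega> = g n \<omega>"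
    by (rule strongly_measurable_representatives[of "\<lambda>n::nat. f" \<mu>, OF assms]) (rule that)
  have "AE \<omega> in \<mu>. g 0 \<omega> \<in> cl A" using g by simp
  with eq[of 0] have "AE \<omega> in \<mu>. scl a (f \<omega>) \<in> cl A"
    by eventually_elim (use separable_subspaceD(4)[OF A] in simp)
  then show ?thesis
    using strongly_measurableI[OF measurable_scl[OF SM_measurable[OF assms]] A] by blast
qed

lemma SM_zero: "(\<lambda>\<omega>. 0) \<in> SM"
proof -
  have "cl {0} = {0}"
  proof
    show "cl {0} \<subseteq> {0}"
    proof
      fix x assume x: "x \<in> cl {0}"
      have "N x < r" if "r > 0" for r using cl_less[OF x that] by simp
      then have "N x \<le> 0" by (meson less_irrefl not_le)
      then show "x \<in> {0}" using N_nonneg[of x] N_eq_0[of x] by simp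
    qed
  qed (rule subset_cl)
  then have "separable_subspace {0}"
    using X.smul_zero_right by (simp add: separable_subspace_def module.subspace_def[OF module])
  then show ?thesis
    using subset_cl[of "{0}"] by (intro strongly_measurableI[OF measurable_zero]) auto
qed

text \<open>A choice, because the pointwise sum of the given representatives may itself not be
  measurable.\<close>

definition rep_add :: "('w \<Rightarrow> 'x) \<Rightarrow> ('w \<Rightarrow> 'x) \<Rightarrow> 'w \<Rightarrow> 'x"
  where "rep_add f g = (SOME h. h \<in> SM \<and> (AE \<omega> in \<mu>. h \<omega> = f \<omega> + g \<omega>))"

lemma rep_add:
  assumes "f \<in> SM" "g \<in> SM"
  shows "rep_add f g \<in> SM" "AE \<omega> in \<mu>. rep_add f g \<omega> = f \<omega> + g \<omega>"
proof -
  have "\<exists>h. h \<in> SM \<and> (AE \<omega> in \<mu>. h \<omega> = f \<omega> + g \<omega>)" using SM_add[OF assms] by blast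
  then have "rep_add f g \<in> SM \<and> (AE \<omega> in \<mu>. rep_add f g \<omega> = f \<omega> + g \<omega>)"
    unfolding rep_add_def by (rule someI_ex)
  then show "rep_add f g \<in> SM" "AE \<omega> in \<mu>. rep_add f g \<omega> = f \<omega> + g \<omega>" by auto
qed

lemma add_cls:
  assumes f: "f \<in> SM" and g: "g \<in> SM"
  shows "add (cls f) (cls g) = cls (rep_add f g)"
proof -
  have "(\<exists>f'\<in>cls f. \<exists>g'\<in>cls g. AE \<omega> in \<mu>. h \<omega> = f' \<omega> + g' \<omega>) \<longleftrightarrow>
      (AE \<omega> in \<mu>. rep_add f g \<omega> = h \<omega>)" for h
  proof
    assume "\<exists>f'\<in>cls f. \<exists>g'\<in>cls g. AE \<omega> in \<mu>. h \<omega> = f' \<omega> + g' \<omega>"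
    then obtain f' g' where "f' \<in> cls f" "g' \<in> cls g" "AE \<omega> in \<mu>. h \<omega> = f' \<omega> + g' \<omega>" by blast
    then have "AE \<omega> in \<mu>. f \<omega> = f' \<omega>" "AE \<omega> in \<mu>. g \<omega> = g' \<omega>" "AE \<omega> in \<mu>. h \<omega> = f' \<omega> + g' \<omega>"
      using mem_clsD by auto
    with rep_add(2)[OF f g] show "AE \<omega> in \<mu>. rep_add f g \<omega> = h \<omega>" by eventually_elim simp
  next
    assume "AE \<omega> in \<mu>. rep_add f g \<omega> = h \<omega>"
    with rep_add(2)[OF f g] have "AE \<omega> in \<mu>. h \<omega> = f \<omega> + g \<omega>" by eventually_elim simp
    then show "\<exists>f'\<in>cls f. \<exists>g'\<in>cls g. AE \<omega> in \<mu>. h \<omega> = f' \<omega> + g' \<omega>"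
      using cls_mem f g by blast
  qed
  then show ?thesis by (simp add: L0_add_def cls_def)
qed

lemma smul_cls:
  assumes f: "f \<in> SM"
  shows "smul a (cls f) = cls (\<lambda>\<omega>. scl a (f \<omega>))"
proof -
  have "(\<exists>f'\<in>cls f. AE \<omega> in \<mu>. h \<omega> = scl a (f' \<omega>)) \<longleftrightarrow> (AE \<omega> in \<mu>. scl a (f \<omega>) = h \<omega>)" for h
  proof
    assume "\<exists>f'\<in>cls f. AE \<omega> in \<mu>. h \<omega> = scl a (f' \<omega>)"
    then obtain f' where "f' \<in> cls f" "AE \<omega> in \<mu>. h \<omega> = scl a (f' \<omega>)" by blast
    then have "AE \<omega> in \<mu>. f \<omega> = f' \<omega>" "AE \<omega> in \<mu>. h \<omega> = scl a (f' \<omega>)"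
      using mem_clsD by auto
    then show "AE \<omega> in \<mu>. scl a (f \<omega>) = h \<omega>" by eventually_elim simp
  next
    assume "AE \<omega> in \<mu>. scl a (f \<omega>) = h \<omega>"
    then have "AE \<omega> in \<mu>. h \<omega> = scl a (f \<omega>)" by eventually_elim simp
    then show "\<exists>f'\<in>cls f. AE \<omega> in \<mu>. h \<omega> = scl a (f' \<omega>)" using cls_mem f by blast
  qed
  then show ?thesis by (simp add: L0_smult_def cls_def)
qed

lemma zero_cls: "zero = cls (\<lambda>\<omega>. 0)"
  by (simp add: L0_zero_def cls_def eq_commute[of "0::'x"])

text \<open>Every axiom holds almost everywhere for representatives, and \<open>cls_eqI\<close>
  turns this into an equality of classes.\<close>

lemma vector_space_on_L0: "vector_space_on L add zero smul"
proof
  show "zero \<in> L" unfolding L0_eq zero_cls using SM_zero by blast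
next
  fix F G H and a b :: 'k
  assume "F \<in> L" "G \<in> L" "H \<in> L"
  then obtain f g h where f: "f \<in> SM" and g: "g \<in> SM" and h: "h \<in> SM"
    and F: "F = cls f" and G: "G = cls g" and H: "H = cls h"
    unfolding L0_eq by blast
  note pl = rep_add(1)[OF f g] rep_add(1)[OF g h]
  show "add F G \<in> L" unfolding F G add_cls[OF f g] L0_eq using pl by blast
  show "smul a F \<in> L" unfolding F smul_cls[OF f] L0_eq using SM_scl[OF f] by blast
  show "add (add F G) H = add F (add G H)"
    unfolding F G H add_cls[OF f g] add_cls[OF g h] add_cls[OF pl(1) h] add_cls[OF f pl(2)]
    using rep_add(2)[OF pl(1) h] rep_add(2)[OF f pl(2)] rep_add(2)[OF f g] rep_add(2)[OF g h]
    by (intro cls_eqI, eventually_elim) (simp add: algebra_simps)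
  show "add F G = add G F"
    unfolding F G add_cls[OF f g] add_cls[OF g f] using rep_add(2)[OF f g] rep_add(2)[OF g f]
    by (intro cls_eqI, eventually_elim) (simp add: algebra_simps)
  show "add F zero = F"
    unfolding F zero_cls add_cls[OF f SM_zero] using rep_add(2)[OF f SM_zero]
    by (intro cls_eqI, eventually_elim) simp
  show "\<exists>G\<in>L. add F G = zero"
  proof
    note s = SM_scl[OF f, of "- 1"]
    show "smul (- 1) F \<in> L" unfolding F smul_cls[OF f] L0_eq using s by blast
    show "add F (smul (- 1) F) = zero"
      unfolding F smul_cls[OF f] add_cls[OF f s] zero_cls using rep_add(2)[OF f s]
      by (intro cls_eqI, eventually_elim) (simp add: scl_minus_one)
  qed
  note s = SM_scl[OF f, of a] SM_scl[OF g, of a] SM_scl[OF f, of b]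
  show "smul a (add F G) = add (smul a F) (smul a G)"
    unfolding F G add_cls[OF f g] smul_cls[OF f] smul_cls[OF g] smul_cls[OF pl(1)]
      add_cls[OF s(1,2)]
    using rep_add(2)[OF f g] rep_add(2)[OF s(1,2)]
    by (intro cls_eqI, eventually_elim) (simp add: X.smul_add_right)
  show "smul (a + b) F = add (smul a F) (smul b F)"
    unfolding F smul_cls[OF f] add_cls[OF s(1,3)] using rep_add(2)[OF s(1,3)]
    by (intro cls_eqI, eventually_elim) (simp add: X.smul_add_left)
  show "smul a (smul b F) = smul (a * b) F"
    unfolding F smul_cls[OF f] smul_cls[OF s(3)] by (simp add: X.smul_smul)
  show "smul 1 F = F" unfolding F smul_cls[OF f] by (simp add: X.smul_one)
qed

sublocale L: vector_space_on L add zero smul by (rule vector_space_on_L0)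

lemma diff_cls:
  assumes f: "f \<in> SM" and g: "g \<in> SM"
  shows "\<exists>h\<in>SM. L.diff (cls f) (cls g) = cls h \<and> (AE \<omega> in \<mu>. h \<omega> = f \<omega> - g \<omega>)"
proof -
  note s = SM_scl[OF g, of "- 1"]
  have "L.diff (cls f) (cls g) = cls (rep_add f (\<lambda>\<omega>. scl (- 1) (g \<omega>)))"
    unfolding L.diff_def smul_cls[OF g] add_cls[OF f s] ..
  moreover have "AE \<omega> in \<mu>. rep_add f (\<lambda>\<omega>. scl (- 1) (g \<omega>)) \<omega> = f \<omega> - g \<omega>"
    using rep_add(2)[OF f s] by eventually_elim (simp add: scl_minus_one)
  ultimately show ?thesis using rep_add(1)[OF f s] by blast
qed

end

section \<open>The modular\<close>

lemma Orlicz_function_mono: "Orlicz_function F \<Longrightarrow> 0 \<le> s \<Longrightarrow> s \<le> t \<Longrightarrow> F s \<le> F t"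
  by (auto simp: Orlicz_function_def mono_on_def)

text \<open>The definition does not prescribe the value at 0, but monotonicity puts it below the
  limit from the right.\<close>

lemma Orlicz_function_zero:
  assumes F: "Orlicz_function F"
  shows "F 0 = 0"
proof -
  have lim: "(F \<longlongrightarrow> 0) (at_right 0)" using F by (simp add: Orlicz_function_def)
  have "\<forall>\<^sub>F t in at_right 0. F 0 \<le> F t"
    using Orlicz_function_mono[OF F] by (auto simp: eventually_at_right_field intro: exI[of _ 1])
  then have "F 0 \<le> 0" using tendsto_lowerbound[OF lim] by simp
  then show ?thesis by simp
qed

lemma Orlicz_function_pos:
  assumes F: "Orlicz_function F"
  shows "\<exists>t>0. F t > 0"
proof -
  obtain l where "l > 0" "(F \<longlongrightarrow> l) at_top" using F by (auto simp: Orlicz_function_def)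
  then have "\<forall>\<^sub>F t in at_top. F t > 0" by (simp add: order_tendstoD(1))
  then have "\<forall>\<^sub>F t in at_top. F t > 0 \<and> t > 0"
    using eventually_gt_at_top[of 0] by (rule eventually_conj)
  then obtain t where "F t > 0 \<and> t > 0"
    using eventually_happens' trivial_limit_at_top_linorder by blast
  then show ?thesis by blast
qed

text \<open>By left-continuity a strict lower bound persists slightly to the left of
  \<open>t\<close>, where a rational point is found. Here \<open>t\<close> is positive because
  \<open>F 0 = 0\<close> cannot exceed \<open>a\<close>.\<close>

lemma Orlicz_function_left_rational:
  assumes F: "Orlicz_function F" and t: "t \<ge> 0" and a: "a < F t"
  shows "\<exists>q\<in>\<rat>. 0 \<le> q \<and> q < t \<and> a < F q"
proof -
  have "t > 0" using t a Orlicz_function_zero[OF F] by (cases "t = 0") auto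
  then have "(F \<longlongrightarrow> F t) (at_left t)"
    using F by (auto simp: Orlicz_function_def continuous_within)
  then have "\<forall>\<^sub>F s in at_left t. a < F s" using a by (rule order_tendstoD(1))
  then obtain b where b: "b < t" "\<forall>s>b. s < t \<longrightarrow> a < F s"
    by (auto simp: eventually_at_left_field)
  obtain q where q: "q \<in> \<rat>" "max b 0 < q" "q < t"
    using Rats_dense_in_real[of "max b 0" t] b(1) \<open>t > 0\<close> by auto
  then show ?thesis using b(2) by (intro bexI[of _ q]) auto
qed

locale musielak_orlicz = measurable_classes scl N \<mu>
  for scl :: "'k::real_normed_field \<Rightarrow> 'x::ab_group_add \<Rightarrow> 'x" and N :: "'x \<Rightarrow> real"
    and \<mu> :: "'w measure" +
  fixes M :: "'w \<Rightarrow> real \<Rightarrow> ennreal"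
  assumes Musielak_Orlicz: "Musielak_Orlicz_function \<mu> M"
    and complete: "complete_vector_topology (+) 0 scl (quasi_norm_top N)"
begin

lemma Orlicz: "\<omega> \<in> space \<mu> \<Longrightarrow> Orlicz_function (M \<omega>)"
  using Musielak_Orlicz by (simp add: Musielak_Orlicz_function_def)

lemmas M_mono = Orlicz_function_mono[OF Orlicz]
lemmas M_zero = Orlicz_function_zero[OF Orlicz]

text \<open>Measurability is given for constant second arguments only. By left-continuity
  \<open>a < M \<omega> (g \<omega>)\<close> is witnessed by a rational
  \<open>q < g \<omega>\<close>, and monotonicity gives the converse, so the superlevel set is a
  countable union.\<close>

lemma measurable_M:
  assumes g: "g \<in> borel_measurable \<mu>" "\<And>\<omega>. \<omega> \<in> space \<mu> \<Longrightarrow> g \<omega> \<ge> 0"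
  shows "(\<lambda>\<omega>. M \<omega> (g \<omega>)) \<in> borel_measurable \<mu>"
proof (rule borel_measurableI_greater)
  fix a
  define Q where "Q = {q \<in> \<rat>. q \<ge> (0::real)}"
  have "countable Q" unfolding Q_def by (rule countable_subset[OF _ countable_rat]) auto
  have "{\<omega> \<in> space \<mu>. a < M \<omega> (g \<omega>)} =
      (\<Union>q\<in>Q. {\<omega> \<in> space \<mu>. q < g \<omega>} \<inter> {\<omega> \<in> space \<mu>. a < M \<omega> q})" (is "_ = ?R")
  proof (rule set_eqI, rule iffI)
    fix \<omega> assume "\<omega> \<in> {\<omega> \<in> space \<mu>. a < M \<omega> (g \<omega>)}"
    then have \<omega>: "\<omega> \<in> space \<mu>" "a < M \<omega> (g \<omega>)" by auto
    then obtain q where "q \<in> \<rat>" "0 \<le> q" "q < g \<omega>" "a < M \<omega> q"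
      using Orlicz_function_left_rational[OF Orlicz[OF \<omega>(1)] g(2)[OF \<omega>(1)] \<omega>(2)] by blast
    then show "\<omega> \<in> ?R" using \<omega>(1) by (auto simp: Q_def)
  next
    fix \<omega> assume "\<omega> \<in> ?R"
    then obtain q where "q \<ge> 0" "\<omega> \<in> space \<mu>" "q < g \<omega>" "a < M \<omega> q" by (auto simp: Q_def)
    then show "\<omega> \<in> {\<omega> \<in> space \<mu>. a < M \<omega> (g \<omega>)}" using M_mono[of \<omega> q "g \<omega>"] by auto
  qed
  also have "\<dots> \<in> sets \<mu>"
  proof (intro sets.countable_UN'' \<open>countable Q\<close> sets.Int)
    fix q assume "q \<in> Q"
    then have "(\<lambda>\<omega>. M \<omega> q) \<in> borel_measurable \<mu>"
      using Musielak_Orlicz by (simp add: Musielak_Orlicz_function_def Q_def)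
    then show "{\<omega> \<in> space \<mu>. a < M \<omega> q} \<in> sets \<mu>" by measurable
    show "{\<omega> \<in> space \<mu>. q < g \<omega>} \<in> sets \<mu>" using g(1) by measurable
  qed
  finally show "{\<omega> \<in> space \<mu>. a < M \<omega> (g \<omega>)} \<in> sets \<mu>" .
qed

text \<open>The modular of \<open>s f\<close>. With the scale as a real parameter, scalars of the
  field act on it through their norm only, see \<open>J_scl\<close>.\<close>

definition J :: "real \<Rightarrow> ('w \<Rightarrow> 'x) \<Rightarrow> ennreal"
  where "J s f = (\<integral>\<^sup>+\<omega>. M \<omega> (s * N (f \<omega>)) \<partial>\<mu>)"

lemma J_measurable:
  "f \<in> measurable \<mu> borel_X \<Longrightarrow> s \<ge> 0 \<Longrightarrow> (\<lambda>\<omega>. M \<omega> (s * N (f \<omega>))) \<in> borel_measurable \<mu>"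
  by (intro measurable_M borel_measurable_times borel_measurable_const borel_measurable_N)
    (auto simp: N_nonneg)

lemma J_mono: "0 \<le> s \<Longrightarrow> s \<le> t \<Longrightarrow> J s f \<le> J t f"
  unfolding J_def using N_nonneg by (intro nn_integral_mono M_mono mult_right_mono) auto

lemma J_cong: "AE \<omega> in \<mu>. f \<omega> = g \<omega> \<Longrightarrow> J s f = J s g"
  unfolding J_def by (rule nn_integral_cong_AE) auto

lemma J_scl: "J s (\<lambda>\<omega>. scl a (f \<omega>)) = J (s * norm a) f"
  by (simp add: J_def N_smul mult.assoc)

lemma J_zero: "J s (\<lambda>\<omega>. 0) = 0"
proof -
  have "J s (\<lambda>\<omega>. 0) = (\<integral>\<^sup>+\<omega>. 0 \<partial>\<mu>)"
    unfolding J_def using M_zero N_zero by (intro nn_integral_cong) auto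
  then show ?thesis by simp
qed

lemma J_add:
  assumes f: "f \<in> measurable \<mu> borel_X" and g: "g \<in> measurable \<mu> borel_X"
    and h: "AE \<omega> in \<mu>. h \<omega> = f \<omega> + g \<omega>" and s: "s \<ge> 0"
  shows "J (s / K) h \<le> J s f + J s g"
proof -
  have "J (s / K) h \<le> (\<integral>\<^sup>+\<omega>. M \<omega> (s * N (f \<omega>)) + M \<omega> (s * N (g \<omega>)) \<partial>\<mu>)"
    unfolding J_def
  proof (rule nn_integral_mono_AE)
    from h AE_space[of \<mu>]
    show "AE \<omega> in \<mu>. M \<omega> (s / K * N (h \<omega>)) \<le> M \<omega> (s * N (f \<omega>)) + M \<omega> (s * N (g \<omega>))"
    proof eventually_elim
      case (elim \<omega>)
      define m where "m = max (N (f \<omega>)) (N (g \<omega>))"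
      have "s / K * N (h \<omega>) \<le> s / K * (K * m)"
        unfolding m_def elim(1) using K s by (intro mult_left_mono) auto
      also have "\<dots> = s * m" using K(1) by simp
      finally have "M \<omega> (s / K * N (h \<omega>)) \<le> M \<omega> (s * m)"
        using K(1) s N_nonneg by (intro M_mono elim) auto
      \<comment> \<open>The value at the maximum is one of the two summands.\<close>
      also have "\<dots> \<le> M \<omega> (s * N (f \<omega>)) + M \<omega> (s * N (g \<omega>))"
        by (auto simp: m_def max_def add_increasing add_increasing2)
      finally show ?case .
    qed
  qed
  also have "\<dots> = J s f + J s g"
    unfolding J_def using f g s J_measurable by (intro nn_integral_add) auto
  finally show ?thesis .
qed

text \<open>A single scale would not suffice, since \<open>M \<omega>\<close> may vanish near 0. If
  \<open>N (f \<omega>) > 0\<close>, then some multiple \<open>n * N (f \<omega>)\<close> passes a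
  point where \<open>M \<omega>\<close> is positive; countably many scales leave one null
  set.\<close>

lemma J_null:
  assumes f: "f \<in> measurable \<mu> borel_X" and "\<And>n. J (real n) f = 0"
  shows "AE \<omega> in \<mu>. f \<omega> = 0"
proof -
  have "AE \<omega> in \<mu>. M \<omega> (real n * N (f \<omega>)) = 0" for n
    using assms(2)[of n] nn_integral_0_iff_AE[OF J_measurable[OF f, of "real n"]]
    by (simp add: J_def)
  then have "AE \<omega> in \<mu>. \<forall>n. M \<omega> (real n * N (f \<omega>)) = 0" by (simp add: AE_all_countable)
  with AE_space[of \<mu>] show ?thesis
  proof eventually_elim
    case (elim \<omega>)
    show ?case
    proof (rule ccontr)
      assume "f \<omega> \<noteq> 0"
      then have pos: "N (f \<omega>) > 0" using N_nonneg[of "f \<omega>"] N_eq_0[of "f \<omega>"] by simp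
      obtain t where t: "t > 0" "M \<omega> t > 0" using Orlicz_function_pos[OF Orlicz[OF elim(1)]] by blast
      obtain n where "real n > t / N (f \<omega>)" using reals_Archimedean2 by blast
      then have "t \<le> real n * N (f \<omega>)" using pos by (simp add: field_simps)
      then have "M \<omega> t \<le> M \<omega> (real n * N (f \<omega>))" using t(1) by (intro M_mono elim) auto
      then show False using elim(2) t(2) by simp
    qed
  qed
qed

lemma J_small:
  assumes f: "f \<in> measurable \<mu> borel_X" and u: "u > 0" "J u f < \<infinity>" and e: "e > 0"
  shows "\<exists>\<delta>>0. J \<delta> f < e"
proof -
  define s where "s n = u / real (Suc n)" for n
  have s: "s n > 0" "s n \<le> u" for n using u by (auto simp: s_def field_simps)
  have s_lim: "s \<longlonglongrightarrow> 0"
    unfolding s_def using tendsto_mult[OF tendsto_const LIMSEQ_inverse_real_of_nat, of u]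
    by (simp add: divide_inverse)
  have "(\<lambda>n. \<integral>\<^sup>+\<omega>. M \<omega> (s n * N (f \<omega>)) \<partial>\<mu>) \<longlonglongrightarrow> (\<integral>\<^sup>+\<omega>. 0 \<partial>\<mu>)"
  proof (rule nn_integral_dominated_convergence)
    show "(\<lambda>\<omega>. M \<omega> (s n * N (f \<omega>))) \<in> borel_measurable \<mu>" for n
      using J_measurable[OF f] s less_imp_le by blast
    show "(\<lambda>\<omega>. M \<omega> (u * N (f \<omega>))) \<in> borel_measurable \<mu>"
      using J_measurable[OF f] u less_imp_le by blast
    show "AE \<omega> in \<mu>. M \<omega> (s n * N (f \<omega>)) \<le> M \<omega> (u * N (f \<omega>))" for n
      using s[of n] N_nonneg by (intro AE_I2 M_mono mult_right_mono) auto
    show "(\<integral>\<^sup>+\<omega>. M \<omega> (u * N (f \<omega>)) \<partial>\<mu>) < \<infinity>" using u by (simp add: J_def)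
    show "AE \<omega> in \<mu>. (\<lambda>n. M \<omega> (s n * N (f \<omega>))) \<longlonglongrightarrow> 0"
    proof (rule AE_I2)
      fix \<omega> assume \<omega>: "\<omega> \<in> space \<mu>"
      show "(\<lambda>n. M \<omega> (s n * N (f \<omega>))) \<longlonglongrightarrow> 0"
      proof (cases "N (f \<omega>) = 0")
        \<comment> \<open>Separate because the limit of \<open>M \<omega>\<close> at 0 is taken over
          positive arguments; at 0 itself \<open>M_zero\<close> applies.\<close>
        case True
        then show ?thesis using M_zero[OF \<omega>] by simp
      next
        case False
        then have pos: "N (f \<omega>) > 0" using N_nonneg[of "f \<omega>"] by simp
        have "(\<lambda>n. s n * N (f \<omega>)) \<longlonglongrightarrow> 0" using tendsto_mult_right[OF s_lim, of "N (f \<omega>)"] by simp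
        then have "filterlim (\<lambda>n. s n * N (f \<omega>)) (at_right 0) sequentially"
          using s(1) pos by (intro filterlim_at_withinI) auto
        moreover have "(M \<omega> \<longlongrightarrow> 0) (at_right 0)" using Orlicz[OF \<omega>] by (simp add: Orlicz_function_def)
        ultimately show ?thesis by (rule filterlim_compose[rotated])
      qed
    qed
  qed auto
  then have "(\<lambda>n. J (s n) f) \<longlonglongrightarrow> 0" by (simp add: J_def)
  then have "\<forall>\<^sub>F n in sequentially. J (s n) f < e" using e by (rule order_tendstoD(2))
  then obtain n where "J (s n) f < e" using eventually_happens' sequentially_bot by blast
  then show ?thesis using s(1) by blast
qed

section \<open>The linear space of classes with finite modular at some scale\<close>

abbreviation "V \<equiv> LM \<mu> M scl N"

lemma in_LM_iff: "F \<in> V \<longleftrightarrow> (\<exists>f\<in>SM. F = cls f \<and> (\<exists>u>0. J u f < \<infinity>))"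
proof
  assume "F \<in> V"
  then obtain f g u where g: "g \<in> SM" "F = cls g" and f: "f \<in> F" "u > 0" "J u f < \<infinity>"
    by (auto simp: LM_def L0_eq J_def)
  then have "J u g = J u f" using mem_clsD by (intro J_cong) auto
  then show "\<exists>f\<in>SM. F = cls f \<and> (\<exists>u>0. J u f < \<infinity>)" using f g by (intro bexI[of _ g] conjI exI[of _ u]) auto
next
  assume "\<exists>f\<in>SM. F = cls f \<and> (\<exists>u>0. J u f < \<infinity>)"
  then obtain f u where f: "f \<in> SM" "F = cls f" "u > 0" "J u f < \<infinity>" by blast
  then have "F \<in> L" "f \<in> F" using cls_mem by (auto simp: L0_eq)
  then show "F \<in> V" unfolding LM_def using f(3,4) unfolding J_def by blast
qed

text \<open>Stated for every \<open>h\<close> that is almost everywhere the sum, so that it covers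
  both \<open>rep_add\<close> and the pointwise limit in the completeness proof.\<close>

lemma LM_add_closed:
  assumes f: "f \<in> SM" "u > 0" "J u f < \<infinity>" and g: "g \<in> SM" "v > 0" "J v g < \<infinity>"
    and h: "AE \<omega> in \<mu>. h \<omega> = f \<omega> + g \<omega>"
  shows "\<exists>w>0. J w h < \<infinity>"
proof -
  define w where "w = min u v"
  have w: "w > 0" using f g by (simp add: w_def)
  have "J w f \<le> J u f" "J w g \<le> J v g" using w by (auto intro!: J_mono simp: w_def)
  then have fin: "J w f < \<infinity>" "J w g < \<infinity>" using f g by (auto intro: le_less_trans)
  have "J (w / K) h \<le> J w f + J w g"
    using SM_measurable f g h w by (intro J_add) auto
  also have "\<dots> < \<infinity>" using fin by simp
  finally have "J (w / K) h < \<infinity>" .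
  moreover have "w / K > 0" using w K(1) by simp
  ultimately show ?thesis by blast
qed

lemma vector_space_on_LM: "vector_space_on V add zero smul"
proof (rule L.vector_space_on_subset)
  show "V \<subseteq> L" by (auto simp: LM_def)
  show "zero \<in> V"
    unfolding in_LM_iff zero_cls using SM_zero J_zero by (intro bexI[of _ "\<lambda>\<omega>. 0"] conjI exI[of _ 1]) auto
next
  fix F G assume "F \<in> V" "G \<in> V"
  then obtain f u g v where fg: "f \<in> SM" "u > 0" "J u f < \<infinity>" "g \<in> SM" "v > 0" "J v g < \<infinity>"
    and FG: "F = cls f" "G = cls g"
    unfolding in_LM_iff by blast
  have "\<exists>w>0. J w (rep_add f g) < \<infinity>"
    using LM_add_closed[OF fg] rep_add(2) fg by blast
  then show "add F G \<in> V"
    unfolding in_LM_iff FG using add_cls rep_add(1) fg by blast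
next
  fix a :: 'k and F assume "F \<in> V"
  then obtain f u where f: "f \<in> SM" "u > 0" "J u f < \<infinity>" "F = cls f" unfolding in_LM_iff by blast
  have pos: "u / (norm a + 1) > 0" using f(2) by (simp add: add_nonneg_pos)
  have "norm a + 1 \<noteq> 0" using norm_ge_zero[of a] by linarith
  then have "u / (norm a + 1) * (norm a + 1) = u" by simp
  then have "u / (norm a + 1) * norm a \<le> u"
    using mult_left_mono[of "norm a" "norm a + 1" "u / (norm a + 1)"] pos by linarith
  then have "J (u / (norm a + 1)) (\<lambda>\<omega>. scl a (f \<omega>)) \<le> J u f"
    unfolding J_scl using pos by (intro J_mono mult_nonneg_nonneg) auto
  then have "J (u / (norm a + 1)) (\<lambda>\<omega>. scl a (f \<omega>)) < \<infinity>" using f(3) by (rule le_less_trans)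
  then show "smul a F \<in> V"
    unfolding in_LM_iff f(4) smul_cls[OF f(1)] using SM_scl[OF f(1)] pos by blast
qed

end

lemma suminf_ennreal_tendsto_0:
  fixes c :: "nat \<Rightarrow> ennreal"
  assumes "(\<Sum>i. c i) \<noteq> \<infinity>"
  shows "c \<longlonglongrightarrow> 0"
proof -
  have "c i < \<infinity>" for i
    using ennreal_suminf_lessD[of c \<infinity> i] assms by (simp add: less_top)
  then have c: "c i = ennreal (enn2real (c i))" for i by simp
  have "(\<Sum>i. ennreal (enn2real (c i))) \<noteq> top" using assms c by simp
  then have "summable (\<lambda>i. enn2real (c i))" by (intro summable_suminf_not_top) auto
  then have "(\<lambda>i. enn2real (c i)) \<longlonglongrightarrow> 0" by (rule summable_LIMSEQ_zero)
  then have "(\<lambda>i. ennreal (enn2real (c i))) \<longlonglongrightarrow> ennreal 0" by (rule tendsto_ennrealI)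
  then show ?thesis using c by simp
qed

context musielak_orlicz
begin

section \<open>Gauges of the modular\<close>

text \<open>\<open>g t = t\<close> yields a quasi-F-norm and \<open>g t = 1\<close> the Luxemburg functional.\<close>

definition gauge :: "(real \<Rightarrow> ennreal) \<Rightarrow> ('w \<Rightarrow> 'x) set \<Rightarrow> real"
  where "gauge g F = Inf {t. t > 0 \<and> (\<exists>f\<in>F. J (1 / t) f < g t)}"

lemma gauge_cls:
  assumes "f \<in> SM"
  shows "gauge g (cls f) = Inf {t. t > 0 \<and> J (1 / t) f < g t}"
proof -
  have "(\<exists>f'\<in>cls f. J (1 / t) f' < g t) \<longleftrightarrow> J (1 / t) f < g t" for t
  proof
    assume "\<exists>f'\<in>cls f. J (1 / t) f' < g t"
    then obtain f' where f': "f' \<in> cls f" "J (1 / t) f' < g t" by blast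
    then show "J (1 / t) f < g t" using J_cong[OF mem_clsD(2)[OF f'(1)]] by simp
  qed (use cls_mem[OF assms] in blast)
  then show ?thesis by (simp add: gauge_def)
qed

lemma gauge_le:
  assumes "f \<in> SM" "t > 0" "J (1 / t) f < g t"
  shows "gauge g (cls f) \<le> t"
  unfolding gauge_cls[OF assms(1)] using assms by (intro cInf_lower bdd_belowI[where m = 0]) auto

lemma gauge_nonneg:
  assumes "f \<in> SM" "t > 0" "J (1 / t) f < g t"
  shows "gauge g (cls f) \<ge> 0"
  unfolding gauge_cls[OF assms(1)] using assms by (intro cInf_greatest) auto

text \<open>As \<open>g\<close> and the modular are monotone, the set under the infimum is upward
  closed, so every \<open>r\<close> above the infimum belongs to it. The given \<open>t\<close>
  shows that the set is nonempty; otherwise the infimum would carry no information.\<close>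

lemma gauge_lessD:
  assumes "mono g" "f \<in> SM" "t > 0" "J (1 / t) f < g t" "gauge g (cls f) < r"
  shows "r > 0" "J (1 / r) f < g r"
proof -
  have "{t. t > 0 \<and> J (1 / t) f < g t} \<noteq> {}" using assms(3,4) by auto
  then obtain s where s: "s > 0" "J (1 / s) f < g s" "s < r"
    using assms(5) cInf_lessD[of "{t. t > 0 \<and> J (1 / t) f < g t}" r]
    unfolding gauge_cls[OF assms(2)] by blast
  then show "r > 0" by simp
  have "J (1 / r) f \<le> J (1 / s) f" using s by (intro J_mono) (auto simp: frac_le)
  also have "\<dots> < g s" by (rule s)
  also have "\<dots> \<le> g r" using assms(1) s by (simp add: monoD)
  finally show "J (1 / r) f < g r" .
qed

definition fnorm :: "('w \<Rightarrow> 'x) set \<Rightarrow> real"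
  where "fnorm = gauge ennreal"

lemma fnorm_finite:
  assumes "u > 0" "J u f < \<infinity>"
  shows "\<exists>t>0. J (1 / t) f < ennreal t"
proof -
  \<comment> \<open>The first term makes the scale \<open>1 / t\<close> at most \<open>u\<close>,
    the second makes \<open>t\<close> exceed the value of the modular.\<close>
  define t where "t = max (1 / u) (enn2real (J u f) + 1)"
  have u: "t \<ge> 1 / u" "1 / u > 0" using assms by (auto simp: t_def)
  then have t: "t > 0" by linarith
  then have "1 / t \<le> u" using u(1) assms(1) by (simp add: field_simps)
  then have "J (1 / t) f \<le> J u f" using t by (intro J_mono) auto
  also have "\<dots> = ennreal (enn2real (J u f))" using assms by simp
  also have "\<dots> < ennreal t" using t by (intro ennreal_lessI) (auto simp: t_def)
  finally show ?thesis using t by blast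
qed

lemma mono_ennreal: "mono ennreal"
  by (rule monoI) (rule ennreal_leI)

lemma fnorm_le: "f \<in> SM \<Longrightarrow> t > 0 \<Longrightarrow> J (1 / t) f < ennreal t \<Longrightarrow> fnorm (cls f) \<le> t"
  unfolding fnorm_def by (rule gauge_le)

lemma cls_LM_iff: "f \<in> SM \<Longrightarrow> cls f \<in> V \<longleftrightarrow> (\<exists>u>0. J u f < \<infinity>)"
proof
  assume f: "f \<in> SM" and "cls f \<in> V"
  then obtain g u where g: "g \<in> SM" "cls f = cls g" "u > 0" "J u g < \<infinity>" unfolding in_LM_iff by blast
  have "f \<in> cls g" using cls_mem[OF f] g(2) by simp
  then have "J u g = J u f" using mem_clsD(2) J_cong by blast
  then show "\<exists>u>0. J u f < \<infinity>" using g by auto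
qed (auto simp: in_LM_iff)

lemma fnorm_lessD:
  assumes "f \<in> SM" "cls f \<in> V" "fnorm (cls f) < r"
  shows "r > 0" "J (1 / r) f < ennreal r"
proof -
  obtain t where "t > 0" "J (1 / t) f < ennreal t"
    using assms(1,2) fnorm_finite unfolding cls_LM_iff[OF assms(1)] by blast
  note * = gauge_lessD[OF mono_ennreal assms(1) this, of r]
  show "r > 0" "J (1 / r) f < ennreal r" using * assms(3) unfolding fnorm_def by auto
qed

lemma fnorm_nonneg:
  assumes "F \<in> V"
  shows "fnorm F \<ge> 0"
proof -
  obtain f u where f: "f \<in> SM" "F = cls f" "u > 0" "J u f < \<infinity>" using assms unfolding in_LM_iff by blast
  then obtain t where "t > 0" "J (1 / t) f < ennreal t" using fnorm_finite by blast
  then show ?thesis unfolding fnorm_def f(2) using f(1) by (intro gauge_nonneg)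
qed

lemma J_le_epsilon:
  assumes "\<And>e. e > 0 \<Longrightarrow> J s f \<le> ennreal e"
  shows "J s f = 0"
  using ennreal_le_epsilon[of 0 "J s f"] assms by simp

sublocale E: quasi_F_norm V add zero smul fnorm K
proof (intro quasi_F_norm.intro vector_space_on_LM quasi_F_norm_axioms.intro)
  show "K \<ge> 1" using K(1) by simp
next
  fix F assume F: "F \<in> V"
  then show "fnorm F \<ge> 0" by (rule fnorm_nonneg)
  assume zero: "fnorm F = 0"
  obtain f where f: "f \<in> SM" "F = cls f" using F unfolding in_LM_iff by blast
  have "J (real n) f = 0" for n
  proof (rule J_le_epsilon)
    fix e :: real assume e: "e > 0"
    \<comment> \<open>This one radius makes the scale \<open>1 / r\<close> at least \<open>n\<close>
      and the bound \<open>r\<close> at most \<open>e\<close>.\<close>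
    define r where "r = min e (1 / (real n + 1))"
    have r: "r > 0" using e by (simp add: r_def)
    have "r \<le> 1 / (real n + 1)" by (simp add: r_def)
    then have "real n \<le> 1 / r" using r by (simp add: field_simps)
    then have "J (real n) f \<le> J (1 / r) f" by (intro J_mono) auto
    also have "\<dots> \<le> ennreal r" using fnorm_lessD(2)[of f r] f F zero r by simp
    also have "\<dots> \<le> ennreal e" by (intro ennreal_leI) (simp add: r_def)
    finally show "J (real n) f \<le> ennreal e" .
  qed
  then have "AE \<omega> in \<mu>. f \<omega> = 0" using f(1) by (intro J_null SM_measurable)
  then show "F = zero" unfolding f(2) zero_cls by (rule cls_eqI)
next
  fix F G assume F: "F \<in> V" and G: "G \<in> V"
  obtain f where f: "f \<in> SM" "F = cls f" using F unfolding in_LM_iff by blast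
  obtain g where g: "g \<in> SM" "G = cls g" using G unfolding in_LM_iff by blast
  \<comment> \<open>The infimum is not claimed to be attained, so the estimate is shown for every
    \<open>t\<close> above it and \<open>dense_ge\<close> finishes.\<close>
  have "fnorm (add F G) / K \<le> t" if t: "max (fnorm F) (fnorm G) < t" for t
  proof -
    have f': "t > 0" "J (1 / t) f < ennreal t"
      using fnorm_lessD[of f t] f F t by auto
    have g': "J (1 / t) g < ennreal t"
      using fnorm_lessD(2)[of g t] g G t by auto
    have "J (1 / (K * t)) (rep_add f g) \<le> J (1 / t) f + J (1 / t) g"
      using J_add[OF SM_measurable[OF f(1)] SM_measurable[OF g(1)] rep_add(2)[OF f(1) g(1)], of "1 / t"] f'(1)
      by (simp add: mult.commute)
    \<comment> \<open>The values add up to less than \<open>2 * t\<close>, and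
      \<open>K \<ge> 2\<close> absorbs the factor 2.\<close>
    also have "\<dots> < ennreal (t + t)" using f'(2) g' by (rule add_mono_ennreal)
    also have "\<dots> \<le> ennreal (K * t)"
      using mult_right_mono[OF K(1), of t] f'(1) by (intro ennreal_leI) simp
    finally have "fnorm (cls (rep_add f g)) \<le> K * t"
      using f'(1) K(1) rep_add(1)[OF f(1) g(1)] by (intro fnorm_le) auto
    then show ?thesis
      unfolding f(2) g(2) add_cls[OF f(1) g(1)] using K(1) by (simp add: field_simps)
  qed
  then have "fnorm (add F G) / K \<le> max (fnorm F) (fnorm G)" by (rule dense_ge)
  then show "fnorm (add F G) \<le> K * max (fnorm F) (fnorm G)"
    using K(1) by (simp add: pos_divide_le_eq mult.commute)
next
  fix F and a :: 'k assume F: "F \<in> V"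
  obtain f where f: "f \<in> SM" "F = cls f" using F unfolding in_LM_iff by blast
  define m where "m = max 1 (norm a)"
  have m: "m \<ge> 1" "norm a \<le> m" by (auto simp: m_def)
  have "fnorm (smul a F) / m \<le> t" if t: "fnorm F < t" for t
  proof -
    have f': "t > 0" "J (1 / t) f < ennreal t" using fnorm_lessD[of f t] f F t by auto
    have "1 / (m * t) * norm a \<le> 1 / (m * t) * m"
      using m f'(1) by (intro mult_left_mono) auto
    then have "J (1 / (m * t)) (\<lambda>\<omega>. scl a (f \<omega>)) \<le> J (1 / t) f"
      unfolding J_scl using m f'(1) by (intro J_mono) auto
    also have "\<dots> < ennreal t" by (rule f')
    also have "\<dots> \<le> ennreal (m * t)"
      using mult_right_mono[OF m(1), of t] f'(1) by (intro ennreal_leI) simp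
    finally have "fnorm (smul a F) \<le> m * t"
      unfolding f(2) smul_cls[OF f(1)] using f'(1) m SM_scl[OF f(1)] by (intro fnorm_le) auto
    then show ?thesis using m by (simp add: field_simps)
  qed
  then have "fnorm (smul a F) / m \<le> fnorm F" by (rule dense_ge)
  then show "fnorm (smul a F) \<le> max 1 (norm a) * fnorm F"
    using m(1) by (simp add: pos_divide_le_eq mult.commute flip: m_def)
next
  fix F and r :: real assume F: "F \<in> V" and r: "r > 0"
  obtain f u where f: "f \<in> SM" "F = cls f" "u > 0" "J u f < \<infinity>" using F unfolding in_LM_iff by blast
  obtain \<delta> where \<delta>: "\<delta> > 0" "J \<delta> f < ennreal (r / 2)"
    using J_small[OF SM_measurable[OF f(1)] f(3,4), of "ennreal (r / 2)"] r by auto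
  \<comment> \<open>The bound on \<open>norm a\<close> keeps \<open>norm a / (r / 2)\<close> below
    \<delta>. The half is there because \<open>fnorm_le\<close> yields only a weak
    inequality.\<close>
  have "fnorm (smul a F) < r" if a: "norm a < \<delta> * (r / 2)" for a :: 'k
  proof -
    have "J (1 / (r / 2)) (\<lambda>\<omega>. scl a (f \<omega>)) \<le> J \<delta> f"
      unfolding J_scl using r a by (intro J_mono) (auto simp: field_simps)
    also have "\<dots> < ennreal (r / 2)" by (rule \<delta>)
    finally have "fnorm (smul a F) \<le> r / 2"
      unfolding f(2) smul_cls[OF f(1)] using r SM_scl[OF f(1)] by (intro fnorm_le) auto
    then show ?thesis using r by simp
  qed
  moreover have "\<delta> * (r / 2) > 0" using \<delta> r by simp
  ultimately show "\<exists>\<delta>>0. \<forall>a::'k. norm a < \<delta> \<longrightarrow> fnorm (smul a F) < r" by blast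
qed

section \<open>Completeness\<close>

lemma measurable_diff:
  assumes A: "separable_subspace A"
    and f: "f \<in> measurable \<mu> borel_X" "\<And>\<omega>. \<omega> \<in> space \<mu> \<Longrightarrow> f \<omega> \<in> cl A"
    and g: "g \<in> measurable \<mu> borel_X" "\<And>\<omega>. \<omega> \<in> space \<mu> \<Longrightarrow> g \<omega> \<in> cl A"
  shows "(\<lambda>\<omega>. f \<omega> - g \<omega>) \<in> measurable \<mu> borel_X"
proof -
  have "(\<lambda>\<omega>. f \<omega> + scl (- 1) (g \<omega>)) \<in> measurable \<mu> borel_X"
    using separable_subspaceD(4)[OF A] g(2)
    by (intro measurable_add[OF separable_subspaceD(1)[OF A] f measurable_scl[OF g(1)]]) auto
  then show ?thesis by (simp add: scl_minus_one)
qed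

text \<open>A Fatou estimate that replaces lower semicontinuity of the integrand by a loss of
  \<open>K\<close>: with \<open>a = N (f \<omega> - l \<omega>)\<close>, as soon as
  \<open>N (x i \<omega> - l \<omega>) < a / K\<close>, the quasi-triangle inequality leaves only
  \<open>a \<le> K * N (f \<omega> - x i \<omega>)\<close>, and monotonicity applies. For
  \<open>a = 0\<close> the left-hand integrand vanishes.\<close>

lemma J_limit:
  fixes x :: "nat \<Rightarrow> 'w \<Rightarrow> 'x"
  assumes meas: "\<And>i. (\<lambda>\<omega>. f \<omega> - x i \<omega>) \<in> measurable \<mu> borel_X"
    and lim: "AE \<omega> in \<mu>. \<forall>r>0. \<exists>k. \<forall>i\<ge>k. N (x i \<omega> - l \<omega>) < r"
    and bound: "\<And>i. i \<ge> i0 \<Longrightarrow> J s (\<lambda>\<omega>. f \<omega> - x i \<omega>) \<le> c"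
    and s: "s \<ge> 0"
  shows "J (s / K) (\<lambda>\<omega>. f \<omega> - l \<omega>) \<le> c"
proof -
  have "J (s / K) (\<lambda>\<omega>. f \<omega> - l \<omega>) \<le> (\<integral>\<^sup>+\<omega>. liminf (\<lambda>i. M \<omega> (s * N (f \<omega> - x i \<omega>))) \<partial>\<mu>)"
    unfolding J_def
  proof (rule nn_integral_mono_AE)
    from lim AE_space[of \<mu>]
    show "AE \<omega> in \<mu>. M \<omega> (s / K * N (f \<omega> - l \<omega>)) \<le> liminf (\<lambda>i. M \<omega> (s * N (f \<omega> - x i \<omega>)))"
    proof eventually_elim
      case (elim \<omega>)
      define a where "a = N (f \<omega> - l \<omega>)"
      show ?case
      proof (cases "a = 0")
        case True
        then show ?thesis using M_zero[OF elim(2)] by (simp add: a_def)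
      next
        case False
        then have a: "a > 0" "a / K > 0" using N_nonneg[of "f \<omega> - l \<omega>"] K(1) by (auto simp: a_def)
        obtain k where k: "\<And>i. i \<ge> k \<Longrightarrow> N (x i \<omega> - l \<omega>) < a / K" using elim(1) a(2) by blast
        have "M \<omega> (s / K * a) \<le> M \<omega> (s * N (f \<omega> - x i \<omega>))" if i: "i \<ge> k" for i
        proof -
          have "a \<le> K * max (N (f \<omega> - x i \<omega>)) (N (x i \<omega> - l \<omega>))"
            using K(2)[of "f \<omega> - x i \<omega>" "x i \<omega> - l \<omega>"] by (simp add: a_def)
          moreover have "K * N (x i \<omega> - l \<omega>) < a" using k[OF i] K(1) by (simp add: field_simps)
          ultimately have "a \<le> K * N (f \<omega> - x i \<omega>)" by (auto simp: max_def split: if_splits)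
          then have "s / K * a \<le> s / K * (K * N (f \<omega> - x i \<omega>))"
            using s K(1) by (intro mult_left_mono) auto
          then show ?thesis using s a(1) K(1) by (intro M_mono elim) auto
        qed
        then have "\<forall>\<^sub>F i in sequentially. M \<omega> (s / K * a) \<le> M \<omega> (s * N (f \<omega> - x i \<omega>))"
          unfolding eventually_sequentially by blast
        then show ?thesis unfolding a_def by (rule Liminf_bounded)
      qed
    qed
  qed
  also have "\<dots> \<le> liminf (\<lambda>i. J s (\<lambda>\<omega>. f \<omega> - x i \<omega>))"
    unfolding J_def using J_measurable[OF meas s] by (intro nn_integral_liminf)
  also have "\<dots> \<le> limsup (\<lambda>i. J s (\<lambda>\<omega>. f \<omega> - x i \<omega>))" by (intro Liminf_le_Limsup) simp
  also have "\<dots> \<le> c"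
    using bound by (intro Limsup_bounded) (auto simp: eventually_sequentially)
  finally show ?thesis .
qed

text \<open>The terms of the series eventually drop below a positive value
  \<open>M \<omega> t\<close>, which by monotonicity bounds the steps by \<open>t / K ^ i\<close>.
  In \<open>chain\<close> the first step is split off: the bound \<open>K * (t / K ^ Suc i)\<close>
  for the rest equals the bound \<open>t / K ^ i\<close> for that step, so the constants do not grow
  with the number of steps.\<close>

lemma Cauchy_pointwise:
  assumes \<omega>: "\<omega> \<in> space \<mu>" and sum: "(\<Sum>i. M \<omega> (K ^ i * N (x (Suc i) - x i))) \<noteq> \<infinity>"
  shows "X.Cauchy_seq x"
proof -
  have K0: "K > 0" using K(1) by simp
  obtain t where t: "t > 0" "M \<omega> t > 0" using Orlicz_function_pos[OF Orlicz[OF \<omega>]] by blast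
  have "\<forall>\<^sub>F i in sequentially. M \<omega> (K ^ i * N (x (Suc i) - x i)) < M \<omega> t"
    using suminf_ennreal_tendsto_0[OF sum] t(2) by (rule order_tendstoD(2))
  then obtain k where k: "\<And>i. i \<ge> k \<Longrightarrow> M \<omega> (K ^ i * N (x (Suc i) - x i)) < M \<omega> t"
    unfolding eventually_sequentially by blast
  have step: "N (x (Suc i) - x i) \<le> t / K ^ i" if "i \<ge> k" for i
  proof -
    have "K ^ i * N (x (Suc i) - x i) \<le> t"
      using k[OF that] M_mono[OF \<omega>, of t "K ^ i * N (x (Suc i) - x i)"] t(1)
      by (meson less_imp_le linorder_not_le)
    then show ?thesis using K0 by (simp add: field_simps)
  qed
  have chain: "N (x (i + j) - x i) \<le> K * (t / K ^ i)" if "i \<ge> k" for i j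
    using that
  proof (induction j arbitrary: i)
    case 0
    then show ?case using K0 t(1) by (simp add: N_zero)
  next
    case (Suc j)
    have "N (x (Suc i + j) - x (Suc i)) \<le> K * (t / K ^ Suc i)" using Suc by (intro Suc.IH) simp
    also have "\<dots> = t / K ^ i" using K0 by simp
    finally have "max (N (x (Suc i + j) - x (Suc i))) (N (x (Suc i) - x i)) \<le> t / K ^ i"
      using step[OF Suc.prems] by simp
    then have "K * max (N (x (Suc i + j) - x (Suc i))) (N (x (Suc i) - x i)) \<le> K * (t / K ^ i)"
      using K0 by (intro mult_left_mono) auto
    then show ?case using K(2)[of "x (Suc i + j) - x (Suc i)" "x (Suc i) - x i"] by simp
  qed
  have "\<exists>p. \<forall>m\<ge>p. \<forall>n\<ge>p. N (x m - x n) < r" if r: "r > 0" for r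
  proof -
    have "norm (1 / K) < 1" using K(1) by simp
    then have "(\<lambda>i. (1 / K) ^ i) \<longlonglongrightarrow> 0" by (rule LIMSEQ_power_zero)
    then have "(\<lambda>i. K * (t * (1 / K) ^ i)) \<longlonglongrightarrow> K * (t * 0)" by (intro tendsto_mult tendsto_const)
    then have "\<forall>\<^sub>F i in sequentially. K * (t * (1 / K) ^ i) < r / K"
      by (rule order_tendstoD(2)) (use r K0 in simp)
    then obtain p0 where p0: "\<And>i. i \<ge> p0 \<Longrightarrow> K * (t * (1 / K) ^ i) < r / K"
      unfolding eventually_sequentially by blast
    define p where "p = max p0 k"
    have near: "N (x m - x p) < r / K" if m: "m \<ge> p" for m
    proof -
      obtain j where j: "m = p + j" using m le_Suc_ex by blast
      have "N (x m - x p) \<le> K * (t / K ^ p)" unfolding j by (rule chain) (simp add: p_def)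
      also have "\<dots> < r / K" using p0[of p] by (simp add: p_def power_one_over)
      finally show ?thesis .
    qed
    have "N (x m - x n) < r" if mn: "m \<ge> p" "n \<ge> p" for m n
      using near[OF mn(1)] near[OF mn(2)] N_diff_commute[of "x n" "x p"]
      by (auto intro!: N_diff_less[of "x m" "x p" r "x n"])
    then show ?thesis by blast
  qed
  then show ?thesis by (simp add: X.Cauchy_seq_def diff_eq)
qed

lemma LM_sequentially_complete:
  assumes "E.Cauchy_seq y"
  shows "\<exists>l. E.converges_to y l"
proof -
  have yV: "y n \<in> V" for n using assms by (auto simp: E.Cauchy_seq_def)
  then have "\<forall>n. \<exists>f\<in>SM. y n = cls f" unfolding in_LM_iff by blast
  then obtain f where f: "\<And>n. f n \<in> SM" "\<And>n. y n = cls (f n)" by metis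
  obtain A g where A: "separable_subspace A" and g: "\<And>n. g n \<in> measurable \<mu> borel_X"
    "\<And>n \<omega>. \<omega> \<in> space \<mu> \<Longrightarrow> g n \<omega> \<in> cl A" and fg: "\<And>n. AE \<omega> in \<mu>. f n \<omega> = g n \<omega>"
    by (rule strongly_measurable_representatives[of f \<mu>, OF f(1)]) (rule that)
  have gSM: "g n \<in> SM" for n using strongly_measurableI[OF g(1) A] g(2) by simp
  have yg: "y n = cls (g n)" for n unfolding f(2) using fg by (rule cls_eqI)
  have diff_meas: "(\<lambda>\<omega>. g m \<omega> - g n \<omega>) \<in> measurable \<mu> borel_X" for m n
    using measurable_diff[OF A g(1) g(2) g(1) g(2)] .
  have "J (1 / r) (\<lambda>\<omega>. g m \<omega> - g n \<omega>) < ennreal r" if r: "fnorm (E.diff (y m) (y n)) < r" for m n r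
  proof -
    obtain h where h: "h \<in> SM" "E.diff (y m) (y n) = cls h" "AE \<omega> in \<mu>. h \<omega> = g m \<omega> - g n \<omega>"
      using diff_cls[OF gSM[of m] gSM[of n]] unfolding yg by blast
    have "E.diff (y m) (y n) \<in> V" using yV by (intro E.diff_closed)
    then have "J (1 / r) h < ennreal r" using fnorm_lessD(2)[OF h(1), of r] r unfolding h(2) by simp
    then show ?thesis using J_cong[OF h(3)] by simp
  qed
  then have Cauchy: "\<exists>k. \<forall>m\<ge>k. \<forall>n\<ge>k. J (1 / r) (\<lambda>\<omega>. g m \<omega> - g n \<omega>) < ennreal r" if "r > 0" for r
    using assms that unfolding E.Cauchy_seq_def by meson
  have K0: "K > 0" using K(1) by simp
  \<comment> \<open>Radius \<open>(1 / K) ^ i\<close> in the Cauchy condition: its inverse is the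
    growing scale required by \<open>Cauchy_pointwise\<close>, and it is itself a summable
    bound.\<close>
  have "\<forall>i. \<exists>k. \<forall>m\<ge>k. \<forall>n\<ge>k. J (K ^ i) (\<lambda>\<omega>. g m \<omega> - g n \<omega>) < ennreal ((1 / K) ^ i)"
  proof
    fix i
    show "\<exists>k. \<forall>m\<ge>k. \<forall>n\<ge>k. J (K ^ i) (\<lambda>\<omega>. g m \<omega> - g n \<omega>) < ennreal ((1 / K) ^ i)"
      using Cauchy[of "(1 / K) ^ i"] K0 by (simp add: power_one_over)
  qed
  then obtain k where k: "\<And>i m n. m \<ge> k i \<Longrightarrow> n \<ge> k i \<Longrightarrow>
      J (K ^ i) (\<lambda>\<omega>. g m \<omega> - g n \<omega>) < ennreal ((1 / K) ^ i)"
    by metis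
  \<comment> \<open>A sum of all earlier thresholds, so that both \<open>q i\<close> and
    \<open>q (Suc i)\<close> are beyond \<open>k i\<close>; the \<open>Suc\<close> ensures
    \<open>q i \<ge> i\<close>, so the subsequence eventually passes every index.\<close>
  define q where "q i = (\<Sum>j\<le>i. Suc (k j))" for i
  have q_k: "q i \<ge> k i" "q (Suc i) \<ge> k i" and q_ge: "q i \<ge> i" for i
  proof -
    have "Suc (k i) \<le> q i" unfolding q_def by (intro member_le_sum) auto
    then show "q i \<ge> k i" "q (Suc i) \<ge> k i" by (auto simp: q_def)
    show "q i \<ge> i" by (induction i) (auto simp: q_def)
  qed
  define d where "d i \<omega> = N (g (q (Suc i)) \<omega> - g (q i) \<omega>)" for i \<omega>
  have d_meas: "(\<lambda>\<omega>. M \<omega> (K ^ i * d i \<omega>)) \<in> borel_measurable \<mu>" for i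
    unfolding d_def using J_measurable[OF diff_meas] K0 by simp
  have "(\<integral>\<^sup>+\<omega>. (\<Sum>i. M \<omega> (K ^ i * d i \<omega>)) \<partial>\<mu>) = (\<Sum>i. \<integral>\<^sup>+\<omega>. M \<omega> (K ^ i * d i \<omega>) \<partial>\<mu>)"
    using d_meas by (rule nn_integral_suminf)
  also have "\<dots> \<le> (\<Sum>i. ennreal ((1 / K) ^ i))"
    using k[OF q_k(2) q_k(1)] unfolding d_def J_def by (intro suminf_le summableI) (simp add: less_imp_le)
  also have "\<dots> < \<infinity>"
  proof -
    have "norm (1 / K) < 1" using K(1) by simp
    then have "summable (\<lambda>i. (1 / K) ^ i)" by (rule summable_geometric)
    then have "(\<Sum>i. ennreal ((1 / K) ^ i)) \<noteq> top" using K0 by (intro ennreal_suminf_neq_top) auto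
    then show ?thesis unfolding infinity_ennreal_def less_top .
  qed
  finally have "AE \<omega> in \<mu>. (\<Sum>i. M \<omega> (K ^ i * d i \<omega>)) \<noteq> \<infinity>"
    using d_meas by (intro nn_integral_PInf_AE) auto
  with AE_space[of \<mu>] have "AE \<omega> in \<mu>. X.Cauchy_seq (\<lambda>i. g (q i) \<omega>)"
    by eventually_elim (rule Cauchy_pointwise, simp_all add: d_def)
  then obtain Z where Z: "\<And>\<omega>. \<omega> \<in> space \<mu> - Z \<Longrightarrow> X.Cauchy_seq (\<lambda>i. g (q i) \<omega>)"
    "Z \<in> null_sets \<mu>"
    by (rule AE_E3) blast
  \<comment> \<open>With value 0 on the null set the subsequence converges at every point, as
    \<open>measurable_limit\<close> demands.\<close>
  define x where "x i \<omega> = (if \<omega> \<in> Z then 0 else g (q i) \<omega>)" for i \<omega>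
  have x_meas: "x i \<in> measurable \<mu> borel_X" for i
    unfolding x_def using Z(2) measurable_zero g(1) by (intro measurable_If_set) auto
  have x_cl: "x i \<omega> \<in> cl A" if "\<omega> \<in> space \<mu>" for i \<omega>
    using g(2)[OF that] separable_subspaceD(2)[OF A] by (simp add: x_def)
  have "\<exists>l. \<forall>r>0. \<exists>k. \<forall>i\<ge>k. N (x i \<omega> - l) < r" if \<omega>: "\<omega> \<in> space \<mu>" for \<omega>
  proof (cases "\<omega> \<in> Z")
    case True
    then show ?thesis by (intro exI[of _ 0]) (simp add: x_def N_zero)
  next
    case False
    then have "X.Cauchy_seq (\<lambda>i. g (q i) \<omega>)" using Z(1) \<omega> by blast
    then obtain l where "X.converges_to (\<lambda>i. g (q i) \<omega>) l"
      using X.Cauchy_seq_converges[OF complete] by blast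
    then show ?thesis using False by (intro exI[of _ l]) (simp add: X.converges_to_def diff_eq x_def)
  qed
  then have "\<forall>\<omega>. \<exists>l. \<omega> \<in> space \<mu> \<longrightarrow> (\<forall>r>0. \<exists>k. \<forall>i\<ge>k. N (x i \<omega> - l) < r)" by blast
  then obtain l where l: "\<And>\<omega> r. \<omega> \<in> space \<mu> \<Longrightarrow> r > 0 \<Longrightarrow> \<exists>k. \<forall>i\<ge>k. N (x i \<omega> - l \<omega>) < r"
    by metis
  note l_meas = measurable_limit[OF separable_subspaceD(1)[OF A] x_meas x_cl l]
  have lSM: "l \<in> SM" using strongly_measurableI[OF l_meas(1) A] l_meas(2) by simp
  have x_eq: "AE \<omega> in \<mu>. g (q i) \<omega> = x i \<omega>" for i
    using AE_not_in[OF Z(2)] by eventually_elim (simp add: x_def)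
  have close: "\<exists>p. \<forall>m\<ge>p. J (1 / (r / 2)) (\<lambda>\<omega>. g m \<omega> - l \<omega>) < ennreal (r / 2)" if r: "r > 0" for r
  proof -
    \<comment> \<open>The divisor \<open>K\<close> compensates the loss in \<open>J_limit\<close>:
      at scale \<open>1 / t\<close> that lemma ends at scale \<open>1 / (r / 2)\<close>, with bound
      \<open>t < r / 2\<close>.\<close>
    define t where "t = r / (2 * K)"
    have t: "t > 0" "t < r / 2" "1 / t / K = 1 / (r / 2)" using r K(1) by (auto simp: t_def field_simps)
    obtain p where p: "\<And>m n. m \<ge> p \<Longrightarrow> n \<ge> p \<Longrightarrow> J (1 / t) (\<lambda>\<omega>. g m \<omega> - g n \<omega>) < ennreal t"
      using Cauchy[OF t(1)] by blast
    have "J (1 / (r / 2)) (\<lambda>\<omega>. g m \<omega> - l \<omega>) < ennreal (r / 2)" if m: "m \<ge> p" for m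
    proof -
      have "J (1 / t / K) (\<lambda>\<omega>. g m \<omega> - l \<omega>) \<le> ennreal t"
      proof (rule J_limit)
        show "(\<lambda>\<omega>. g m \<omega> - x i \<omega>) \<in> measurable \<mu> borel_X" for i
          using measurable_diff[OF A g(1) g(2) x_meas x_cl] .
        show "AE \<omega> in \<mu>. \<forall>r>0. \<exists>k. \<forall>i\<ge>k. N (x i \<omega> - l \<omega>) < r" using l by (intro AE_I2) blast
        show "J (1 / t) (\<lambda>\<omega>. g m \<omega> - x i \<omega>) \<le> ennreal t" if i: "i \<ge> p" for i
        proof -
          have "AE \<omega> in \<mu>. g m \<omega> - x i \<omega> = g m \<omega> - g (q i) \<omega>" using x_eq[of i] by eventually_elim simp
          then have "J (1 / t) (\<lambda>\<omega>. g m \<omega> - x i \<omega>) = J (1 / t) (\<lambda>\<omega>. g m \<omega> - g (q i) \<omega>)" by (rule J_cong)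
          also have "\<dots> \<le> ennreal t" using p[OF m, of "q i"] q_ge[of i] i by (simp add: less_imp_le)
          finally show ?thesis .
        qed
        show "1 / t \<ge> 0" using t by simp
      qed
      also have "\<dots> < ennreal (r / 2)" using t by (intro ennreal_lessI) auto
      finally show ?thesis unfolding t(3) .
    qed
    then show ?thesis by blast
  qed
  \<comment> \<open>The limit is \<open>g m\<close> minus the difference \<open>g m - l\<close>;
    both have finite modular at some scale.\<close>
  have lV: "cls l \<in> V"
  proof -
    obtain m where m: "J (1 / (1 / 2)) (\<lambda>\<omega>. g m \<omega> - l \<omega>) < ennreal (1 / 2)" using close[of 1] by auto
    obtain u where u: "u > 0" "J u (g m) < \<infinity>" using yV[of m] unfolding yg cls_LM_iff[OF gSM] by blast
    obtain h where h: "h \<in> SM" "AE \<omega> in \<mu>. h \<omega> = g m \<omega> - l \<omega>" using diff_cls[OF gSM lSM] by blast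
    have "J 2 h = J 2 (\<lambda>\<omega>. g m \<omega> - l \<omega>)" using h(2) by (rule J_cong)
    also have "\<dots> < \<infinity>" using less_trans[OF m ennreal_less_top] by simp
    finally have "J 2 (\<lambda>\<omega>. scl (- 1) (h \<omega>)) < \<infinity>" unfolding J_scl by simp
    moreover have "AE \<omega> in \<mu>. l \<omega> = g m \<omega> + scl (- 1) (h \<omega>)"
      using h(2) by eventually_elim (simp add: scl_minus_one)
    ultimately have "\<exists>w>0. J w l < \<infinity>"
      using LM_add_closed[OF gSM u SM_scl[OF h(1), of "- 1"], of 2 l] by simp
    then show ?thesis using cls_LM_iff[OF lSM] by blast
  qed
  have "\<exists>p. \<forall>m\<ge>p. fnorm (E.diff (y m) (cls l)) < r" if r: "r > 0" for r
  proof -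
    obtain p where p: "\<And>m. m \<ge> p \<Longrightarrow> J (1 / (r / 2)) (\<lambda>\<omega>. g m \<omega> - l \<omega>) < ennreal (r / 2)"
      using close[OF r] by blast
    have "fnorm (E.diff (y m) (cls l)) < r" if m: "m \<ge> p" for m
    proof -
      obtain h where h: "h \<in> SM" "E.diff (y m) (cls l) = cls h" "AE \<omega> in \<mu>. h \<omega> = g m \<omega> - l \<omega>"
        using diff_cls[OF gSM[of m] lSM] unfolding yg by blast
      have "J (1 / (r / 2)) h < ennreal (r / 2)" using p[OF m] J_cong[OF h(3)] by simp
      then have "fnorm (cls h) \<le> r / 2" using h(1) r by (intro fnorm_le) auto
      then show ?thesis unfolding h(2) using r by simp
    qed
    then show ?thesis by blast
  qed
  then have "E.converges_to y (cls l)" unfolding E.converges_to_def using lV by blast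
  then show ?thesis by blast
qed

lemma complete_LM: "complete_vector_topology add zero smul E.T"
  using LM_sequentially_complete by (rule E.complete_vector_topology_T)

end

context musielak_orlicz
begin

section \<open>Neighbourhood bases and the Luxemburg quasi-norm\<close>

text \<open>The dilation moves into the scale of the modular, so both parameters of the
  neighbourhood become visible in one inequality.\<close>

lemma scaled_BM_iff:
  assumes u: "u > 0"
  shows "F \<in> smul (of_real u) ` BM \<mu> M scl N \<epsilon> \<longleftrightarrow> (\<exists>f\<in>SM. F = cls f \<and> J (1 / u) f < ennreal \<epsilon>)"
proof
  assume "F \<in> smul (of_real u) ` BM \<mu> M scl N \<epsilon>"
  then obtain G where G: "F = smul (of_real u) G" "G \<in> BM \<mu> M scl N \<epsilon>" by blast
  then obtain g0 g where g0: "g0 \<in> SM" "G = cls g0" and g: "g \<in> G" "J 1 g < ennreal \<epsilon>"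
    by (auto simp: BM_def L0_eq J_def)
  have gG: "g \<in> SM" "G = cls g" using g(1) mem_clsD[of g g0] cls_eqI[of g0 g] unfolding g0(2) by auto
  have "J (1 / u) (\<lambda>\<omega>. scl (of_real u) (g \<omega>)) = J 1 g" using u by (simp add: J_scl)
  then show "\<exists>f\<in>SM. F = cls f \<and> J (1 / u) f < ennreal \<epsilon>"
    using g(2) SM_scl[OF gG(1)] unfolding G(1) gG(2) smul_cls[OF gG(1)] by metis
next
  assume "\<exists>f\<in>SM. F = cls f \<and> J (1 / u) f < ennreal \<epsilon>"
  then obtain f where f: "f \<in> SM" "F = cls f" "J (1 / u) f < ennreal \<epsilon>" by blast
  define g where "g = (\<lambda>\<omega>. scl (of_real (1 / u)) (f \<omega>))"
  have g: "g \<in> SM" unfolding g_def by (rule SM_scl[OF f(1)])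
  have "J 1 g < ennreal \<epsilon>" using f(3) u unfolding g_def J_scl by (simp add: norm_divide)
  then have "cls g \<in> BM \<mu> M scl N \<epsilon>"
    using g cls_mem[OF g] by (auto simp: BM_def L0_eq J_def)
  moreover have "smul (of_real u) (cls g) = F"
    using u unfolding smul_cls[OF g] f(2) by (simp add: g_def X.smul_smul X.smul_one flip: of_real_mult)
  ultimately show "F \<in> smul (of_real u) ` BM \<mu> M scl N \<epsilon>" by blast
qed

lemma BM_iff: "F \<in> BM \<mu> M scl N \<epsilon> \<longleftrightarrow> (\<exists>f\<in>SM. F = cls f \<and> J 1 f < ennreal \<epsilon>)"
proof -
  have "smul (of_real 1) G = G" if "G \<in> BM \<mu> M scl N \<epsilon>" for G
    using that L.smul_one[of G] by (simp add: BM_def)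
  then have "smul (of_real 1) ` BM \<mu> M scl N \<epsilon> = BM \<mu> M scl N \<epsilon>" by simp
  then show ?thesis using scaled_BM_iff[of 1 F \<epsilon>] by simp
qed

lemma J_finite_imp_LM: "f \<in> SM \<Longrightarrow> u > 0 \<Longrightarrow> J u f < ennreal \<epsilon> \<Longrightarrow> cls f \<in> V"
  using cls_LM_iff[of f] less_trans[OF _ ennreal_less_top, of "J u f" \<epsilon>] by auto

text \<open>The diagonal members with \<open>u = \<epsilon> = r / 2\<close> already lie in
  arbitrarily small balls, and the ball of radius \<open>min u \<epsilon>\<close> lies in the member
  with parameters \<open>u\<close> and \<epsilon>.\<close>

lemma nhds_basis_scaled_BM:
  "nhds_basis_at E.T zero {smul (of_real u) ` BM \<mu> M scl N \<epsilon> | u \<epsilon>. u > 0 \<and> \<epsilon> > 0}"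
proof (rule E.nhds_basis_at_zero)
  fix B assume "B \<in> {smul (of_real u) ` BM \<mu> M scl N \<epsilon> | u \<epsilon>. u > 0 \<and> \<epsilon> > 0}"
  then obtain u \<epsilon> where B: "B = smul (of_real u) ` BM \<mu> M scl N \<epsilon>" and pos: "u > 0" "\<epsilon> > 0" by blast
  note iff = scaled_BM_iff[OF pos(1), of _ \<epsilon>, folded B]
  have "F \<in> V" if F: "F \<in> B" for F
  proof -
    obtain f where f: "f \<in> SM" "F = cls f" "J (1 / u) f < ennreal \<epsilon>" using F unfolding iff by blast
    then show ?thesis using pos J_finite_imp_LM[of f "1 / u" \<epsilon>] by simp
  qed
  moreover have "F \<in> B" if F: "F \<in> V" "fnorm F < min u \<epsilon>" for F
  proof -
    obtain f where f: "f \<in> SM" "F = cls f" using F(1) unfolding in_LM_iff by blast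
    have "J (1 / u) f \<le> J (1 / min u \<epsilon>) f" using pos by (intro J_mono) (auto simp: frac_le)
    also have "\<dots> < ennreal (min u \<epsilon>)" using fnorm_lessD(2)[of f "min u \<epsilon>"] f F by simp
    also have "\<dots> \<le> ennreal \<epsilon>" by (intro ennreal_leI) simp
    finally show ?thesis unfolding iff using f by blast
  qed
  moreover have "min u \<epsilon> > 0" using pos by simp
  ultimately show "B \<subseteq> V \<and> (\<exists>r>0. \<forall>x\<in>V. fnorm x < r \<longrightarrow> x \<in> B)" by blast
next
  fix r :: real assume r: "r > 0"
  have "fnorm F < r" if F: "F \<in> smul (of_real (r / 2)) ` BM \<mu> M scl N (r / 2)" for F
  proof -
    obtain f where f: "f \<in> SM" "F = cls f" "J (1 / (r / 2)) f < ennreal (r / 2)"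
      using F scaled_BM_iff[of "r / 2"] r by auto
    then have "fnorm F \<le> r / 2" using r fnorm_le[of f "r / 2"] by simp
    then show ?thesis using r by simp
  qed
  then show "\<exists>B\<in>{smul (of_real u) ` BM \<mu> M scl N \<epsilon> | u \<epsilon>. u > 0 \<and> \<epsilon> > 0}. \<forall>x\<in>B. fnorm x < r"
    using r by (intro bexI[of _ "smul (of_real (r / 2)) ` BM \<mu> M scl N (r / 2)"])
      (auto intro!: exI[of _ "r / 2"])
qed

text \<open>Iterates a pointwise growth condition. It serves both hypotheses: \<open>c = 2\<close>
  with a large \<open>d\<close>, and \<open>c\<close>, \<open>d\<close> below 1.\<close>

lemma J_scaling:
  assumes M: "\<And>\<omega> s. \<omega> \<in> space \<mu> \<Longrightarrow> s \<ge> 0 \<Longrightarrow> M \<omega> (c * s) \<le> ennreal d * M \<omega> s"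
    and c: "c \<ge> 0" and d: "d \<ge> 0" and f: "f \<in> SM" and s: "s \<ge> 0"
  shows "J (c ^ n * s) f \<le> ennreal (d ^ n) * J s f"
proof (induction n)
  case (Suc n)
  define t where "t = c ^ n * s"
  have t: "t \<ge> 0" using c s by (simp add: t_def)
  have "J (c * t) f \<le> (\<integral>\<^sup>+\<omega>. ennreal d * M \<omega> (t * N (f \<omega>)) \<partial>\<mu>)"
    unfolding J_def mult.assoc using t N_nonneg by (intro nn_integral_mono M) auto
  also have "\<dots> = ennreal d * J t f"
    unfolding J_def using J_measurable[OF SM_measurable[OF f] t] by (rule nn_integral_cmult)
  also have "\<dots> \<le> ennreal d * (ennreal (d ^ n) * J s f)"
    using Suc unfolding t_def by (intro mult_left_mono) auto
  also have "\<dots> = ennreal (d ^ Suc n) * J s f"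
    using d by (simp add: ennreal_mult mult.assoc)
  finally show ?case by (simp add: t_def mult.assoc)
qed simp

section \<open>Modulars with the doubling condition\<close>

context
  fixes D :: real
  assumes D: "D > 1"
    and M_double: "\<And>\<omega> s. \<omega> \<in> space \<mu> \<Longrightarrow> s \<ge> 0 \<Longrightarrow> M \<omega> (2 * s) \<le> ennreal D * M \<omega> s"
begin

text \<open>The number of doublings depends on \<open>s / t\<close> alone. This uniformity in
  \<open>f\<close> lets the scale disappear from the neighbourhood basis.\<close>

lemma J_le_doubling:
  assumes s: "s \<ge> 0" and t: "t > 0"
  shows "\<exists>n. \<forall>f\<in>SM. J s f \<le> ennreal (D ^ n) * J t f"
proof -
  obtain n where "s / t < 2 ^ n" using real_arch_pow[of 2 "s / t"] by auto
  then have n: "s \<le> 2 ^ n * t" using t by (simp add: field_simps)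
  have "J s f \<le> ennreal (D ^ n) * J t f" if f: "f \<in> SM" for f
  proof -
    have "J s f \<le> J (2 ^ n * t) f" using n s by (intro J_mono)
    also have "\<dots> \<le> ennreal (D ^ n) * J t f" using J_scaling[OF M_double, of f t n] D f t by simp
    finally show ?thesis .
  qed
  then show ?thesis by blast
qed

lemma nhds_basis_BM: "nhds_basis_at E.T zero {BM \<mu> M scl N \<epsilon> | \<epsilon>. \<epsilon> > 0}"
proof (rule E.nhds_basis_at_zero)
  fix B assume "B \<in> {BM \<mu> M scl N \<epsilon> | \<epsilon>. \<epsilon> > 0}"
  then obtain \<epsilon> where B: "B = BM \<mu> M scl N \<epsilon>" and \<epsilon>: "\<epsilon> > 0" by blast
  note iff = BM_iff[of _ \<epsilon>, folded B]
  have "F \<in> V" if F: "F \<in> B" for F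
  proof -
    obtain f where f: "f \<in> SM" "F = cls f" "J 1 f < ennreal \<epsilon>" using F unfolding iff by blast
    then show ?thesis using J_finite_imp_LM[of f 1 \<epsilon>] by simp
  qed
  moreover have "F \<in> B" if F: "F \<in> V" "fnorm F < min 1 \<epsilon>" for F
  proof -
    obtain f where f: "f \<in> SM" "F = cls f" using F(1) unfolding in_LM_iff by blast
    have "J 1 f \<le> J (1 / min 1 \<epsilon>) f" using \<epsilon> by (intro J_mono) (auto simp: min_def)
    also have "\<dots> < ennreal (min 1 \<epsilon>)" using fnorm_lessD(2)[of f "min 1 \<epsilon>"] f F by simp
    also have "\<dots> \<le> ennreal \<epsilon>" by (intro ennreal_leI) simp
    finally show ?thesis unfolding iff using f by blast
  qed
  moreover have "min 1 \<epsilon> > 0" using \<epsilon> by simp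
  ultimately show "B \<subseteq> V \<and> (\<exists>r>0. \<forall>x\<in>V. fnorm x < r \<longrightarrow> x \<in> B)" by blast
next
  fix r :: real assume r: "r > 0"
  obtain n where n: "\<And>f. f \<in> SM \<Longrightarrow> J (1 / (r / 2)) f \<le> ennreal (D ^ n) * J 1 f"
    using J_le_doubling[of "1 / (r / 2)" 1] r by auto
  \<comment> \<open>Chosen so that \<epsilon>, after multiplication by \<open>D ^ n\<close>, becomes
    \<open>r / 4\<close>, strictly below \<open>r / 2\<close>.\<close>
  define \<epsilon> where "\<epsilon> = r / 4 / D ^ n"
  have \<epsilon>: "\<epsilon> > 0" using r D by (simp add: \<epsilon>_def)
  have "fnorm F < r" if F: "F \<in> BM \<mu> M scl N \<epsilon>" for F
  proof -
    obtain f where f: "f \<in> SM" "F = cls f" "J 1 f < ennreal \<epsilon>" using F unfolding BM_iff by blast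
    have "J (1 / (r / 2)) f \<le> ennreal (D ^ n) * J 1 f" using n f(1) .
    also have "\<dots> \<le> ennreal (D ^ n) * ennreal \<epsilon>" using f(3) by (intro mult_left_mono) auto
    also have "\<dots> = ennreal (r / 4)" using D \<epsilon> by (simp add: \<epsilon>_def flip: ennreal_mult)
    also have "\<dots> < ennreal (r / 2)" using r by (intro ennreal_lessI) auto
    finally have "fnorm F \<le> r / 2" unfolding f(2) using r f(1) by (intro fnorm_le) auto
    then show ?thesis using r by simp
  qed
  then show "\<exists>B\<in>{BM \<mu> M scl N \<epsilon> | \<epsilon>. \<epsilon> > 0}. \<forall>x\<in>B. fnorm x < r" using \<epsilon> by blast
qed

lemma LM_eq_modular_finite: "V = {F \<in> L. \<exists>f\<in>F. (\<integral>\<^sup>+\<omega>. M \<omega> (N (f \<omega>)) \<partial>\<mu>) < \<infinity>}"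
proof (rule set_eqI, rule iffI)
  fix F assume F: "F \<in> V"
  then obtain f u where f: "f \<in> SM" "F = cls f" "u > 0" "J u f < \<infinity>" unfolding in_LM_iff by blast
  obtain n where "J 1 f \<le> ennreal (D ^ n) * J u f" using J_le_doubling[of 1 u] f by auto
  also have "\<dots> < \<infinity>" using f(4) by (simp add: ennreal_mult_less_top)
  finally have "J 1 f < \<infinity>" .
  moreover have "F \<in> L" using F by (simp add: LM_def)
  moreover have "f \<in> F" using f cls_mem by simp
  ultimately show "F \<in> {F \<in> L. \<exists>f\<in>F. (\<integral>\<^sup>+\<omega>. M \<omega> (N (f \<omega>)) \<partial>\<mu>) < \<infinity>}" unfolding J_def by auto
next
  fix F assume "F \<in> {F \<in> L. \<exists>f\<in>F. (\<integral>\<^sup>+\<omega>. M \<omega> (N (f \<omega>)) \<partial>\<mu>) < \<infinity>}"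
  then show "F \<in> V" unfolding LM_def by (auto intro!: exI[of _ 1])
qed

end

section \<open>The Luxemburg functional and the condition of part (b)\<close>

abbreviation lux :: "('w \<Rightarrow> 'x) set \<Rightarrow> real"
  where "lux \<equiv> Luxemburg \<mu> M N"

lemma lux_eq: "lux = gauge (\<lambda>_. 1)"
  by (intro ext) (simp add: Luxemburg_def gauge_def J_def)

lemma lux_le: "f \<in> SM \<Longrightarrow> t > 0 \<Longrightarrow> J (1 / t) f < 1 \<Longrightarrow> lux (cls f) \<le> t"
  unfolding lux_eq by (rule gauge_le)

context
  fixes c d :: real
  assumes c: "0 < c" "c < 1" and d: "0 < d" "d < 1"
    and M_shrink: "\<And>\<omega> s. \<omega> \<in> space \<mu> \<Longrightarrow> s \<ge> 0 \<Longrightarrow> M \<omega> (c * s) \<le> ennreal d * M \<omega> s"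
begin

lemma J_shrink: "f \<in> SM \<Longrightarrow> s \<ge> 0 \<Longrightarrow> J (c ^ n * s) f \<le> ennreal (d ^ n) * J s f"
  using J_scaling[OF M_shrink] c d by simp

lemma lux_finite:
  assumes f: "f \<in> SM" "cls f \<in> V"
  shows "\<exists>t>0. J (1 / t) f < 1"
proof -
  obtain u where u: "u > 0" "J u f < \<infinity>" using f cls_LM_iff by blast
  define a where "a = enn2real (J u f)"
  have a: "J u f = ennreal a" "a \<ge> 0" using u by (auto simp: a_def)
  \<comment> \<open>A finite modular value \<open>a\<close> is brought below 1 by \<open>n\<close>
    shrinkings; \<open>a + 1\<close> keeps the denominator positive when
    \<open>a = 0\<close>.\<close>
  obtain n where "d ^ n < 1 / (a + 1)" using real_arch_pow_inv[of "1 / (a + 1)" d] a(2) d by auto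
  then have n: "d ^ n * a < 1" using a(2) d
    by (smt (verit) mult_left_mono pos_less_divide_eq zero_less_power)
  have "J (c ^ n * u) f \<le> ennreal (d ^ n) * J u f" using f(1) u by (intro J_shrink) auto
  also have "\<dots> = ennreal (d ^ n * a)" using a d by (simp add: ennreal_mult)
  also have "\<dots> < 1" using n by simp
  finally have "J (1 / (1 / (c ^ n * u))) f < 1" by simp
  moreover have "1 / (c ^ n * u) > 0" using c u by simp
  ultimately show ?thesis by blast
qed

lemma lux_lessD:
  assumes "f \<in> SM" "cls f \<in> V" "lux (cls f) < r"
  shows "r > 0" "J (1 / r) f < 1"
proof -
  obtain t where t: "t > 0" "J (1 / t) f < 1" using lux_finite assms(1,2) by blast
  have mono: "mono (\<lambda>_::real. 1::ennreal)" by (rule monoI) simp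
  note * = gauge_lessD[OF mono assms(1) t, of r]
  show "r > 0" "J (1 / r) f < 1" using * assms(3) unfolding lux_eq by auto
qed

lemma lux_nonneg:
  assumes "F \<in> V"
  shows "lux F \<ge> 0"
proof -
  obtain f where f: "f \<in> SM" "F = cls f" using assms unfolding in_LM_iff by blast
  then obtain t where "t > 0" "J (1 / t) f < 1" using lux_finite assms by blast
  then show ?thesis unfolding lux_eq f(2) using f(1) by (intro gauge_nonneg)
qed

text \<open>The Luxemburg functional controls the modular only at level 1. Shrinking the scale by
  \<open>c ^ n\<close> lowers the level to \<open>d ^ n < r / 2\<close>, which is why
  \<open>s\<close> carries the factor \<open>c ^ n\<close>.\<close>

lemma lux_small_imp_fnorm_small:
  assumes r: "r > 0"
  shows "\<exists>s>0. \<forall>F\<in>V. lux F < s \<longrightarrow> fnorm F < r"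
proof -
  obtain n where n: "d ^ n < r / 2" using real_arch_pow_inv[of "r / 2" d] r d by auto
  define s where "s = c ^ n * (r / 2)"
  have s: "s > 0" "c ^ n * (1 / s) = 1 / (r / 2)" using c r by (auto simp: s_def)
  have "fnorm F < r" if F: "F \<in> V" "lux F < s" for F
  proof -
    obtain f where f: "f \<in> SM" "F = cls f" using F(1) unfolding in_LM_iff by blast
    have J1: "J (1 / s) f < 1" using lux_lessD(2) f F by blast
    have "J (1 / (r / 2)) f = J (c ^ n * (1 / s)) f" by (simp only: s(2))
    also have "\<dots> \<le> ennreal (d ^ n) * J (1 / s) f" using f(1) s by (intro J_shrink) auto
    also have "\<dots> \<le> ennreal (d ^ n) * 1" using J1 by (intro mult_left_mono) auto
    also have "\<dots> < ennreal (r / 2)" using n d r by (simp add: ennreal_less_iff)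
    finally have "fnorm F \<le> r / 2" unfolding f(2) using r f(1) by (intro fnorm_le) auto
    then show ?thesis using r by simp
  qed
  then show ?thesis using s(1) by blast
qed

lemma fnorm_small_imp_lux_small:
  assumes r: "r > 0"
  shows "\<exists>s>0. \<forall>F\<in>V. fnorm F < s \<longrightarrow> lux F < r"
proof -
  \<comment> \<open>The bound \<open>r / 2\<close> takes care of the scale, the bound 1 of the value
    of the modular.\<close>
  define s where "s = min 1 (r / 2)"
  have s: "s > 0" "s \<le> 1" "s \<le> r / 2" using r by (auto simp: s_def)
  have "lux F < r" if F: "F \<in> V" "fnorm F < s" for F
  proof -
    obtain f where f: "f \<in> SM" "F = cls f" using F(1) unfolding in_LM_iff by blast
    have "J (1 / (r / 2)) f \<le> J (1 / s) f" using s r by (intro J_mono frac_le) auto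
    also have "\<dots> < ennreal s" using fnorm_lessD(2)[of f s] f F by simp
    also have "\<dots> \<le> 1" using ennreal_leI[OF s(2)] by simp
    finally have "lux F \<le> r / 2" unfolding f(2) using r f(1) by (intro lux_le) auto
    then show ?thesis using r by simp
  qed
  then show ?thesis using s(1) by blast
qed

lemma lux_topology: "quasi_norm_topology V add lux = E.T"
  using fnorm_small_imp_lux_small lux_small_imp_fnorm_small by (rule E.topology_eqI)

text \<open>Definiteness is inherited from \<open>fnorm\<close>: where \<open>lux\<close> vanishes,
  the comparison makes \<open>fnorm\<close> smaller than every positive number.\<close>

lemma lux_pos:
  assumes F: "F \<in> V" "F \<noteq> zero"
  shows "lux F > 0"
proof (rule ccontr)
  assume "\<not> lux F > 0"
  then have "lux F = 0" using lux_nonneg[OF F(1)] by simp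
  then have "fnorm F < r" if "r > 0" for r
    using lux_small_imp_fnorm_small[OF that] F(1) by auto
  then have "fnorm F \<le> 0" by (meson less_irrefl not_le)
  then have "fnorm F = 0" using fnorm_nonneg[OF F(1)] by simp
  then show False using E.rho_zeroD F by blast
qed

lemma lux_smul_le:
  assumes F: "F \<in> V"
  shows "lux (smul a F) \<le> norm a * lux F"
proof -
  obtain f where f: "f \<in> SM" "F = cls f" using F unfolding in_LM_iff by blast
  note af = SM_scl[OF f(1), of a]
  show ?thesis
  proof (cases "a = 0")
    case True
    have "lux (smul a F) \<le> t" if "0 < t" for t
      unfolding f(2) smul_cls[OF f(1)] using af that
    proof (rule lux_le)
      have "J (1 / t) (\<lambda>\<omega>. scl a (f \<omega>)) = J (1 / t) (\<lambda>\<omega>. 0)"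
        using True X.smul_zero_left by simp
      then show "J (1 / t) (\<lambda>\<omega>. scl a (f \<omega>)) < 1" using J_zero by simp
    qed
    then have "lux (smul a F) \<le> 0" by (rule dense_ge)
    then show ?thesis using True by simp
  next
    case False
    then have a: "norm a > 0" by simp
    have "lux (smul a F) / norm a \<le> t" if t: "lux F < t" for t
    proof -
      have f': "t > 0" "J (1 / t) f < 1" using lux_lessD[of f t] f F t by auto
      have "J (1 / (norm a * t)) (\<lambda>\<omega>. scl a (f \<omega>)) < 1"
        unfolding J_scl using f' a by simp
      then have "lux (smul a F) \<le> norm a * t"
        unfolding f(2) smul_cls[OF f(1)] using f'(1) a af by (intro lux_le) auto
      then show ?thesis using a by (simp add: pos_divide_le_eq mult.commute)
    qed
    then have "lux (smul a F) / norm a \<le> lux F" by (rule dense_ge)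
    then show ?thesis using a by (simp add: pos_divide_le_eq mult.commute)
  qed
qed

text \<open>The reverse inequality is \<open>lux_smul_le\<close> for the inverse scalar.\<close>

lemma lux_smul:
  assumes F: "F \<in> V"
  shows "lux (smul a F) = norm a * lux F"
proof (rule antisym)
  show "norm a * lux F \<le> lux (smul a F)"
  proof (cases "a = 0")
    case True
    then show ?thesis using lux_nonneg[OF E.smul_closed[OF F, of a]] by simp
  next
    case False
    have "F = smul (inverse a) (smul a F)"
      using E.smul_smul[OF F, of "inverse a" a] E.smul_one[OF F] False by simp
    then have "lux F \<le> norm (inverse a) * lux (smul a F)"
      using lux_smul_le[OF E.smul_closed[OF F, of a], of "inverse a"] by simp
    then have "norm a * lux F \<le> norm a * (norm (inverse a) * lux (smul a F))"
      by (rule mult_left_mono) simp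
    then show ?thesis using False by (simp add: norm_inverse flip: mult.assoc)
  qed
qed (rule lux_smul_le[OF F])

text \<open>\<open>J_add\<close> bounds the modular of the sum by 2, where a value below 1 is
  required. With \<open>d ^ n < 1 / 4\<close>, \<open>n\<close> further shrinkings give a value
  below \<open>1 / 2\<close>; the scales \<open>1 / K\<close> and \<open>c ^ n\<close> spent on the
  way make up \<kappa>.\<close>

lemma lux_add: "\<exists>\<kappa>. \<forall>F\<in>V. \<forall>G\<in>V. lux (add F G) \<le> \<kappa> * (lux F + lux G)"
proof -
  obtain n where n: "d ^ n < 1 / 4" using real_arch_pow_inv[of "1 / 4" d] d by auto
  define \<kappa> where "\<kappa> = K / c ^ n"
  have \<kappa>: "\<kappa> > 0" using K(1) c by (simp add: \<kappa>_def)
  have "lux (add F G) \<le> \<kappa> * (lux F + lux G)" if F: "F \<in> V" and G: "G \<in> V" for F G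
  proof -
    obtain f where f: "f \<in> SM" "F = cls f" using F unfolding in_LM_iff by blast
    obtain g where g: "g \<in> SM" "G = cls g" using G unfolding in_LM_iff by blast
    note pl = rep_add[OF f(1) g(1)]
    have "lux (add F G) / \<kappa> \<le> t" if t: "lux F + lux G < t" for t
    proof -
      have "lux F < t" "lux G < t" using t lux_nonneg[OF F] lux_nonneg[OF G] by auto
      then have J1: "t > 0" "J (1 / t) f < 1" "J (1 / t) g < 1"
        using lux_lessD[of f t] lux_lessD[of g t] f g F G by auto
      have "J (1 / t / K) (rep_add f g) \<le> J (1 / t) f + J (1 / t) g"
        using J1(1) by (intro J_add SM_measurable f g pl) auto
      also have "\<dots> \<le> 1 + 1" using J1 by (intro add_mono) auto
      finally have J2: "J (1 / t / K) (rep_add f g) \<le> 2" by simp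
      have "1 / (\<kappa> * t) = c ^ n * (1 / t / K)" by (simp add: \<kappa>_def)
      then have "J (1 / (\<kappa> * t)) (rep_add f g) = J (c ^ n * (1 / t / K)) (rep_add f g)" by (rule arg_cong)
      also have "\<dots> \<le> ennreal (d ^ n) * J (1 / t / K) (rep_add f g)"
        using J1(1) K(1) pl(1) by (intro J_shrink) auto
      also have "\<dots> \<le> ennreal (d ^ n) * 2" using J2 by (intro mult_left_mono) auto
      also have "\<dots> = ennreal (d ^ n * 2)" using d by (simp add: ennreal_mult)
      also have "\<dots> < ennreal 1" using n by (intro ennreal_lessI) auto
      finally have "lux (add F G) \<le> \<kappa> * t"
        unfolding f(2) g(2) add_cls[OF f(1) g(1)] using \<kappa> J1(1) pl(1) by (intro lux_le) auto
      then show ?thesis using \<kappa> by (simp add: pos_divide_le_eq mult.commute)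
    qed
    then have "lux (add F G) / \<kappa> \<le> lux F + lux G" by (rule dense_ge)
    then show ?thesis using \<kappa> by (simp add: pos_divide_le_eq mult.commute)
  qed
  then show ?thesis by blast
qed

lemma quasi_Banach_LM: "quasi_Banach_space_on V add zero smul lux"
  unfolding quasi_Banach_space_on_def quasi_norm_on_def lux_topology
  using vector_space_on_LM lux_nonneg lux_pos lux_smul lux_add complete_LM by simp

end

end

theorem mainTheorem4:
  fixes \<mu> :: "'w measure"
    and M :: "'w \<Rightarrow> real \<Rightarrow> ennreal"
    and scl :: "'k::real_normed_field \<Rightarrow> 'x::ab_group_add \<Rightarrow> 'x"
    and N :: "'x \<Rightarrow> real"
  assumes "sigma_finite_measure \<mu>"
    and "Musielak_Orlicz_function \<mu> M"
    and "quasi_Banach_space_on UNIV (+) 0 scl N"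
    and "continuous_map (quasi_norm_top N) euclideanreal N"
  shows "\<exists>T :: ('w \<Rightarrow> 'x) set topology.
    vector_topology_on (LM \<mu> M scl N)
      (L0_add \<mu> scl N) (L0_zero \<mu> scl N) (L0_smult \<mu> scl N) T \<and>
    complete_vector_topology (L0_add \<mu> scl N) (L0_zero \<mu> scl N) (L0_smult \<mu> scl N) T \<and>
    metrizable_space T \<and>
    nhds_basis_at T (L0_zero \<mu> scl N)
      {L0_smult \<mu> scl N (of_real u) ` BM \<mu> M scl N \<epsilon> | u \<epsilon>. u > 0 \<and> \<epsilon> > 0} \<and>
    ((\<exists>D::real. D > 1 \<and> (\<forall>\<omega>\<in>space \<mu>. \<forall>s\<ge>0. M \<omega> (2 * s) \<le> ennreal D * M \<omega> s)) \<longrightarrow>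
      nhds_basis_at T (L0_zero \<mu> scl N) {BM \<mu> M scl N \<epsilon> | \<epsilon>. \<epsilon> > 0} \<and>
      LM \<mu> M scl N =
        {F \<in> L0 \<mu> scl N. \<exists>f\<in>F. (\<integral>\<^sup>+\<omega>. M \<omega> (N (f \<omega>)) \<partial>\<mu>) < \<infinity>}) \<and>
    ((\<exists>c d::real. 0 < c \<and> c < 1 \<and> 0 < d \<and> d < 1 \<and>
        (\<forall>\<omega>\<in>space \<mu>. \<forall>s\<ge>0. M \<omega> (c * s) \<le> ennreal d * M \<omega> s)) \<longrightarrow>
      quasi_Banach_space_on (LM \<mu> M scl N)
        (L0_add \<mu> scl N) (L0_zero \<mu> scl N) (L0_smult \<mu> scl N) (Luxemburg \<mu> M N) \<and>
      quasi_norm_topology (LM \<mu> M scl N) (L0_add \<mu> scl N) (Luxemburg \<mu> M N) = T)"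
proof -
  interpret musielak_orlicz scl N \<mu> M
    using assms by unfold_locales (auto simp: quasi_Banach_space_on_def)
  show ?thesis
  proof (intro exI[of _ E.T] conjI impI E.vector_topology_on_T complete_LM E.metrizable_space_T
      nhds_basis_scaled_BM)
    assume "\<exists>D::real. D > 1 \<and> (\<forall>\<omega>\<in>space \<mu>. \<forall>s\<ge>0. M \<omega> (2 * s) \<le> ennreal D * M \<omega> s)"
    then obtain D :: real where D: "D > 1"
      "\<And>\<omega> s. \<omega> \<in> space \<mu> \<Longrightarrow> s \<ge> 0 \<Longrightarrow> M \<omega> (2 * s) \<le> ennreal D * M \<omega> s"
      by blast
    show "nhds_basis_at E.T zero {BM \<mu> M scl N \<epsilon> | \<epsilon>. \<epsilon> > 0}"
      using D by (rule nhds_basis_BM)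
    show "V = {F \<in> L. \<exists>f\<in>F. (\<integral>\<^sup>+\<omega>. M \<omega> (N (f \<omega>)) \<partial>\<mu>) < \<infinity>}"
      using D by (rule LM_eq_modular_finite)
  next
    assume "\<exists>c d::real. 0 < c \<and> c < 1 \<and> 0 < d \<and> d < 1 \<and>
        (\<forall>\<omega>\<in>space \<mu>. \<forall>s\<ge>0. M \<omega> (c * s) \<le> ennreal d * M \<omega> s)"
    then obtain c d :: real where cd: "0 < c" "c < 1" "0 < d" "d < 1"
      "\<And>\<omega> s. \<omega> \<in> space \<mu> \<Longrightarrow> s \<ge> 0 \<Longrightarrow> M \<omega> (c * s) \<le> ennreal d * M \<omega> s"
      by blast
    show "quasi_Banach_space_on V add zero smul lux" using cd by (rule quasi_Banach_LM)
    show "quasi_norm_topology V add lux = E.T" using cd by (rule lux_topology)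
  qed
qed

end
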